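(* Let $g$ be an entire function on $\mathbb{C}$ and let $0<p\leq\infty$. Let $V_g$ be the Volterra-type integral operator $V_gf(z)=\int_0^z f(w)g'(w)\,dw$. Then: (i) $V_g:\mathcal{F}_p^\psi\to\mathcal{F}_\infty^\psi$ is bounded if and only if $$\sup_{z\in\mathbb{C}}\frac{|g'(z)|}{1+\psi'(z)}<\infty\ \text{ when } p=\infty,\qquad \sup_{z\in\mathbb{C}}\frac{|g'(z)|(\Delta\psi(z))^{1/p}}{1+\psi'(z)}<\infty\ \text{ when } 0<p<\infty.$$ (ii) $V_g:\mathcal{F}_p^\psi\to\mathcal{F}_\infty^\psi$ is compact if and only if $$\lim_{|z|\to\infty}\frac{|g'(z)|}{1+\psi'(z)}=0\ \text{ when } p=\infty,\qquad \lim_{|z|\to\infty}\frac{|g'(z)|(\Delta\psi(z))^{1/p}}{1+\psi'(z)}=0\ \text{ when } 0<p<\infty.$$ (iii) If $0<p<\infty$, then the following statements are equivalent: (a) $V_g:\mathcal{F}_\infty^\psi\to\mathcal{F}_p^\psi$ is bounded; (b) $V_g:\mathcal{F}_\infty^\psi\to\mathcal{F}_p^\psi$ is compact; (c) the function $\frac{g'}{1+\psi'}$ belongs to $L^p(\mathbb{C},dm)$.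
   Context: Notation: $U\simeq V$ means that there is a constant $C>0$ with $C^{-1}V\le U\le CV$ throughout the set in question. $dm$ is Lebesgue area measure on $\mathbb{C}$. Standing assumptions on the weight: $\psi:[0,\infty)\to[0,\infty)$ is twice continuously differentiable and is extended to $\mathbb{C}$ by $\psi(z)=\psi(|z|)$; likewise $\psi'(z)$ means $\psi'(|z|)$. The Laplacian $\Delta\psi$ of the extended function is positive. There is a positive, radial, differentiable function $\tau$ on $\mathbb{C}$ (write $\tau(z)=\tau(|z|)$) with $\tau(z)\simeq 1$ for $0\le|z|<1$ and $\tau(z)\simeq(\Delta\psi(z))^{-1/2}$ for $|z|\ge1$, such that $\lim_{r\to\infty}\tau(r)=0$ and $\lim_{r\to\infty}\tau'(r)=0$. In addition, either there exists a constant $C>0$ such that $\tau(r)r^C$ is increasing for large $r$, or $\lim_{r\to\infty}\tau'(r)\log\frac1{\tau(r)}=0$. Spaces: for $0<p<\infty$, $\mathcal{F}_p^\psi$ is the space of entire functions $f$ with $\|f\|_{\mathcal{F}_p^\psi}^p=\int_{\mathbb{C}}|f(z)|^pe^{-p\psi(z)}\,dm(z)<\infty$; $\mathcal{F}_\infty^\psi$ is the space of entire functions $f$ with $\|f\|_{\mathcal{F}_\infty^\psi}=\sup_{z\in\mathbb{C}}|f(z)|e^{-\psi(z)}<\infty$. A linear operator $T$ between two such spaces is bounded if it maps the first space into the second and there is a constant $C$ with $\|Tf\|\le C\|f\|$ for all $f$; it is compact if it maps bounded sets to relatively compact sets. *)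

theory Defs
  imports "HOL-Complex_Analysis.Complex_Analysis"
begin

definition partial_deriv :: "'a \<Rightarrow> ('a::real_vector \<Rightarrow> real) \<Rightarrow> 'a \<Rightarrow> real" where
  "partial_deriv v u x = deriv (\<lambda>t::real. u (x + t *\<^sub>R v)) 0"

definition partially_differentiable :: "'a \<Rightarrow> ('a::real_vector \<Rightarrow> real) \<Rightarrow> 'a \<Rightarrow> bool" where
  "partially_differentiable v u x \<longleftrightarrow> (\<lambda>t::real. u (x + t *\<^sub>R v)) field_differentiable (at 0)"

definition laplacian :: "('a::euclidean_space \<Rightarrow> real) \<Rightarrow> 'a \<Rightarrow> real" where
  "laplacian u x = (\<Sum>v\<in>Basis. partial_deriv v (partial_deriv v u) x)"

(* "deriv" is total, so the existence of the Laplacian has to be stated separately. *)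
definition has_laplacian_everywhere :: "('a::euclidean_space \<Rightarrow> real) \<Rightarrow> bool" where
  "has_laplacian_everywhere u \<longleftrightarrow>
     (\<forall>v\<in>Basis. \<forall>x. partially_differentiable v u x \<and>
                     partially_differentiable v (partial_deriv v u) x)"

definition comparable_on :: "'a set \<Rightarrow> ('a \<Rightarrow> real) \<Rightarrow> ('a \<Rightarrow> real) \<Rightarrow> bool" where
  "comparable_on S U V \<longleftrightarrow> (\<exists>C>0. \<forall>x\<in>S. inverse C * V x \<le> U x \<and> U x \<le> C * V x)"

definition radial :: "(real \<Rightarrow> real) \<Rightarrow> complex \<Rightarrow> real" where
  "radial \<phi> z = \<phi> (cmod z)"

(* The functions psi, psi', psi'', tau live on [0,oo): their values at negative arguments are
   irrelevant, and derivatives at 0 are one-sided.  Since the Laplacian of the radial extension is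
   required to exist at the origin too, psi'(0) = 0. *)
locale admissible_weight =
  fixes \<psi> \<psi>' \<psi>'' \<tau> :: "real \<Rightarrow> real"
  assumes psi_nonneg: "\<And>r. 0 \<le> r \<Longrightarrow> 0 \<le> \<psi> r"
    and psi_deriv: "\<And>r. 0 \<le> r \<Longrightarrow> (\<psi> has_real_derivative \<psi>' r) (at r within {0..})"
    and psi_deriv2: "\<And>r. 0 \<le> r \<Longrightarrow> (\<psi>' has_real_derivative \<psi>'' r) (at r within {0..})"
    and psi_deriv2_cont: "continuous_on {0..} \<psi>''"
    and laplacian_exists: "has_laplacian_everywhere (radial \<psi>)"
    and laplacian_pos: "\<And>z. 0 < laplacian (radial \<psi>) z"
    and tau_pos: "\<And>z. 0 < radial \<tau> z"
    and tau_differentiable: "\<And>z. radial \<tau> differentiable (at z)"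
    and tau_inside: "comparable_on {z. cmod z < 1} (radial \<tau>) (\<lambda>z. 1)"
    and tau_outside: "comparable_on {z. 1 \<le> cmod z} (radial \<tau>)
                        (\<lambda>z. laplacian (radial \<psi>) z powr (- 1 / 2))"
    and tau_lim: "(\<tau> \<longlongrightarrow> 0) at_top"
    and tau_deriv_lim: "(deriv \<tau> \<longlongrightarrow> 0) at_top"
    and tau_growth: "(\<exists>C>0. \<exists>R. mono_on {R..} (\<lambda>r. \<tau> r * r powr C)) \<or>
                     ((\<lambda>r. deriv \<tau> r * ln (1 / \<tau> r)) \<longlongrightarrow> 0) at_top"

(* The exponent p ranges over (0,oo]; Lebesgue area measure is lborel on the complex numbers. *)
definition fock_space :: "(real \<Rightarrow> real) \<Rightarrow> ennreal \<Rightarrow> (complex \<Rightarrow> complex) set" where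
  "fock_space \<psi> p = {f. f holomorphic_on UNIV \<and>
     (if p = \<infinity> then bdd_above (range (\<lambda>z. cmod (f z) * exp (- radial \<psi> z)))
      else integrable lborel
             (\<lambda>z. cmod (f z) powr enn2real p * exp (- (enn2real p * radial \<psi> z))))}"

definition fock_norm :: "(real \<Rightarrow> real) \<Rightarrow> ennreal \<Rightarrow> (complex \<Rightarrow> complex) \<Rightarrow> real" where
  "fock_norm \<psi> p f =
     (if p = \<infinity> then (SUP z. cmod (f z) * exp (- radial \<psi> z))
      else (LINT z|lborel. cmod (f z) powr enn2real p * exp (- (enn2real p * radial \<psi> z)))
             powr (1 / enn2real p))"

(* For p < 1 the "norm" is only a quasi-norm; its p-th power is a metric that has the same
   balls around each point, up to a change of radius. *)
definition fock_dist ::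
  "(real \<Rightarrow> real) \<Rightarrow> ennreal \<Rightarrow> (complex \<Rightarrow> complex) \<Rightarrow> (complex \<Rightarrow> complex) \<Rightarrow> real" where
  "fock_dist \<psi> p f h = fock_norm \<psi> p (\<lambda>z. f z - h z) powr (if p < 1 then enn2real p else 1)"

definition fock_topology :: "(real \<Rightarrow> real) \<Rightarrow> ennreal \<Rightarrow> (complex \<Rightarrow> complex) topology" where
  "fock_topology \<psi> p = Metric_space.mtopology (fock_space \<psi> p) (fock_dist \<psi> p)"

definition bounded_operator :: "(real \<Rightarrow> real) \<Rightarrow> ennreal \<Rightarrow> ennreal \<Rightarrow>
    ((complex \<Rightarrow> complex) \<Rightarrow> (complex \<Rightarrow> complex)) \<Rightarrow> bool" where
  "bounded_operator \<psi> p q T \<longleftrightarrow>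
     (\<forall>f\<in>fock_space \<psi> p. T f \<in> fock_space \<psi> q) \<and>
     (\<exists>C. \<forall>f\<in>fock_space \<psi> p. fock_norm \<psi> q (T f) \<le> C * fock_norm \<psi> p f)"

definition compact_operator :: "(real \<Rightarrow> real) \<Rightarrow> ennreal \<Rightarrow> ennreal \<Rightarrow>
    ((complex \<Rightarrow> complex) \<Rightarrow> (complex \<Rightarrow> complex)) \<Rightarrow> bool" where
  "compact_operator \<psi> p q T \<longleftrightarrow>
     (\<forall>f\<in>fock_space \<psi> p. T f \<in> fock_space \<psi> q) \<and>
     (\<forall>S\<subseteq>fock_space \<psi> p. (\<exists>M. \<forall>f\<in>S. fock_norm \<psi> p f \<le> M) \<longrightarrow>
        compactin (fock_topology \<psi> q) (fock_topology \<psi> q closure_of (T ` S)))"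

definition volterra :: "(complex \<Rightarrow> complex) \<Rightarrow> (complex \<Rightarrow> complex) \<Rightarrow> complex \<Rightarrow> complex" where
  "volterra g f z = contour_integral (linepath 0 z) (\<lambda>w. f w * deriv g w)"

definition Lp_space :: "real \<Rightarrow> (complex \<Rightarrow> complex) set" where
  "Lp_space p = {f \<in> borel_measurable lborel. integrable lborel (\<lambda>z. cmod (f z) powr p)}"

end

theory Submission
  imports Defs
begin

text \<open>The weight is studied through \<open>mom r = r * \<psi>' r\<close>, its derivative in the variable \<open>ln r\<close>. The
  hypotheses on \<open>\<tau>\<close> say that \<open>mom\<close> changes by about \<open>r / \<tau> r\<close> over one \<open>\<tau>\<close>-step; farther away
  the convexity of the weight in \<open>ln r\<close> suffices.

  Near a circle the weight is compared with a power of \<open>z\<close>, which turns the mean value inequality into the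
  sharp bound for point evaluations. In the other direction, a monomial of degree about \<open>mom (cmod a)\<close> times a power of a
  Fejer-type mean in \<open>z / a\<close> is a function concentrated on the disc of radius \<open>\<tau> (cmod a)\<close> about \<open>a\<close>.
  Since \<open>\<psi>'\<close> dominates \<open>1 / \<tau>\<close>, the weight is nearly constant on discs of radius \<open>1 / (1 + \<psi>')\<close>, so the Cauchy
  estimate recovers \<open>f * g'\<close> from \<open>V\<^sub>g f\<close>, while integrating along rays gains the factor \<open>1 / (1 + \<psi>')\<close>.
  This gives (i), and (ii) with Montel's theorem.

  For (iii), finitely many lacunary power series in the space with the supremum norm have moduli whose maximum is comparable
  with the weight. Applied to them, the Cauchy estimate in integrated form shows that (c) is necessary. Conversely
  (c) yields one integrable function that dominates \<open>\<bar>V\<^sub>g f\<bar>\<^sup>p\<close> times the weight for all \<open>f\<close> in the unit ball,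
  whence boundedness, and compactness by Montel's theorem and dominated convergence.\<close>

section \<open>Mean value inequalities and the Volterra operator\<close>

text \<open>For a radial weight, subharmonicity is convexity in \<open>ln r\<close>, since the
  Laplacian is the derivative of \<open>mom\<close> divided by \<open>r\<close>. A tangent line in
  \<open>ln r\<close> is, up to a constant, the logarithm of the modulus of a power of
  \<open>z\<close>. Monomials are therefore the natural building blocks, and the single function
  \<open>gap\<close> measures how well they fit: it is bounded within one \<open>\<tau>\<close>-step
  and grows at least linearly in the logarithm beyond it. Degrees must be integers; the rounding
  costs one unit of slope, which the slope \<open>c * r / \<tau> r\<close> of \<open>gap\<close>
  absorbs.

  The inequality \<open>c / \<tau> r \<le> \<psi>' r\<close> holds because \<open>mom\<close> is
  still non-negative one step below \<open>r\<close>. It makes \<open>1 / (1 + \<psi>')\<close> the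
  smaller of the two length scales.

  In (iii) all finite exponents are treated alike, so no convexity in the exponent is available for
  the integrals along rays. The way out is to halve the weight: one half is spent on bounding an
  integral along a ray by the largest value of the remaining factor, the other half keeps the result
  integrable. Local means over discs of variable radius and Fubini's theorem play the part of a
  covering by discs.\<close>

lemma lborel_complex_eq_distr:
  "(lborel :: complex measure) = distr (lborel :: (real^2) measure) borel (\<lambda>v. Complex (vec_nth v 1) (vec_nth v 2))"
proof (rule lborel_eqI)
  have meas: "(\<lambda>v::real^2. Complex (vec_nth v 1) (vec_nth v 2)) \<in> borel_measurable borel"
    by (intro borel_measurable_continuous_onI) (auto simp: Complex_eq intro!: continuous_intros)
  show "sets (distr (lborel :: (real^2) measure) borel (\<lambda>v. Complex (vec_nth v 1) (vec_nth v 2))) = sets borel"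
    by simp
  fix l u :: complex
  assume lu: "\<And>b. b \<in> Basis \<Longrightarrow> l \<bullet> b \<le> u \<bullet> b"
  let ?l = "vector [Re l, Im l] :: real^2" and ?u = "vector [Re u, Im u] :: real^2"
  have "Re l \<le> Re u" "Im l \<le> Im u"
    using lu[of 1] lu[of \<i>] by (auto simp: Basis_complex_def)
  then have le: "vec_nth ?l i \<le> vec_nth ?u i" for i
    using exhaust_2[of i] by auto
  have "(\<lambda>v::real^2. Complex (vec_nth v 1) (vec_nth v 2)) -` box l u = box ?l ?u"
    by (auto simp: box_def Basis_complex_def Basis_vec_def inner_axis forall_2)
  then have "emeasure (distr (lborel :: (real^2) measure) borel (\<lambda>v. Complex (vec_nth v 1) (vec_nth v 2))) (box l u)
      = emeasure lborel (box ?l ?u)"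
    using meas by (simp add: emeasure_distr)
  also have "\<dots> = ennreal (\<Prod>b\<in>Basis. (?u - ?l) \<bullet> b)"
    by (rule emeasure_lborel_box) (use le in \<open>auto simp: Basis_vec_def inner_axis\<close>)
  also have "(\<Prod>b\<in>Basis. (?u - ?l) \<bullet> b) = (\<Prod>b\<in>Basis. (u - l) \<bullet> b)"
    by (simp add: Basis_complex_def Basis_vec_def inner_axis UNIV_2 axis_eq_axis prod.union_disjoint)
  finally show "emeasure (distr (lborel :: (real^2) measure) borel (\<lambda>v. Complex (vec_nth v 1) (vec_nth v 2))) (box l u)
      = (\<Prod>b\<in>Basis. (u - l) \<bullet> b)" .
qed

lemma lborel_distr_orthogonal:
  fixes f :: "real^'n::{finite,wellorder} \<Rightarrow> real^'n::_"
  assumes f: "orthogonal_transformation f"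
  shows "distr lborel borel f = lborel"
proof (rule sym, rule lborel_eqI)
  have inv: "orthogonal_transformation (inv f)"
    using f orthogonal_transformation_inv by blast
  have bij: "bij f"
    using f orthogonal_transformation_bij by blast
  have "continuous_on UNIV f"
    using f by (intro linear_continuous_on linear_conv_bounded_linear[THEN iffD1] orthogonal_transformation_linear)
  then have meas: "f \<in> borel_measurable borel"
    by (rule borel_measurable_continuous_onI)
  show "sets (distr lborel borel f) = sets borel"
    by simp
  fix l u :: "real^'n::_"
  assume lu: "\<And>b. b \<in> Basis \<Longrightarrow> l \<bullet> b \<le> u \<bullet> b"
  have vi: "f -` box l u = inv f ` box l u"
    by (simp add: bij bij_vimage_eq_inv_image)
  have B: "f -` box l u \<in> sets borel"
    using meas by (metis borel_open measurable_sets_borel open_box)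
  have m: "box l u \<in> lmeasurable" by simp
  have "emeasure (distr lborel borel f) (box l u) = emeasure lborel (f -` box l u)"
    using meas by (simp add: emeasure_distr)
  also have "\<dots> = emeasure lebesgue (inv f ` box l u)"
    using B by (simp add: vi)
  also have "\<dots> = ennreal (measure lebesgue (inv f ` box l u))"
    using measurable_orthogonal_image[OF inv m] by (simp add: emeasure_eq_measure2)
  also have "measure lebesgue (inv f ` box l u) = measure lebesgue (box l u)"
    by (rule measure_orthogonal_image[OF inv m])
  also have "ennreal \<dots> = (\<Prod>b\<in>Basis. (u - l) \<bullet> b)"
    using lu emeasure_lborel_box[OF lu] by (simp add: measure_def)
  finally show "emeasure (distr lborel borel f) (box l u) = (\<Prod>b\<in>Basis. (u - l) \<bullet> b)" .
qed

text \<open>Multiplication by a unimodular number is an orthogonal map of \<open>real^2\<close>, and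
  orthogonal maps preserve Lebesgue measure.\<close>

lemma lborel_complex_rotation:
  assumes c: "cmod c = 1"
  shows "distr lborel borel (\<lambda>z. c * z) = lborel"
proof -
  let ?\<phi> = "\<lambda>v::real^2. Complex (vec_nth v 1) (vec_nth v 2)"
  let ?R = "\<lambda>v::real^2. vector [Re (c * ?\<phi> v), Im (c * ?\<phi> v)] :: real^2"
  have meas: "?\<phi> \<in> borel_measurable borel"
    by (intro borel_measurable_continuous_onI) (auto simp: Complex_eq intro!: continuous_intros)
  have "linear ?R"
    by (intro linearI) (auto simp: vec_eq_iff forall_2 algebra_simps)
  moreover have "norm (?R v) = norm v" for v
  proof -
    have "norm (?R v) = cmod (c * ?\<phi> v)"
      by (simp add: norm_vec_def L2_set_def UNIV_2 cmod_def)
    also have "\<dots> = cmod (?\<phi> v)" using c by (simp add: norm_mult)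
    also have "\<dots> = norm v" by (simp add: norm_vec_def L2_set_def UNIV_2 cmod_def)
    finally show ?thesis .
  qed
  ultimately have R: "orthogonal_transformation ?R"
    by (simp add: orthogonal_transformation)
  then have Rm: "?R \<in> borel_measurable borel"
    by (intro borel_measurable_continuous_onI linear_continuous_on
        linear_conv_bounded_linear[THEN iffD1] orthogonal_transformation_linear)
  have comp: "(\<lambda>z. c * z) \<circ> ?\<phi> = ?\<phi> \<circ> ?R"
    by (auto simp: fun_eq_iff complex_eq_iff)
  have "distr lborel borel (\<lambda>z. c * z) = distr (distr lborel borel ?\<phi>) borel (\<lambda>z. c * z)"
    by (subst lborel_complex_eq_distr) simp
  also have "\<dots> = distr lborel borel (?\<phi> \<circ> ?R)"
    using meas by (subst distr_distr) (auto simp: comp)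
  also have "\<dots> = distr (distr lborel borel ?R) borel ?\<phi>"
    using meas Rm by (subst distr_distr) auto
  also have "\<dots> = lborel"
    unfolding lborel_distr_orthogonal[OF R] by (rule lborel_complex_eq_distr[symmetric])
  finally show ?thesis .
qed

text \<open>Cauchy's formula at the centre, with norms taken inside. The parameter integral is kept
  as a non-negative integral so that Fubini's theorem applies to it directly.\<close>

lemma submean_circle:
  assumes cont: "continuous_on (cball 0 1) h" and hol: "h holomorphic_on ball 0 1"
  shows "ennreal (cmod (h 0)) \<le> (\<integral>\<^sup>+t\<in>{0..1}. ennreal (cmod (h (exp (2 * pi * \<i> * of_real t)))) \<partial>lborel)"
proof -
  let ?e = "\<lambda>t::real. exp (2 * pi * \<i> * of_real t)"
  have "((\<lambda>u. h u / (u - 0)) has_contour_integral (2 * of_real pi * \<i> * h 0)) (circlepath 0 1)"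
    by (rule Cauchy_integral_circlepath[OF cont hol]) auto
  then have "((\<lambda>t. h (?e t) / ?e t * (2 * pi * \<i> * ?e t)) has_integral (2 * of_real pi * \<i> * h 0)) {0..1}"
    unfolding has_contour_integral_def
    by (rule has_integral_eq[rotated]) (simp add: vector_derivative_circlepath01, simp add: circlepath)
  then have "((\<lambda>t. 1 / (2 * pi * \<i>) * (h (?e t) / ?e t * (2 * pi * \<i> * ?e t)))
      has_integral (1 / (2 * pi * \<i>) * (2 * of_real pi * \<i> * h 0))) {0..1}"
    by (rule has_integral_mult_right)
  then have hi: "((\<lambda>t. h (?e t)) has_integral h 0) {0..1}"
    by (simp add: field_simps)
  have c: "continuous_on {0..1} (\<lambda>t. h (?e t))"
    by (rule continuous_on_compose2[OF cont]) (auto intro!: continuous_intros simp: norm_exp_eq_Re)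
  have si: "set_integrable lborel {0..1} (\<lambda>t. h (?e t))"
    by (rule borel_integrable_atLeastAtMost'[OF c])
  have "h 0 = (LINT t:{0..1}|lborel. h (?e t))"
    using set_borel_integral_eq_integral(2)[OF si] hi by (simp add: integral_unique)
  also have "\<dots> = (LINT t|lborel. indicator {0..1} t *\<^sub>R h (?e t))"
    by (simp add: set_lebesgue_integral_def)
  finally have "ennreal (cmod (h 0)) \<le> (\<integral>\<^sup>+t. ennreal (cmod (indicator {0..1} t *\<^sub>R h (?e t))) \<partial>lborel)"
    using integral_norm_bound_ennreal[OF si[unfolded set_integrable_def]] by simp
  also have "\<dots> = (\<integral>\<^sup>+t\<in>{0..1}. ennreal (cmod (h (?e t))) \<partial>lborel)"
    by (intro nn_integral_cong) (auto simp: indicator_def)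
  finally show ?thesis .
qed

lemma emeasure_cball_complex: "0 \<le> r \<Longrightarrow> emeasure lborel (cball (a::complex) r) = ennreal (pi * r^2)"
  by (simp add: emeasure_cball unit_ball_vol_2 flip: ennreal_mult'')

text \<open>The circle inequality is applied to \<open>u \<mapsto> h (a + u * w)\<close> for every
  \<open>w\<close> in the disc and integrated over \<open>w\<close>. After exchanging the integrals,
  rotation invariance makes the inner integral independent of the angle, so no polar coordinates
  enter.\<close>

lemma submean_area:
  assumes r: "0 < r" and cont: "continuous_on (cball a r) h" and hol: "h holomorphic_on ball a r"
  shows "ennreal (cmod (h a)) * ennreal (pi * r^2) \<le> (\<integral>\<^sup>+z\<in>cball a r. ennreal (cmod (h z)) \<partial>lborel)"
proof -
  \<comment> \<open>The recentred function, cut off to the closed disc, is Borel measurable on the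
    whole plane although \<open>h\<close> is only controlled on the disc.\<close>
  define H where "H z = indicator (cball 0 r) z *\<^sub>R h (a + z)" for z
  let ?e = "\<lambda>t::real. exp (2 * pi * \<i> * of_real t)"
  have [measurable]: "H \<in> borel_measurable borel"
    unfolding H_def
    by (rule borel_measurable_continuous_on_indicator)
       (auto intro!: continuous_on_compose2[OF cont] continuous_intros simp: dist_norm)
  have [measurable]: "?e \<in> borel_measurable borel"
    by (intro borel_measurable_continuous_onI continuous_intros)
  have "ennreal (cmod (h a)) * ennreal (pi * r^2) = (\<integral>\<^sup>+w. ennreal (cmod (h a)) * indicator (cball (0::complex) r) w \<partial>lborel)"
    using r by (simp add: nn_integral_cmult_indicator emeasure_cball_complex)
  also have "\<dots> \<le> (\<integral>\<^sup>+w. (\<integral>\<^sup>+t. ennreal (cmod (H (?e t * w))) * indicator {0..1} t \<partial>lborel) \<partial>lborel)"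
  proof (rule nn_integral_mono)
    fix w :: complex
    show "ennreal (cmod (h a)) * indicator (cball 0 r) w
      \<le> (\<integral>\<^sup>+t. ennreal (cmod (H (?e t * w))) * indicator {0..1} t \<partial>lborel)"
    proof (cases "w \<in> cball 0 r")
      case True
      have sub: "(\<lambda>u. a + u * w) ` cball 0 1 \<subseteq> cball a r"
      proof safe
        fix u :: complex assume "u \<in> cball 0 1"
        then have "cmod u * cmod w \<le> 1 * r" using True by (intro mult_mono) auto
        then show "a + u * w \<in> cball a r" by (simp add: dist_norm norm_mult)
      qed
      have sub2: "(\<lambda>u. a + u * w) ` ball 0 1 \<subseteq> ball a r"
      proof safe
        fix u :: complex assume u: "u \<in> ball 0 1"
        have "cmod u * cmod w < r"
        proof (cases "w = 0")
          case False
          then have "cmod u * cmod w < 1 * cmod w" using u by (intro mult_strict_right_mono) auto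
          then show ?thesis using True by simp
        qed (use r in simp)
        then show "a + u * w \<in> ball a r" by (simp add: dist_norm norm_mult)
      qed
      have "ennreal (cmod (h (a + 0 * w))) \<le> (\<integral>\<^sup>+t\<in>{0..1}. ennreal (cmod (h (a + ?e t * w))) \<partial>lborel)"
      proof (rule submean_circle)
        show "continuous_on (cball 0 1) (\<lambda>u. h (a + u * w))"
          by (rule continuous_on_compose2[OF cont _ sub]) (intro continuous_intros)
        have "(h \<circ> (\<lambda>u. a + u * w)) holomorphic_on ball 0 1"
          by (rule holomorphic_on_compose_gen[OF _ hol sub2]) (intro holomorphic_intros)
        then show "(\<lambda>u. h (a + u * w)) holomorphic_on ball 0 1" by (simp add: o_def)
      qed
      moreover have "H (?e t * w) = h (a + ?e t * w)" for t
        using True by (simp add: H_def norm_mult norm_exp_eq_Re)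
      ultimately show ?thesis using True by simp
    qed simp
  qed
  also have "\<dots> = (\<integral>\<^sup>+t. (\<integral>\<^sup>+w. ennreal (cmod (H (?e t * w))) * indicator {0..1} t \<partial>lborel) \<partial>lborel)"
    by (rule lborel_pair.Fubini') measurable
  also have "\<dots> = (\<integral>\<^sup>+t. (\<integral>\<^sup>+w. ennreal (cmod (H w)) \<partial>lborel) * indicator {0..1} (t::real) \<partial>lborel)"
  proof (intro nn_integral_cong)
    fix t :: real
    have "(\<integral>\<^sup>+w. ennreal (cmod (H w)) \<partial>lborel) = (\<integral>\<^sup>+w. ennreal (cmod (H w)) \<partial>(distr lborel borel (\<lambda>w. ?e t * w)))"
      by (subst lborel_complex_rotation) (auto simp: norm_exp_eq_Re)
    also have "\<dots> = (\<integral>\<^sup>+w. ennreal (cmod (H (?e t * w))) \<partial>lborel)"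
      by (subst nn_integral_distr) auto
    finally show "(\<integral>\<^sup>+w. ennreal (cmod (H (?e t * w))) * indicator {0..1} t \<partial>lborel)
        = (\<integral>\<^sup>+w. ennreal (cmod (H w)) \<partial>lborel) * indicator {0..1} t"
      by (subst nn_integral_multc) auto
  qed
  also have "\<dots> = (\<integral>\<^sup>+w. ennreal (cmod (H w)) \<partial>lborel)"
    by (subst nn_integral_cmult_indicator) auto
  also have "\<dots> = (\<integral>\<^sup>+w. ennreal (cmod (H w)) \<partial>(distr lborel borel (\<lambda>z. -a + z)))"
    by (subst lborel_distr_plus) simp
  also have "\<dots> = (\<integral>\<^sup>+z. ennreal (cmod (H (-a + z))) \<partial>lborel)"
    by (subst nn_integral_distr) auto
  also have "\<dots> = (\<integral>\<^sup>+z\<in>cball a r. ennreal (cmod (h z)) \<partial>lborel)"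
    by (intro nn_integral_cong) (auto simp: H_def indicator_def dist_norm norm_minus_commute)
  finally show ?thesis .
qed

text \<open>For exponents below one, \<^term>\<open>cmod (h z) powr p * (r - dist a z)^2\<close> is evaluated at a maximum point:
  there the mean value inequality for exponent one can be applied with the integrand split as
  \<open>\<bar>h\<bar> = \<bar>h\<bar>\<^sup>p * \<bar>h\<bar>\<^sup>1\<^sup>-\<^sup>p\<close>.\<close>

lemma submean_powr:
  fixes p :: real
  assumes p: "0 < p"
  obtains C :: real where "0 < C"
    and "\<And>h a r. \<lbrakk>0 < r; continuous_on (cball a r) h; h holomorphic_on ball a r\<rbrakk> \<Longrightarrow>
      ennreal (cmod (h a) powr p * r^2) \<le> ennreal C * (\<integral>\<^sup>+z\<in>cball a r. ennreal (cmod (h z) powr p) \<partial>lborel)"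
proof (cases "1 \<le> p")
  case True
  show ?thesis
  proof (rule that)
    show "0 < 1 / pi" by simp
    fix h and a :: complex and r :: real
    assume r: "0 < r" and cont: "continuous_on (cball a r) h" and hol: "h holomorphic_on ball a r"
    let ?t = "cmod (h a)" and ?V = "pi * r^2"
    let ?I = "\<integral>\<^sup>+z\<in>cball a r. ennreal (cmod (h z) powr p) \<partial>lborel"
    have meas: "(\<lambda>z. indicator (cball a r) z *\<^sub>R h z) \<in> borel_measurable borel"
      by (rule borel_measurable_continuous_on_indicator) (use cont in auto)
    have m1: "(\<lambda>z. ennreal (cmod (h z)) * indicator (cball a r) z) \<in> borel_measurable borel"
    proof -
      have "(\<lambda>z. ennreal (cmod (indicator (cball a r) z *\<^sub>R h z))) \<in> borel_measurable borel"
        using meas by measurable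
      then show ?thesis by (rule back_subst[of "\<lambda>f. f \<in> _"]) (auto simp: indicator_def)
    qed
    have m2: "(\<lambda>z. ennreal (cmod (h z) powr p) * indicator (cball a r) z) \<in> borel_measurable borel"
    proof -
      have "(\<lambda>z. ennreal (cmod (indicator (cball a r) z *\<^sub>R h z) powr p)) \<in> borel_measurable borel"
        using meas by measurable
      then show ?thesis by (rule back_subst[of "\<lambda>f. f \<in> _"]) (auto simp: indicator_def)
    qed
    have "ennreal (?t powr p * ?V) \<le> ?I"
    proof (cases "h a = 0")
      case False
      \<comment> \<open>The graph of \<open>x powr p\<close> lies above its tangent at
        \<open>?t\<close>. Integrated over the disc, this is Jensen's inequality for the area
        mean.\<close>
      have young: "p * ?t powr (p - 1) * x \<le> (p - 1) * ?t powr p + x powr p" if "0 \<le> x" for x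
      proof (cases "p = 1")
        case True then show ?thesis using that False by simp
      next
        case p1: False
        then have "x * ?t powr (p - 1) \<le> x powr p / p + (?t powr (p - 1)) powr (p / (p - 1)) / (p / (p - 1))"
          using True that by (intro Youngs_inequality) (auto simp: field_simps)
        also have "(?t powr (p - 1)) powr (p / (p - 1)) = ?t powr p"
          using p1 by (simp add: powr_powr)
        finally show ?thesis using p1 True by (simp add: field_simps)
      qed
      have "ennreal (p * ?t powr (p - 1)) * (ennreal ?t * ennreal ?V)
          \<le> ennreal (p * ?t powr (p - 1)) * (\<integral>\<^sup>+z\<in>cball a r. ennreal (cmod (h z)) \<partial>lborel)"
        by (intro mult_left_mono submean_area[OF r cont hol]) auto
      also have "\<dots> = (\<integral>\<^sup>+z. ennreal (p * ?t powr (p - 1)) * (ennreal (cmod (h z)) * indicator (cball a r) z) \<partial>lborel)"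
        using m1 by (intro nn_integral_cmult[symmetric]) auto
      also have "\<dots> \<le> (\<integral>\<^sup>+z. ennreal ((p - 1) * ?t powr p) * indicator (cball a r) z
          + ennreal (cmod (h z) powr p) * indicator (cball a r) z \<partial>lborel)"
      proof (rule nn_integral_mono)
        fix z
        have "ennreal (p * ?t powr (p - 1)) * ennreal (cmod (h z)) \<le> ennreal ((p - 1) * ?t powr p) + ennreal (cmod (h z) powr p)"
        proof -
          have "ennreal (p * ?t powr (p - 1)) * ennreal (cmod (h z)) = ennreal (p * ?t powr (p - 1) * cmod (h z))"
            by (simp only: ennreal_mult'' norm_ge_zero)
          moreover have "ennreal ((p - 1) * ?t powr p) + ennreal (cmod (h z) powr p) = ennreal ((p - 1) * ?t powr p + cmod (h z) powr p)"
            using True by simp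
          ultimately show ?thesis using young[of "cmod (h z)"] by (simp only: ennreal_leI norm_ge_zero)
        qed
        then show "ennreal (p * ?t powr (p - 1)) * (ennreal (cmod (h z)) * indicator (cball a r) z)
            \<le> ennreal ((p - 1) * ?t powr p) * indicator (cball a r) z + ennreal (cmod (h z) powr p) * indicator (cball a r) z"
          by (cases "z \<in> cball a r") simp_all
      qed
      also have "\<dots> = ennreal ((p - 1) * ?t powr p) * ennreal ?V + ?I"
      proof -
        have e: "(\<integral>\<^sup>+z. ennreal ((p - 1) * ?t powr p) * indicator (cball a r) z \<partial>lborel) = ennreal ((p - 1) * ?t powr p) * ennreal ?V"
          using r by (subst nn_integral_cmult_indicator) (simp_all add: emeasure_cball_complex)
        have m: "(\<lambda>z. ennreal ((p - 1) * ?t powr p) * indicator (cball a r) z) \<in> borel_measurable lborel"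
          by (intro borel_measurable_times_ennreal borel_measurable_indicator) simp_all
        have m2': "(\<lambda>z. ennreal (cmod (h z) powr p) * indicator (cball a r) z) \<in> borel_measurable lborel"
          using m2 by simp
        show ?thesis by (subst nn_integral_add[OF m m2']) (simp only: e)
      qed
      finally have *: "ennreal (p * ?t powr (p - 1)) * (ennreal ?t * ennreal ?V) \<le> ennreal ((p - 1) * ?t powr p) * ennreal ?V + ?I" .
      have "ennreal (p * ?t powr p * ?V) \<le> ennreal ((p - 1) * ?t powr p * ?V) + ?I"
      proof -
        have "p * ?t powr (p - 1) * (?t * ?V) = p * ?t powr p * ?V"
          using False by (simp add: powr_diff)
        then have "ennreal (p * ?t powr (p - 1)) * (ennreal ?t * ennreal ?V) = ennreal (p * ?t powr p * ?V)"
          by (simp only: ennreal_mult''[symmetric] mult_nonneg_nonneg norm_ge_zero pi_ge_zero zero_le_power2)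
        moreover have "ennreal ((p - 1) * ?t powr p) * ennreal ?V = ennreal ((p - 1) * ?t powr p * ?V)"
          by (rule ennreal_mult''[symmetric]) simp
        ultimately show ?thesis using * by (simp only:)
      qed
      moreover have "ennreal (p * ?t powr p * ?V) = ennreal ((p - 1) * ?t powr p * ?V) + ennreal (?t powr p * ?V)"
      proof -
        have "p * ?t powr p * ?V = (p - 1) * ?t powr p * ?V + ?t powr p * ?V" by (simp add: algebra_simps)
        moreover have "0 \<le> (p - 1) * ?t powr p * ?V" "0 \<le> ?t powr p * ?V" using True by simp_all
        ultimately show ?thesis by (metis ennreal_plus)
      qed
      moreover have "Z \<le> I" if "X \<le> ennreal y + I" "X = ennreal y + Z" for X Z I :: ennreal and y
        using that by (auto simp: ennreal_add_left_cancel_le)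
      ultimately show ?thesis by blast
    qed (use p in simp)
    then have "ennreal (1 / pi) * ennreal (?t powr p * ?V) \<le> ennreal (1 / pi) * ?I"
      by (rule mult_left_mono) simp
    then show "ennreal (?t powr p * r^2) \<le> ennreal (1 / pi) * ?I"
      by (simp flip: ennreal_mult'')
  qed
next
  case False
  \<comment> \<open>The constant results from raising \<open>\<bar>h\<bar>^p \<le> 4 * t^p\<close>,
    valid on the smaller disc below, to the power \<open>(1 - p) / p\<close>.\<close>
  define A where "A = (4::real) powr ((1 - p) / p)"
  show ?thesis
  proof (rule that)
    show "0 < 4 * A / pi" by (simp add: A_def)
    fix h and a :: complex and r :: real
    assume r: "0 < r" and cont: "continuous_on (cball a r) h" and hol: "h holomorphic_on ball a r"
    let ?I = "\<integral>\<^sup>+z\<in>cball a r. ennreal (cmod (h z) powr p) \<partial>lborel"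
    define \<phi> where "\<phi> z = cmod (h z) powr p * (r - dist a z)^2" for z
    have "continuous_on (cball a r) \<phi>"
      unfolding \<phi>_def using p by (intro continuous_intros cont continuous_on_powr') auto
    then obtain z0 where z0: "z0 \<in> cball a r" "\<And>z. z \<in> cball a r \<Longrightarrow> \<phi> z \<le> \<phi> z0"
      using continuous_attains_sup[of "cball a r" \<phi>] r by (auto simp: ball_def)
    have \<phi>a: "\<phi> a = cmod (h a) powr p * r^2" by (simp add: \<phi>_def)
    show "ennreal (cmod (h a) powr p * r^2) \<le> ennreal (4 * A / pi) * ?I"
    proof (cases "\<phi> z0 = 0")
      case True
      then have "cmod (h a) powr p * r^2 \<le> 0"
        using z0(2)[of a] r \<phi>a by simp
      then show ?thesis by (simp only: ennreal_neg zero_le)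
    next
      case nz: False
      define t where "t = cmod (h z0)"
      \<comment> \<open>Half the distance from the maximum point to the boundary: on
        \<open>cball z0 d\<close> the factor \<open>r - dist a z\<close> is at least
        \<open>d\<close>, against \<open>2 * d\<close> at \<open>z0\<close>, so maximality costs a
        factor 4.\<close>
      define d where "d = (r - dist a z0) / 2"
      have t: "0 < t" using nz p unfolding \<phi>_def t_def by auto
      have d: "0 < d" using nz z0(1) unfolding \<phi>_def d_def by (cases "dist a z0 = r") auto
      have \<phi>z0: "\<phi> z0 = 4 * (t powr p * d^2)"
        by (simp add: \<phi>_def t_def d_def power2_eq_square)
      have sub: "cball z0 d \<subseteq> cball a r"
      proof
        fix z assume "z \<in> cball z0 d"
        then have "dist a z \<le> dist a z0 + d" using dist_triangle[of a z z0] by (simp add: dist_commute)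
        then show "z \<in> cball a r" using d by (simp add: d_def field_simps)
      qed
      have subb: "ball z0 d \<subseteq> ball a r"
      proof
        fix z assume "z \<in> ball z0 d"
        then have "dist a z < dist a z0 + d" using dist_triangle[of a z z0] by (simp add: dist_commute)
        then show "z \<in> ball a r" using d by (simp add: d_def field_simps)
      qed
      have bd: "cmod (h z) \<le> A * t powr (1 - p) * cmod (h z) powr p" if z: "z \<in> cball z0 d" for z
      proof -
        have "dist a z \<le> dist a z0 + d" using dist_triangle[of a z z0] z by (simp add: dist_commute)
        then have "d \<le> r - dist a z" by (simp add: d_def field_simps)
        then have "cmod (h z) powr p * d^2 \<le> \<phi> z"
          unfolding \<phi>_def using d by (intro mult_left_mono power_mono) auto
        also have "\<dots> \<le> 4 * (t powr p * d^2)"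
          using z0(2)[of z] sub z \<phi>z0 by auto
        finally have "cmod (h z) powr p \<le> 4 * t powr p" using d by simp
        then have "(cmod (h z) powr p) powr ((1 - p) / p) \<le> (4 * t powr p) powr ((1 - p) / p)"
          using False p by (intro powr_mono2) auto
        then have "cmod (h z) powr (1 - p) \<le> A * t powr (1 - p)"
          using p by (simp add: powr_powr powr_mult A_def)
        then have "cmod (h z) powr (1 - p) * cmod (h z) powr p \<le> A * t powr (1 - p) * cmod (h z) powr p"
          by (rule mult_right_mono) simp
        moreover have "cmod (h z) powr (1 - p) * cmod (h z) powr p = cmod (h z)"
          by (cases "h z = 0") (simp_all flip: powr_add)
        ultimately show ?thesis by simp
      qed
      have meas: "(\<lambda>z. indicator (cball z0 d) z *\<^sub>R h z) \<in> borel_measurable borel"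
        by (rule borel_measurable_continuous_on_indicator) (use cont sub in \<open>auto intro: continuous_on_subset\<close>)
      have m2: "(\<lambda>z. ennreal (cmod (h z) powr p) * indicator (cball z0 d) z) \<in> borel_measurable borel"
      proof -
        have "(\<lambda>z. ennreal (cmod (indicator (cball z0 d) z *\<^sub>R h z) powr p)) \<in> borel_measurable borel"
          using meas by measurable
        then show ?thesis by (rule back_subst[of "\<lambda>f. f \<in> _"]) (auto simp: indicator_def)
      qed
      have "ennreal (t * (pi * d^2)) \<le> (\<integral>\<^sup>+z\<in>cball z0 d. ennreal (cmod (h z)) \<partial>lborel)"
        using submean_area[OF d continuous_on_subset[OF cont sub] holomorphic_on_subset[OF hol subb]]
        by (simp add: t_def ennreal_mult'')
      also have "\<dots> \<le> (\<integral>\<^sup>+z. ennreal (A * t powr (1 - p)) * (ennreal (cmod (h z) powr p) * indicator (cball z0 d) z) \<partial>lborel)"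
      proof (rule nn_integral_mono)
        fix z
        show "ennreal (cmod (h z)) * indicator (cball z0 d) z
            \<le> ennreal (A * t powr (1 - p)) * (ennreal (cmod (h z) powr p) * indicator (cball z0 d) z)"
        proof (cases "z \<in> cball z0 d")
          case True
          have "ennreal (cmod (h z)) \<le> ennreal (A * t powr (1 - p)) * ennreal (cmod (h z) powr p)"
            using bd[OF True] by (subst ennreal_mult''[symmetric]) (auto intro: ennreal_leI)
          then show ?thesis using True by simp
        qed simp
      qed
      also have "\<dots> = ennreal (A * t powr (1 - p)) * (\<integral>\<^sup>+z\<in>cball z0 d. ennreal (cmod (h z) powr p) \<partial>lborel)"
        using m2 by (intro nn_integral_cmult) auto
      also have "\<dots> \<le> ennreal (A * t powr (1 - p)) * ?I"
        using sub by (intro mult_left_mono nn_integral_mono) (auto simp: indicator_def)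
      finally have "ennreal (4 * t powr (p - 1) / pi) * ennreal (t * (pi * d^2))
          \<le> ennreal (4 * t powr (p - 1) / pi) * (ennreal (A * t powr (1 - p)) * ?I)"
        by (rule mult_left_mono) simp
      also have "ennreal (4 * t powr (p - 1) / pi) * ennreal (t * (pi * d^2)) = ennreal (\<phi> z0)"
      proof -
        have "4 * t powr (p - 1) / pi * (t * (pi * d^2)) = \<phi> z0"
          using t by (simp add: \<phi>z0 powr_diff)
        then show ?thesis using t by (subst ennreal_mult''[symmetric]) simp_all
      qed
      also have "ennreal (4 * t powr (p - 1) / pi) * (ennreal (A * t powr (1 - p)) * ?I)
         = ennreal (4 * A / pi) * ?I"
      proof -
        have "4 * t powr (p - 1) / pi * (A * t powr (1 - p)) = 4 * A / pi"
          using t by (simp add: powr_diff)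
        then have "ennreal (4 * t powr (p - 1) / pi) * ennreal (A * t powr (1 - p)) = ennreal (4 * A / pi)"
          by (subst ennreal_mult''[symmetric]) (simp_all add: A_def)
        then show ?thesis by (simp only: mult.assoc[symmetric])
      qed
      finally have "ennreal (\<phi> z0) \<le> ennreal (4 * A / pi) * ?I" .
      moreover have "ennreal (cmod (h a) powr p * r^2) \<le> ennreal (\<phi> z0)"
        using z0(2)[of a] r \<phi>a by (intro ennreal_leI) auto
      ultimately show ?thesis by (rule order_trans[rotated])
    qed
  qed
qed

text \<open>The mean value inequality on discs of radius \<open>r / 2\<close> bounds
  \<open>h\<close> on the circle of radius \<open>r / 2\<close> about \<open>a\<close>; Cauchy's
  estimate on that circle then gives the derivative, also for exponents below one.\<close>

lemma submean_powr_deriv: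
  fixes p :: real
  assumes p: "0 < p"
  obtains C :: real where "0 < C"
    and "\<And>h a r. \<lbrakk>0 < r; continuous_on (cball a r) h; h holomorphic_on ball a r\<rbrakk> \<Longrightarrow>
      ennreal (cmod (deriv h a) powr p * r powr (p + 2)) \<le> ennreal C * (\<integral>\<^sup>+z\<in>cball a r. ennreal (cmod (h z) powr p) \<partial>lborel)"
proof -
  obtain C where C: "0 < C" and sub: "\<And>h a r. \<lbrakk>0 < r; continuous_on (cball a r) h; h holomorphic_on ball a r\<rbrakk> \<Longrightarrow>
      ennreal (cmod (h a) powr p * r^2) \<le> ennreal C * (\<integral>\<^sup>+z\<in>cball a r. ennreal (cmod (h z) powr p) \<partial>lborel)"
    using submean_powr[OF p] by blast
  show ?thesis
  proof (rule that)
    show "0 < 2 powr p * 4 * C" using C by simp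
    fix h and a :: complex and r :: real
    assume r: "0 < r" and cont: "continuous_on (cball a r) h" and hol: "h holomorphic_on ball a r"
    let ?I = "\<integral>\<^sup>+z\<in>cball a r. ennreal (cmod (h z) powr p) \<partial>lborel"
    show "ennreal (cmod (deriv h a) powr p * r powr (p + 2)) \<le> ennreal (2 powr p * 4 * C) * ?I"
    proof (cases "?I = \<infinity>")
      case True
      then show ?thesis using C by (simp add: ennreal_mult_top)
    next
      case False
      then obtain J where J: "0 \<le> J" "?I = ennreal J" by (cases ?I rule: ennreal_cases) auto
      define B where "B = (C * J / (r/2)^2) powr (1 / p)"
      have bd: "cmod (h z) \<le> B" if z: "cmod (a - z) = r / 2" for z
      proof -
        have s: "cball z (r/2) \<subseteq> cball a r" "ball z (r/2) \<subseteq> ball a r"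
          using z by (auto simp: cball_subset_cball_iff ball_subset_ball_iff dist_norm norm_minus_commute)
        have "ennreal (cmod (h z) powr p * (r/2)^2) \<le> ennreal C * (\<integral>\<^sup>+w\<in>cball z (r/2). ennreal (cmod (h w) powr p) \<partial>lborel)"
          using r s by (intro sub continuous_on_subset[OF cont] holomorphic_on_subset[OF hol]) auto
        also have "\<dots> \<le> ennreal C * ?I"
          using s by (intro mult_left_mono nn_integral_mono) (auto simp: indicator_def)
        also have "\<dots> = ennreal (C * J)" using C J by (simp add: ennreal_mult)
        finally have "cmod (h z) powr p * (r/2)^2 \<le> C * J" using C J by (simp add: ennreal_le_iff)
        then have "cmod (h z) powr p \<le> C * J / (r/2)^2" using r by (simp add: pos_le_divide_eq)
        then have "(cmod (h z) powr p) powr (1/p) \<le> B"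
          unfolding B_def using p by (intro powr_mono2) auto
        then show ?thesis using p by (simp add: powr_powr)
      qed
      have "cmod ((deriv ^^ 1) h a) \<le> fact 1 * B / (r/2)^1"
        using r bd by (intro Cauchy_inequality continuous_on_subset[OF cont] holomorphic_on_subset[OF hol]) auto
      then have "cmod (deriv h a) \<le> 2 * B / r" by (simp add: mult.commute)
      then have "cmod (deriv h a) powr p \<le> (2 * B / r) powr p"
        using p by (intro powr_mono2) auto
      also have "\<dots> = 2 powr p * (C * J / (r/2)^2) / r powr p"
        using p r C J by (simp add: powr_divide powr_mult B_def powr_powr)
      finally have "cmod (deriv h a) powr p * r powr (p + 2) \<le> 2 powr p * (C * J / (r/2)^2) / r powr p * r powr (p + 2)"
        by (rule mult_right_mono) simp
      also have "\<dots> = 2 powr p * 4 * C * J"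
        using r by (simp add: powr_add field_simps power2_eq_square)
      finally have "ennreal (cmod (deriv h a) powr p * r powr (p + 2)) \<le> ennreal (2 powr p * 4 * C * J)"
        by (rule ennreal_leI)
      then show ?thesis using J C by (simp add: ennreal_mult)
    qed
  qed
qed

text \<open>Where \<open>dist a z / \<kappa>\<close> lies between \<open>n\<close> and
  \<open>n + 1\<close> the integrand is at most \<open>1 / (n + 1)^4\<close>. Against the area of
  the disc of radius \<open>(n + 1) * \<kappa>\<close> this leaves the convergent series of
  \<open>1 / (n + 1)^2\<close>.\<close>

lemma nn_integral_bump:
  obtains C :: real where "0 < C"
    and "\<And>(a::complex) \<kappa>. 0 < \<kappa> \<Longrightarrow> (\<integral>\<^sup>+z. ennreal (1 / (1 + dist a z / \<kappa>)^4) \<partial>lborel) \<le> ennreal (C * \<kappa>^2)"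
proof -
  define C where "C = (\<Sum>n::nat. pi * (1 / real (Suc n)^2))"
  have sm: "summable (\<lambda>n::nat. pi * (1 / real (Suc n)^2))"
    using inverse_power_summable[of 2, where 'a = real]
    by (subst summable_cmult_iff, subst summable_Suc_iff) (simp add: field_simps)
  show ?thesis
  proof (rule that)
    show "0 < C" unfolding C_def by (rule suminf_pos[OF sm]) simp
    fix a :: complex and \<kappa> :: real
    assume k: "0 < \<kappa>"
    let ?f = "\<lambda>n z. ennreal (1 / real (Suc n)^4) * indicator (cball a (Suc n * \<kappa>)) z"
    have "(\<integral>\<^sup>+z. ennreal (1 / (1 + dist a z / \<kappa>)^4) \<partial>lborel) \<le> (\<integral>\<^sup>+z. (\<Sum>n. ?f n z) \<partial>lborel)"
    proof (rule nn_integral_mono)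
      fix z
      define n where "n = nat \<lfloor>dist a z / \<kappa>\<rfloor>"
      have n: "real n \<le> dist a z / \<kappa>" "dist a z / \<kappa> < real n + 1"
        using k by (auto simp: n_def)
      have "ennreal (1 / (1 + dist a z / \<kappa>)^4) \<le> ennreal (1 / real (Suc n)^4)"
        using n by (intro ennreal_leI divide_left_mono power_mono mult_pos_pos) (auto intro!: add_pos_nonneg zero_less_power simp: k less_imp_le)
      also have "\<dots> = ?f n z"
        using n(2) k by (simp add: field_simps)
      also have "\<dots> = sum (\<lambda>n. ?f n z) {n}" by (subst sum.insert) (auto simp only: finite.emptyI sum.empty add_0_right empty_iff not_False_eq_True)
      also have "\<dots> \<le> (\<Sum>n. ?f n z)" by (rule sum_le_suminf) auto
      finally show "ennreal (1 / (1 + dist a z / \<kappa>)^4) \<le> (\<Sum>n. ?f n z)" .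
    qed
    also have "\<dots> = (\<Sum>n. \<integral>\<^sup>+z. ?f n z \<partial>lborel)"
      by (rule nn_integral_suminf) (auto intro!: borel_measurable_times_ennreal borel_measurable_indicator simp del: of_nat_Suc)
    also have "\<dots> = (\<Sum>n. ennreal (pi * (1 / real (Suc n)^2) * \<kappa>^2))"
    proof (rule arg_cong[where f = suminf], rule ext)
      fix n
      have "(\<integral>\<^sup>+z. ?f n z \<partial>lborel) = ennreal (1 / real (Suc n)^4) * ennreal (pi * (Suc n * \<kappa>)^2)"
        using k by (subst nn_integral_cmult_indicator) (auto simp del: of_nat_Suc simp add: emeasure_cball_complex)
      also have "\<dots> = ennreal (pi * (1 / real (Suc n)^2) * \<kappa>^2)"
      proof -
        have "1 / x^4 * (pi * (x * \<kappa>)^2) = pi * (1 / x^2) * \<kappa>^2" if "0 < x" for x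
          using that by (simp add: field_simps eval_nat_numeral)
        from this[of "real (Suc n)"]
        have "1 / real (Suc n)^4 * (pi * (Suc n * \<kappa>)^2) = pi * (1 / real (Suc n)^2) * \<kappa>^2" by simp
        then show ?thesis by (subst ennreal_mult''[symmetric]) (simp_all del: of_nat_Suc)
      qed
      finally show "(\<integral>\<^sup>+z. ?f n z \<partial>lborel) = ennreal (pi * (1 / real (Suc n)^2) * \<kappa>^2)" .
    qed
    also have "\<dots> = ennreal (\<Sum>n. pi * (1 / real (Suc n)^2) * \<kappa>^2)"
      by (intro suminf_ennreal2 summable_mult2 sm) auto
    also have "(\<Sum>n. pi * (1 / real (Suc n)^2) * \<kappa>^2) = C * \<kappa>^2"
      unfolding C_def by (rule suminf_mult2[OF sm, symmetric])
    finally show "(\<integral>\<^sup>+z. ennreal (1 / (1 + dist a z / \<kappa>)^4) \<partial>lborel) \<le> ennreal (C * \<kappa>^2)" .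
  qed
qed

section \<open>The Volterra operator as the primitive of \<open>f * g'\<close> that vanishes at
  0\<close>

lemma volterra_has_field_derivative:
  assumes f: "f holomorphic_on UNIV" and g: "g holomorphic_on UNIV"
  shows "(volterra g f has_field_derivative f z * deriv g z) (at z)"
proof -
  have "(\<lambda>w. f w * deriv g w) holomorphic_on UNIV"
    using f g by (intro holomorphic_intros) auto
  then obtain G where G: "\<And>x. (G has_field_derivative f x * deriv g x) (at x)"
    using holomorphic_convex_primitive'[of UNIV "\<lambda>w. f w * deriv g w"] by auto
  have "volterra g f = (\<lambda>z. G z - G 0)"
  proof
    fix z
    have "((\<lambda>w. f w * deriv g w) has_contour_integral (G (pathfinish (linepath 0 z)) - G (pathstart (linepath 0 z)))) (linepath 0 z)"
      by (rule contour_integral_primitive[of UNIV]) (use G has_field_derivative_at_within valid_path_linepath in blast)+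
    then have "((\<lambda>w. f w * deriv g w) has_contour_integral (G z - G 0)) (linepath 0 z)" by simp
    then show "volterra g f z = G z - G 0"
      by (simp add: volterra_def contour_integral_unique)
  qed
  then show ?thesis by (auto intro!: derivative_eq_intros G)
qed

lemma holomorphic_on_volterra:
  "f holomorphic_on UNIV \<Longrightarrow> g holomorphic_on UNIV \<Longrightarrow> volterra g f holomorphic_on UNIV"
  using volterra_has_field_derivative by (metis field_differentiable_at_within field_differentiable_def holomorphic_onI)

lemma deriv_volterra:
  "f holomorphic_on UNIV \<Longrightarrow> g holomorphic_on UNIV \<Longrightarrow> deriv (volterra g f) z = f z * deriv g z"
  by (rule DERIV_imp_deriv[OF volterra_has_field_derivative])

lemma volterra_0 [simp]: "volterra g f 0 = 0"
  by (simp add: volterra_def)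

lemma volterra_diff:
  assumes "f holomorphic_on UNIV" "h holomorphic_on UNIV" "g holomorphic_on UNIV"
  shows "volterra g (\<lambda>w. f w - h w) z = volterra g f z - volterra g h z"
proof -
  have "(\<lambda>w. u w * deriv g w) contour_integrable_on linepath 0 z" if "u holomorphic_on UNIV" for u
  proof -
    have "(\<lambda>w. u w * deriv g w) holomorphic_on UNIV"
      using that assms(3) by (intro holomorphic_intros) auto
    then show ?thesis
      by (intro contour_integrable_continuous_linepath holomorphic_on_imp_continuous_on)
         (rule holomorphic_on_subset, auto)
  qed
  then show ?thesis
    using assms by (simp add: volterra_def algebra_simps contour_integral_diff)
qed

section \<open>The weighted spaces as metric spaces\<close>

lemma ennreal_exponent_cases:
  fixes p :: ennreal
  assumes "0 < p"
  obtains "p = \<infinity>" | q where "0 < q" "p = ennreal q"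
  using assms by (cases p rule: ennreal_cases) auto

lemma fock_space_holomorphic: "f \<in> fock_space \<psi> p \<Longrightarrow> f holomorphic_on UNIV"
  by (simp add: fock_space_def)

lemma fock_norm_infinity_bound:
  assumes "f \<in> fock_space \<psi> \<infinity>"
  shows "cmod (f z) \<le> fock_norm \<psi> \<infinity> f * exp (radial \<psi> z)"
proof -
  have "cmod (f z) * exp (- radial \<psi> z) \<le> fock_norm \<psi> \<infinity> f"
    using assms by (auto simp: fock_space_def fock_norm_def intro: cSUP_upper)
  then show ?thesis by (simp add: exp_minus field_simps)
qed

lemma fock_space_infinityI:
  assumes "f holomorphic_on UNIV" "\<And>z. cmod (f z) \<le> B * exp (radial \<psi> z)"
  shows "f \<in> fock_space \<psi> \<infinity>" "fock_norm \<psi> \<infinity> f \<le> B"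
proof -
  have "cmod (f z) * exp (- radial \<psi> z) \<le> B" for z
    using assms(2)[of z] by (simp add: exp_minus field_simps)
  then show "f \<in> fock_space \<psi> \<infinity>" "fock_norm \<psi> \<infinity> f \<le> B"
    using assms(1) by (auto simp: fock_space_def fock_norm_def intro!: bdd_aboveI2 cSUP_least)
qed

lemma fock_norm_nonneg:
  assumes "f \<in> fock_space \<psi> p"
  shows "0 \<le> fock_norm \<psi> p f"
proof (cases "p = \<infinity>")
  case True
  have "0 \<le> cmod (f 0) * exp (- radial \<psi> 0)" by simp
  also have "\<dots> \<le> fock_norm \<psi> \<infinity> f"
    using assms True by (auto simp: fock_space_def fock_norm_def intro: cSUP_upper)
  finally show ?thesis using True by simp
qed (simp add: fock_norm_def)

lemma fock_dist_nonneg [simp]: "0 \<le> fock_dist \<psi> p f h"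
  by (simp add: fock_dist_def)

lemma fock_dist_commute: "fock_dist \<psi> p f h = fock_dist \<psi> p h f"
  by (simp add: fock_dist_def fock_norm_def norm_minus_commute)

lemma powr_le_imp_le:
  fixes a b :: real
  assumes "0 < q" "0 \<le> b" "a powr q \<le> b powr q"
  shows "a \<le> b"
  using powr_less_mono2[of q b a] assms by (cases "a \<le> b") auto

locale radial_weight =
  fixes \<psi> :: "real \<Rightarrow> real"
  assumes continuous_weight: "continuous_on UNIV (radial \<psi>)"
begin

abbreviation fock_density :: "real \<Rightarrow> (complex \<Rightarrow> complex) \<Rightarrow> complex \<Rightarrow> real" where
  "fock_density q f z \<equiv> cmod (f z) powr q * exp (- (q * radial \<psi> z))"

lemma measurable_fock_density [measurable]:
  assumes "f holomorphic_on UNIV"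
  shows "fock_density q f \<in> borel_measurable borel"
proof -
  have [measurable]: "f \<in> borel_measurable borel"
    using assms by (intro borel_measurable_continuous_onI holomorphic_on_imp_continuous_on)
  have [measurable]: "radial \<psi> \<in> borel_measurable borel"
    by (intro borel_measurable_continuous_onI continuous_weight)
  show ?thesis by measurable
qed

lemma fock_space_finite_iff:
  assumes "0 < q"
  shows "f \<in> fock_space \<psi> (ennreal q) \<longleftrightarrow>
    f holomorphic_on UNIV \<and> (\<integral>\<^sup>+z. ennreal (fock_density q f z) \<partial>lborel) < \<infinity>"
  using assms measurable_fock_density[of f q]
  by (auto simp: fock_space_def integrable_iff_bounded)

lemma fock_norm_finite:
  assumes "0 < q"
  shows "fock_norm \<psi> (ennreal q) f = (LINT z|lborel. fock_density q f z) powr (1 / q)"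
  using assms by (simp add: fock_norm_def)

lemma fock_norm_powr:
  assumes "0 < q"
  shows "fock_norm \<psi> (ennreal q) f powr q = (LINT z|lborel. fock_density q f z)"
  using assms by (simp add: fock_norm_finite powr_powr)

lemma nn_integral_fock_density:
  assumes "0 < q" "f \<in> fock_space \<psi> (ennreal q)"
  shows "(\<integral>\<^sup>+z. ennreal (fock_density q f z) \<partial>lborel) = ennreal (fock_norm \<psi> (ennreal q) f powr q)"
  using assms by (subst nn_integral_eq_integral) (auto simp: fock_norm_powr fock_space_def)

lemma fock_space_finiteI:
  assumes q: "0 < q" and f: "f holomorphic_on UNIV" and B: "0 \<le> B"
    and le: "(\<integral>\<^sup>+z. ennreal (fock_density q f z) \<partial>lborel) \<le> ennreal (B powr q)"
  shows "f \<in> fock_space \<psi> (ennreal q)" "fock_norm \<psi> (ennreal q) f \<le> B"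
proof -
  show mem: "f \<in> fock_space \<psi> (ennreal q)"
    using q f le by (auto simp: fock_space_finite_iff intro: le_less_trans)
  have "fock_norm \<psi> (ennreal q) f powr q \<le> B powr q"
    using le nn_integral_fock_density[OF q mem] by (simp add: ennreal_le_iff)
  then show "fock_norm \<psi> (ennreal q) f \<le> B"
    by (rule powr_le_imp_le[OF q B])
qed

text \<open>On bounded sets the weight is bounded, so the unweighted mean value inequality on unit
  discs suffices. The constant depends badly on the radius; it serves Montel's theorem and the disc
  on which the asymptotic estimates do not yet hold.\<close>

lemma fock_local_bound:
  assumes p: "0 < p"
  obtains C where "0 < C" "\<And>f z. \<lbrakk>f \<in> fock_space \<psi> p; cmod z \<le> R\<rbrakk> \<Longrightarrow> cmod (f z) \<le> C * fock_norm \<psi> p f"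
proof -
  have "compact (radial \<psi> ` cball 0 (R + 1))"
    by (intro compact_continuous_image continuous_on_subset[OF continuous_weight]) auto
  then obtain M0 where M0: "\<And>z. z \<in> cball 0 (R + 1) \<Longrightarrow> norm (radial \<psi> z) \<le> M0"
    by (meson bounded_iff compact_imp_bounded imageI)
  then have M: "radial \<psi> z \<le> M0" if "cmod z \<le> R + 1" for z
    using that by (metis abs_le_D1 mem_cball_0 real_norm_def)
  show ?thesis
    using p
  proof (cases p rule: ennreal_exponent_cases)
    case 1
    show ?thesis
    proof (rule that)
      show "0 < exp M0" by simp
      fix f z assume f: "f \<in> fock_space \<psi> p" and z: "cmod z \<le> R"
      have "cmod (f z) \<le> fock_norm \<psi> \<infinity> f * exp (radial \<psi> z)"
        using fock_norm_infinity_bound f 1 by simp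
      also have "\<dots> \<le> fock_norm \<psi> \<infinity> f * exp M0"
        using M[of z] z f 1 by (intro mult_left_mono) (auto intro: fock_norm_nonneg)
      finally show "cmod (f z) \<le> exp M0 * fock_norm \<psi> p f" using 1 by (simp add: mult.commute)
    qed
  next
    case (2 q)
    obtain C where C: "0 < C" and sub: "\<And>h a r. \<lbrakk>0 < r; continuous_on (cball a r) h; h holomorphic_on ball a r\<rbrakk> \<Longrightarrow>
      ennreal (cmod (h a) powr q * r^2) \<le> ennreal C * (\<integral>\<^sup>+z\<in>cball a r. ennreal (cmod (h z) powr q) \<partial>lborel)"
      using submean_powr[OF 2(1)] by blast
    show ?thesis
    proof (rule that)
      show "0 < (C * exp (q * M0)) powr (1 / q)" using C by simp
      fix f z assume f: "f \<in> fock_space \<psi> p" and z: "cmod z \<le> R"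
      have hol: "f holomorphic_on UNIV" using f by (rule fock_space_holomorphic)
      have [measurable]: "f \<in> borel_measurable borel"
        using hol by (intro borel_measurable_continuous_onI holomorphic_on_imp_continuous_on)
      have "ennreal (cmod (f z) powr q * 1^2) \<le> ennreal C * (\<integral>\<^sup>+w\<in>cball z 1. ennreal (cmod (f w) powr q) \<partial>lborel)"
        by (intro sub holomorphic_on_imp_continuous_on holomorphic_on_subset[OF hol]) auto
      also have "\<dots> \<le> ennreal C * (\<integral>\<^sup>+w. ennreal (exp (q * M0)) * ennreal (fock_density q f w) \<partial>lborel)"
      proof (intro mult_left_mono nn_integral_mono)
        fix w
        show "ennreal (cmod (f w) powr q) * indicator (cball z 1) w \<le> ennreal (exp (q * M0)) * ennreal (fock_density q f w)"
        proof (cases "w \<in> cball z 1")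
          case True
          then have "cmod w \<le> R + 1"
            using z norm_triangle_ineq2[of w z] by (simp add: dist_norm norm_minus_commute)
          then have "1 \<le> exp (q * M0) * exp (- (q * radial \<psi> w))"
            using M 2 by (simp flip: exp_add)
          then have "cmod (f w) powr q * 1 \<le> cmod (f w) powr q * (exp (q * M0) * exp (- (q * radial \<psi> w)))"
            by (rule mult_left_mono) simp
          then show ?thesis using True
            by (subst ennreal_mult''[symmetric]) (auto intro!: ennreal_leI simp: mult.left_commute)
        qed simp
      qed auto
      also have "(\<integral>\<^sup>+w. ennreal (exp (q * M0)) * ennreal (fock_density q f w) \<partial>lborel)
          = ennreal (exp (q * M0)) * (\<integral>\<^sup>+w. ennreal (fock_density q f w) \<partial>lborel)"
        using hol by (intro nn_integral_cmult) measurable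
      also have "(\<integral>\<^sup>+w. ennreal (fock_density q f w) \<partial>lborel) = ennreal (fock_norm \<psi> p f powr q)"
        using nn_integral_fock_density f 2 by simp
      also have "ennreal C * (ennreal (exp (q * M0)) * ennreal (fock_norm \<psi> p f powr q))
          = ennreal (C * exp (q * M0) * fock_norm \<psi> p f powr q)"
        using C by (simp add: ennreal_mult mult.assoc)
      finally have "cmod (f z) powr q \<le> C * exp (q * M0) * fock_norm \<psi> p f powr q"
        using C by (simp add: ennreal_le_iff)
      then have "(cmod (f z) powr q) powr (1 / q) \<le> (C * exp (q * M0) * fock_norm \<psi> p f powr q) powr (1 / q)"
        using 2 by (intro powr_mono2) auto
      then show "cmod (f z) \<le> (C * exp (q * M0)) powr (1 / q) * fock_norm \<psi> p f"
        using 2 C fock_norm_nonneg[OF f] by (simp add: powr_mult powr_powr)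
    qed
  qed
qed

lemma fock_norm_eq_0_iff:
  assumes p: "0 < p" and f: "f \<in> fock_space \<psi> p"
  shows "fock_norm \<psi> p f = 0 \<longleftrightarrow> f = (\<lambda>_. 0)"
proof
  assume 0: "fock_norm \<psi> p f = 0"
  have "f z = 0" for z
  proof -
    obtain C where "\<And>f w. \<lbrakk>f \<in> fock_space \<psi> p; cmod w \<le> cmod z\<rbrakk> \<Longrightarrow> cmod (f w) \<le> C * fock_norm \<psi> p f"
      using fock_local_bound[OF p] by metis
    from this[OF f, of z] show "f z = 0" using 0 by simp
  qed
  then show "f = (\<lambda>_. 0)" by auto
next
  assume "f = (\<lambda>_. 0)"
  then show "fock_norm \<psi> p f = 0" by (simp add: fock_norm_def)
qed

text \<open>After division by \<open>x + y\<close> this is \<open>t \<le> t powr q\<close> for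
  \<open>t\<close> between 0 and 1.\<close>

lemma powr_add_le:
  fixes x y :: real
  assumes "0 < q" "q \<le> 1" "0 \<le> x" "0 \<le> y"
  shows "(x + y) powr q \<le> x powr q + y powr q"
proof (cases "x + y = 0")
  case False
  have le: "t / (x + y) \<le> (t / (x + y)) powr q" if "0 \<le> t" "t \<le> x + y" for t
    using powr_mono'[of q 1 "t / (x + y)"] that assms False by auto
  have "1 = x / (x + y) + y / (x + y)" using False by (simp add: add_divide_distrib[symmetric])
  also have "\<dots> \<le> (x / (x + y)) powr q + (y / (x + y)) powr q"
    using le[of x] le[of y] assms by simp
  also have "\<dots> = (x powr q + y powr q) / (x + y) powr q"
    using assms by (simp add: powr_divide add_divide_distrib)
  finally show ?thesis using assms False by (simp add: field_simps)
qed (use assms in simp)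

lemma powr_add_le_2:
  fixes x y :: real
  assumes "0 < q" "0 \<le> x" "0 \<le> y"
  shows "(x + y) powr q \<le> 2 powr q * (x powr q + y powr q)"
proof -
  have "(x + y) powr q \<le> (2 * max x y) powr q"
    using assms by (intro powr_mono2) auto
  also have "\<dots> = 2 powr q * max x y powr q" using assms by (simp add: powr_mult)
  also have "\<dots> \<le> 2 powr q * (x powr q + y powr q)"
    by (intro mult_left_mono) (auto simp: max_def)
  finally show ?thesis .
qed

lemma fock_space_diff:
  assumes p: "0 < p" and f: "f \<in> fock_space \<psi> p" and h: "h \<in> fock_space \<psi> p"
  shows "(\<lambda>z. f z - h z) \<in> fock_space \<psi> p"
  using p
proof (cases p rule: ennreal_exponent_cases)
  case 1
  show ?thesis unfolding 1
  proof (rule fock_space_infinityI)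
    show "(\<lambda>z. f z - h z) holomorphic_on UNIV"
      by (intro holomorphic_on_diff fock_space_holomorphic[OF f] fock_space_holomorphic[OF h])
    show "cmod (f z - h z) \<le> (fock_norm \<psi> \<infinity> f + fock_norm \<psi> \<infinity> h) * exp (radial \<psi> z)" for z
      using norm_triangle_ineq4[of "f z" "h z"] fock_norm_infinity_bound[of f \<psi> z] fock_norm_infinity_bound[of h \<psi> z]
        f h 1 by (simp add: algebra_simps)
  qed
next
  case (2 q)
  have hol: "f holomorphic_on UNIV" "h holomorphic_on UNIV" "(\<lambda>z. f z - h z) holomorphic_on UNIV"
    by (intro holomorphic_on_diff fock_space_holomorphic[OF f] fock_space_holomorphic[OF h])+
  have "integrable lborel (\<lambda>z. 2 powr q * (fock_density q f z + fock_density q h z))"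
    using f h 2 by (auto simp: fock_space_def)
  then have "integrable lborel (fock_density q (\<lambda>z. f z - h z))"
  proof (rule Bochner_Integration.integrable_bound)
    show "fock_density q (\<lambda>z. f z - h z) \<in> borel_measurable lborel"
      using measurable_fock_density[OF hol(3)] by simp
    have "cmod (f z - h z) powr q \<le> 2 powr q * (cmod (f z) powr q + cmod (h z) powr q)" for z
    proof -
      have "cmod (f z - h z) powr q \<le> (cmod (f z) + cmod (h z)) powr q"
        by (rule powr_mono2[OF _ _ norm_triangle_ineq4]) (use 2 in simp_all)
      also have "\<dots> \<le> 2 powr q * (cmod (f z) powr q + cmod (h z) powr q)"
        using 2 by (intro powr_add_le_2) auto
      finally show ?thesis .
    qed
    then have "fock_density q (\<lambda>z. f z - h z) z \<le> 2 powr q * (fock_density q f z + fock_density q h z)" for z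
      using mult_right_mono[of "cmod (f z - h z) powr q" "2 powr q * (cmod (f z) powr q + cmod (h z) powr q)" "exp (- (q * radial \<psi> z))"]
      by (simp add: algebra_simps)
    then show "AE z in lborel. norm (fock_density q (\<lambda>z. f z - h z) z) \<le> norm (2 powr q * (fock_density q f z + fock_density q h z))"
      by (intro AE_I2) (simp add: abs_mult)
  qed
  then show ?thesis using 2 hol(3) by (simp add: fock_space_def)
qed

text \<open>Both functions are divided by slightly more than their norms, so that the convexity of
  \<^term>\<open>\<lambda>x. x powr q\<close> applies even if one of the norms vanishes.\<close>

lemma fock_norm_triangle_1:
  assumes q: "1 \<le> q" and f: "f \<in> fock_space \<psi> (ennreal q)" and h: "h \<in> fock_space \<psi> (ennreal q)"
  shows "fock_norm \<psi> (ennreal q) (\<lambda>z. f z - h z) \<le> fock_norm \<psi> (ennreal q) f + fock_norm \<psi> (ennreal q) h"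
proof (rule field_le_epsilon)
  fix e :: real
  assume e: "0 < e"
  let ?N = "fock_norm \<psi> (ennreal q)"
  define A where "A = ?N f + e / 2"
  define B where "B = ?N h + e / 2"
  have A: "0 < A" "?N f \<le> A" and B: "0 < B" "?N h \<le> B"
    using e fock_norm_nonneg[OF f] fock_norm_nonneg[OF h] by (auto simp: A_def B_def)
  have d: "(\<lambda>z. f z - h z) \<in> fock_space \<psi> (ennreal q)"
    using q f h by (intro fock_space_diff) auto
  have conv: "(x + y) powr q \<le> (A + B) powr q * (A / (A + B) * (x / A) powr q + B / (A + B) * (y / B) powr q)"
    if "0 \<le> x" "0 \<le> y" for x y
  proof (cases "x = 0 \<or> y = 0")
    case True
    \<comment> \<open>Convexity is applied below at positive arguments only. If one argument
      vanishes, the claim reduces to \<open>((S + D) / S) powr (q - 1) \<ge> 1\<close>.\<close>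
    have *: "t powr q \<le> (S + D) powr q * (S / (S + D) * (t / S) powr q)" if "0 < S" "0 < D" "0 \<le> t" for t S D
    proof -
      have "t powr q * 1 \<le> t powr q * ((S + D) / S) powr (q - 1)"
        using that q by (intro mult_left_mono ge_one_powr_ge_zero) auto
      also have "\<dots> = (S + D) powr q * (S / (S + D) * (t / S) powr q)"
        using that by (simp add: powr_divide powr_diff field_simps)
      finally show ?thesis by simp
    qed
    show ?thesis using True *[of A B x] *[of B A y] A B that q by (auto simp: add.commute)
  next
    case False
    have "(A / (A + B) * (x / A) + B / (A + B) * (y / B)) powr q \<le> A / (A + B) * (x / A) powr q + B / (A + B) * (y / B) powr q"
      using convex_onD[OF powr_convex[OF q], of "B / (A + B)" "x / A" "y / B"] A B that False
      by (auto simp: field_simps)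
    also have "A / (A + B) * (x / A) + B / (A + B) * (y / B) = (x + y) / (A + B)"
      using A B by (simp add: add_divide_distrib)
    finally have "(x + y) powr q / (A + B) powr q \<le> A / (A + B) * (x / A) powr q + B / (A + B) * (y / B) powr q"
      using A B that by (simp add: powr_divide)
    then show ?thesis using A B by (simp add: pos_divide_le_eq mult.commute)
  qed
  let ?c = "(A + B) powr q * (A / (A + B)) / A powr q" and ?d = "(A + B) powr q * (B / (A + B)) / B powr q"
  have pt: "fock_density q (\<lambda>z. f z - h z) z \<le> ?c * fock_density q f z + ?d * fock_density q h z" for z
  proof -
    have "cmod (f z - h z) powr q \<le> (cmod (f z) + cmod (h z)) powr q"
      by (rule powr_mono2[OF _ _ norm_triangle_ineq4]) (use q in simp_all)
    also have "\<dots> \<le> (A + B) powr q * (A / (A + B) * (cmod (f z) / A) powr q + B / (A + B) * (cmod (h z) / B) powr q)"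
      by (rule conv) auto
    also have "\<dots> = ?c * cmod (f z) powr q + ?d * cmod (h z) powr q"
      using A B by (simp add: powr_divide distrib_left)
    finally have "cmod (f z - h z) powr q * exp (- (q * radial \<psi> z)) \<le> (?c * cmod (f z) powr q + ?d * cmod (h z) powr q) * exp (- (q * radial \<psi> z))"
      by (rule mult_right_mono) simp
    then show ?thesis by (simp only: distrib_right mult.assoc)
  qed
  have If: "integrable lborel (fock_density q f)" and Ih: "integrable lborel (fock_density q h)"
    and Id: "integrable lborel (fock_density q (\<lambda>z. f z - h z))"
    using f h d q by (auto simp: fock_space_def)
  have "?N (\<lambda>z. f z - h z) powr q \<le> (LINT z|lborel. ?c * fock_density q f z + ?d * fock_density q h z)"
  proof -
    have "(LINT z|lborel. fock_density q (\<lambda>z. f z - h z) z) \<le> (LINT z|lborel. ?c * fock_density q f z + ?d * fock_density q h z)"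
      by (rule integral_mono[OF Id _ pt]) (use If Ih in auto)
    then show ?thesis using q by (subst fock_norm_powr) auto
  qed
  also have "\<dots> = ?c * ?N f powr q + ?d * ?N h powr q"
    using q If Ih by (simp add: fock_norm_powr)
  also have "\<dots> \<le> ?c * A powr q + ?d * B powr q"
    using A B q fock_norm_nonneg[OF f] fock_norm_nonneg[OF h]
    by (intro add_mono mult_left_mono powr_mono2) auto
  also have "\<dots> = (A + B) powr q * (A / (A + B) + B / (A + B))"
    using A B by (simp add: distrib_left)
  also have "\<dots> = (A + B) powr q" using A B by (simp add: add_divide_distrib[symmetric])
  finally have "?N (\<lambda>z. f z - h z) \<le> A + B"
    by (rule powr_le_imp_le[of q, rotated 2]) (use q A B in auto)
  then show "?N (\<lambda>z. f z - h z) \<le> ?N f + ?N h + e" by (simp add: A_def B_def)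
qed

text \<open>The triangle inequality at the origin: Minkowski for \<open>p \<ge> 1\<close>, pointwise
  subadditivity of the \<open>p\<close>-th power for \<open>p < 1\<close>. The general triangle
  inequality follows by translating the middle point to the origin.\<close>

lemma fock_dist_triangle_0:
  assumes p: "0 < p" and f: "f \<in> fock_space \<psi> p" and h: "h \<in> fock_space \<psi> p"
  shows "fock_norm \<psi> p (\<lambda>z. f z - h z) powr (if p < 1 then enn2real p else 1)
    \<le> fock_norm \<psi> p f powr (if p < 1 then enn2real p else 1) + fock_norm \<psi> p h powr (if p < 1 then enn2real p else 1)"
  using p
proof (cases p rule: ennreal_exponent_cases)
  case 1
  have "fock_norm \<psi> \<infinity> (\<lambda>z. f z - h z) \<le> fock_norm \<psi> \<infinity> f + fock_norm \<psi> \<infinity> h"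
  proof (rule fock_space_infinityI)
    show "(\<lambda>z. f z - h z) holomorphic_on UNIV"
      by (intro holomorphic_on_diff fock_space_holomorphic[OF f] fock_space_holomorphic[OF h])
    show "cmod (f z - h z) \<le> (fock_norm \<psi> \<infinity> f + fock_norm \<psi> \<infinity> h) * exp (radial \<psi> z)" for z
      using norm_triangle_ineq4[of "f z" "h z"] fock_norm_infinity_bound[of f \<psi> z] fock_norm_infinity_bound[of h \<psi> z]
        f h 1 by (simp add: algebra_simps)
  qed
  then show ?thesis using f h fock_space_diff[OF p f h] 1 by (simp add: fock_norm_nonneg)
next
  case (2 q)
  show ?thesis
  proof (cases "q < 1")
    case False
    then have "\<not> p < 1" using 2 by (simp add: ennreal_less_iff flip: ennreal_1)
    then show ?thesis
      using fock_norm_triangle_1[of q f h] f h 2 False fock_space_diff[OF p f h] by (simp add: fock_norm_nonneg)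
  next
    case True
    then have p1: "p < 1" using 2 by (simp add: ennreal_less_iff flip: ennreal_1)
    have d: "(\<lambda>z. f z - h z) \<in> fock_space \<psi> p" by (rule fock_space_diff[OF p f h])
    have If: "integrable lborel (fock_density q f)" and Ih: "integrable lborel (fock_density q h)"
      and Id: "integrable lborel (fock_density q (\<lambda>z. f z - h z))"
      using f h d 2 by (auto simp: fock_space_def)
    have "fock_density q (\<lambda>z. f z - h z) z \<le> fock_density q f z + fock_density q h z" for z
    proof -
      have "cmod (f z - h z) powr q \<le> (cmod (f z) + cmod (h z)) powr q"
        by (rule powr_mono2[OF _ _ norm_triangle_ineq4]) (use 2 in simp_all)
      also have "\<dots> \<le> cmod (f z) powr q + cmod (h z) powr q"
        using 2 True by (intro powr_add_le) auto
      finally have "cmod (f z - h z) powr q * exp (- (q * radial \<psi> z)) \<le> (cmod (f z) powr q + cmod (h z) powr q) * exp (- (q * radial \<psi> z))"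
        by (rule mult_right_mono) simp
      then show ?thesis by (simp add: distrib_right)
    qed
    then have "(LINT z|lborel. fock_density q (\<lambda>z. f z - h z) z) \<le> (LINT z|lborel. fock_density q f z + fock_density q h z)"
      using If Ih Id by (intro integral_mono) auto
    then show ?thesis using p1 2 If Ih by (simp add: fock_norm_powr)
  qed
qed

section \<open>The metric and the sequential form of compactness\<close>

lemma Metric_space_fock:
  assumes p: "0 < p"
  shows "Metric_space (fock_space \<psi> p) (fock_dist \<psi> p)"
proof
  show "0 \<le> fock_dist \<psi> p f h" for f h by simp
  show "fock_dist \<psi> p f h = fock_dist \<psi> p h f" for f h by (rule fock_dist_commute)
  show "fock_dist \<psi> p f h = 0 \<longleftrightarrow> f = h" if "f \<in> fock_space \<psi> p" "h \<in> fock_space \<psi> p" for f h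
    using fock_norm_eq_0_iff[OF p fock_space_diff[OF p that]] by (auto simp: fock_dist_def fun_eq_iff)
  show "fock_dist \<psi> p f k \<le> fock_dist \<psi> p f h + fock_dist \<psi> p h k"
    if "f \<in> fock_space \<psi> p" "h \<in> fock_space \<psi> p" "k \<in> fock_space \<psi> p" for f h k
  proof -
    have "fock_dist \<psi> p f k = fock_norm \<psi> p (\<lambda>z. (f z - h z) - (k z - h z)) powr (if p < 1 then enn2real p else 1)"
      by (simp add: fock_dist_def)
    also have "\<dots> \<le> fock_dist \<psi> p f h + fock_dist \<psi> p k h"
      unfolding fock_dist_def by (rule fock_dist_triangle_0[OF p fock_space_diff[OF p] fock_space_diff[OF p]]) (use that in auto)
    finally show ?thesis by (simp add: fock_dist_commute)
  qed
qed

lemma fock_limitin_iff: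
  assumes p: "0 < p" and F: "\<And>n. F n \<in> fock_space \<psi> p"
  shows "limitin (fock_topology \<psi> p) F u sequentially \<longleftrightarrow>
    u \<in> fock_space \<psi> p \<and> (\<lambda>n. fock_norm \<psi> p (\<lambda>z. F n z - u z)) \<longlonglongrightarrow> 0"
proof -
  define s where "s = (if p < 1 then enn2real p else 1)"
  have s: "0 < s" using p by (auto simp: s_def enn2real_positive_iff less_top[symmetric] order.strict_trans[of p 1 top])
  interpret Metric_space "fock_space \<psi> p" "fock_dist \<psi> p" by (rule Metric_space_fock[OF p])
  have "((\<lambda>n. fock_dist \<psi> p (F n) u) \<longlonglongrightarrow> 0) \<longleftrightarrow> ((\<lambda>n. fock_norm \<psi> p (\<lambda>z. F n z - u z)) \<longlonglongrightarrow> 0)"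
    if u: "u \<in> fock_space \<psi> p"
  proof
    have nn: "0 \<le> fock_norm \<psi> p (\<lambda>z. F n z - u z)" for n
    proof -
      from fock_space_diff[OF p F[of n] u] show ?thesis by (rule fock_norm_nonneg)
    qed
    { assume "(\<lambda>n. fock_norm \<psi> p (\<lambda>z. F n z - u z)) \<longlonglongrightarrow> 0"
      then have "(\<lambda>n. fock_norm \<psi> p (\<lambda>z. F n z - u z) powr s) \<longlonglongrightarrow> 0 powr s"
        using s nn by (intro tendsto_powr') auto
      then show "(\<lambda>n. fock_dist \<psi> p (F n) u) \<longlonglongrightarrow> 0" using s by (simp add: fock_dist_def s_def) }
    { assume "(\<lambda>n. fock_dist \<psi> p (F n) u) \<longlonglongrightarrow> 0"
      then have "(\<lambda>n. fock_dist \<psi> p (F n) u powr (1 / s)) \<longlonglongrightarrow> 0 powr (1 / s)"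
        using s by (intro tendsto_powr') auto
      moreover have "fock_dist \<psi> p (F n) u powr (1 / s) = fock_norm \<psi> p (\<lambda>z. F n z - u z)" for n
        using s nn[of n] unfolding fock_dist_def s_def[symmetric] by (simp add: powr_powr)
      ultimately show "(\<lambda>n. fock_norm \<psi> p (\<lambda>z. F n z - u z)) \<longlonglongrightarrow> 0" using s by simp }
  qed
  then show ?thesis
    unfolding fock_topology_def limitin_metric_dist_null using F by auto
qed

text \<open>By the Bolzano-Weierstrass criterion the closure of \<open>T\<close>
  S\<open>is compact once every sequence in\<close>T \<open>S\<close> has a subsequence converging
  somewhere in the target space; the limit may lie outside the image.\<close>

lemma compact_operatorI:
  assumes q: "0 < q" and T: "\<And>f. f \<in> fock_space \<psi> p \<Longrightarrow> T f \<in> fock_space \<psi> q"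
    and seq: "\<And>F M. \<lbrakk>\<And>n::nat. F n \<in> fock_space \<psi> p; \<And>n. fock_norm \<psi> p (F n) \<le> M\<rbrakk> \<Longrightarrow>
       \<exists>r u. strict_mono r \<and> u \<in> fock_space \<psi> q \<and> (\<lambda>n. fock_norm \<psi> q (\<lambda>z. T (F (r n)) z - u z)) \<longlonglongrightarrow> 0"
  shows "compact_operator \<psi> p q T"
  unfolding compact_operator_def
proof (intro conjI allI impI ballI T)
  fix S assume S: "S \<subseteq> fock_space \<psi> p" and "\<exists>M. \<forall>f\<in>S. fock_norm \<psi> p f \<le> M"
  then obtain M where M: "\<And>f. f \<in> S \<Longrightarrow> fock_norm \<psi> p f \<le> M" by blast
  interpret Metric_space "fock_space \<psi> q" "fock_dist \<psi> q" by (rule Metric_space_fock[OF q])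
  have TS: "T ` S \<subseteq> fock_space \<psi> q" using S T by auto
  have "\<exists>l r. l \<in> fock_space \<psi> q \<and> strict_mono r \<and> limitin mtopology (\<sigma> \<circ> r) l sequentially"
    if \<sigma>: "range \<sigma> \<subseteq> T ` S" for \<sigma> :: "nat \<Rightarrow> complex \<Rightarrow> complex"
  proof -
    have "\<forall>n. \<exists>f\<in>S. \<sigma> n = T f" using \<sigma> by auto
    then obtain F where F: "\<And>n. F n \<in> S" "\<And>n. \<sigma> n = T (F n)" by metis
    obtain r u where r: "strict_mono (r :: nat \<Rightarrow> nat)" "u \<in> fock_space \<psi> q"
      "(\<lambda>n. fock_norm \<psi> q (\<lambda>z. T (F (r n)) z - u z)) \<longlonglongrightarrow> 0"
      using seq[of F M] F S M by blast
    have "limitin (fock_topology \<psi> q) (\<sigma> \<circ> r) u sequentially"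
      using r F S T by (subst fock_limitin_iff[OF q]) auto
    then show ?thesis using r unfolding fock_topology_def by blast
  qed
  then have *: "\<forall>X. X \<subseteq> T ` S \<and> infinite X \<longrightarrow> fock_space \<psi> q \<inter> mtopology derived_set_of X \<noteq> {}"
    using Bolzano_Weierstrass_property[of "T ` S" "fock_space \<psi> q"] TS by blast
  then show "compactin (fock_topology \<psi> q) (fock_topology \<psi> q closure_of (T ` S))"
    unfolding fock_topology_def compact_closure_of_eq_Bolzano_Weierstrass by blast
qed

lemma compact_operatorD:
  assumes q: "0 < q" and T: "compact_operator \<psi> p q T"
    and F: "\<And>n::nat. F n \<in> fock_space \<psi> p" "\<And>n. fock_norm \<psi> p (F n) \<le> M"
  obtains r u where "strict_mono (r :: nat \<Rightarrow> nat)" "u \<in> fock_space \<psi> q"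
    "(\<lambda>n. fock_norm \<psi> q (\<lambda>z. T (F (r n)) z - u z)) \<longlonglongrightarrow> 0"
proof -
  interpret Metric_space "fock_space \<psi> q" "fock_dist \<psi> q" by (rule Metric_space_fock[OF q])
  have TF: "T (F n) \<in> fock_space \<psi> q" for n using T F by (auto simp: compact_operator_def)
  have "compactin mtopology (mtopology closure_of (T ` range F))"
  proof -
    have "range F \<subseteq> fock_space \<psi> p" "\<exists>M. \<forall>f\<in>range F. fock_norm \<psi> p f \<le> M"
      using F by auto
    then show ?thesis
      using conjunct2[OF T[unfolded compact_operator_def]] unfolding fock_topology_def by simp
  qed
  moreover have "range (\<lambda>n. T (F n)) \<subseteq> mtopology closure_of (T ` range F)"
  proof -
    have "range (\<lambda>n. T (F n)) \<subseteq> T ` range F" by auto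
    also have "T ` range F \<subseteq> mtopology closure_of (T ` range F)"
      by (rule closure_of_subset) (use TF in auto)
    finally show ?thesis .
  qed
  ultimately obtain l r where lr: "strict_mono (r :: nat \<Rightarrow> nat)" "limitin mtopology ((\<lambda>n. T (F n)) \<circ> r) l sequentially"
    unfolding compactin_sequentially by blast
  then have "limitin (fock_topology \<psi> q) (\<lambda>n. T (F (r n))) l sequentially"
    by (simp add: fock_topology_def o_def)
  then show ?thesis using that lr(1) fock_limitin_iff[OF q, of "\<lambda>n. T (F (r n))"] TF by blast
qed

end

section \<open>Radial calculus of the weight\<close>

lemma has_real_derivative_norm_line:
  fixes w v :: "'a::real_inner"
  assumes "w + t *\<^sub>R v \<noteq> 0"
  shows "((\<lambda>t. norm (w + t *\<^sub>R v)) has_real_derivative ((w + t *\<^sub>R v) \<bullet> v / norm (w + t *\<^sub>R v))) (at t)"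
proof -
  have "((\<lambda>t. norm (w + t *\<^sub>R v)) has_derivative (\<lambda>h. (h *\<^sub>R v) \<bullet> sgn (w + t *\<^sub>R v))) (at t)"
    by (rule has_derivative_compose[of "\<lambda>t. w + t *\<^sub>R v", OF _ has_derivative_norm, OF _ assms])
       (auto intro!: derivative_eq_intros)
  moreover have "(\<lambda>h. (h *\<^sub>R v) \<bullet> sgn (w + t *\<^sub>R v)) = (*) ((w + t *\<^sub>R v) \<bullet> v / norm (w + t *\<^sub>R v))"
    by (auto simp: sgn_div_norm fun_eq_iff inner_commute divide_simps)
  ultimately show ?thesis by (simp add: has_field_derivative_def)
qed

context admissible_weight
begin

lemma psi_has_derivative: "0 < r \<Longrightarrow> (\<psi> has_real_derivative \<psi>' r) (at r)"
  using psi_deriv[of r] at_within_interior[of r "{0..}"] by (simp add: interior_real_atLeast)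

lemma psi'_has_derivative: "0 < r \<Longrightarrow> (\<psi>' has_real_derivative \<psi>'' r) (at r)"
  using psi_deriv2[of r] at_within_interior[of r "{0..}"] by (simp add: interior_real_atLeast)

lemma continuous_on_psi: "continuous_on {0..} \<psi>"
  by (rule DERIV_continuous_on[OF psi_deriv]) auto

lemma continuous_on_psi': "continuous_on {0..} \<psi>'"
  by (rule DERIV_continuous_on[OF psi_deriv2]) auto

text \<open>Along the real axis the radial extension is the even function
  \<open>\<psi> \<bar>t\<bar>\<close>. Being differentiable at 0, it has derivative 0 there, and
  this is also its one-sided derivative.\<close>

lemma psi'_0: "\<psi>' 0 = 0"
proof -
  have "partially_differentiable 1 (radial \<psi>) 0"
    using laplacian_exists by (auto simp: has_laplacian_everywhere_def Basis_complex_def)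
  then obtain D where D: "((\<lambda>t. \<psi> \<bar>t\<bar>) has_real_derivative D) (at 0)"
    by (auto simp: partially_differentiable_def radial_def field_differentiable_def)
  have "((\<lambda>t. \<psi> \<bar>- t\<bar>) has_real_derivative D * (- 1)) (at 0)"
    by (rule DERIV_chain2[where f = "\<lambda>t. \<psi> \<bar>t\<bar>"]) (use D in \<open>auto intro!: derivative_eq_intros\<close>)
  then have "D = - D" using D DERIV_unique by fastforce
  moreover have "D = \<psi>' 0"
  proof (rule tendsto_unique)
    show "at (0::real) within {0..} \<noteq> bot" by (simp add: at_within_Ici_at_right)
    have "((\<lambda>t. \<psi> \<bar>t\<bar>) has_real_derivative D) (at 0 within {0..})"
      using D by (rule has_field_derivative_at_within)
    then have "((\<lambda>y. (\<psi> \<bar>y\<bar> - \<psi> \<bar>0\<bar>) / (y - 0)) \<longlongrightarrow> D) (at 0 within {0..})"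
      by (simp add: has_field_derivative_iff)
    then show "((\<lambda>y. (\<psi> y - \<psi> 0) / (y - 0)) \<longlongrightarrow> D) (at 0 within {0..})"
      by (rule Lim_transform_within[OF _ zero_less_one]) auto
    show "((\<lambda>y. (\<psi> y - \<psi> 0) / (y - 0)) \<longlongrightarrow> \<psi>' 0) (at 0 within {0..})"
      using psi_deriv[of 0] by (simp add: has_field_derivative_iff)
  qed
  ultimately show ?thesis by simp
qed

text \<open>The Laplacian of a radial function in polar form, meaningful for positive radii; the
  origin is treated separately.\<close>

definition lap :: "real \<Rightarrow> real" where "lap r = \<psi>'' r + \<psi>' r / r"

lemma partial_deriv_radial:
  assumes "w \<noteq> 0"
  shows "partial_deriv v (radial \<psi>) w = \<psi>' (cmod w) * (w \<bullet> v / cmod w)"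
proof -
  have "((\<lambda>t. \<psi> (norm (w + t *\<^sub>R v))) has_real_derivative \<psi>' (cmod w) * (w \<bullet> v / cmod w)) (at 0)"
    by (rule DERIV_chain2[where f = \<psi>])
       (use has_real_derivative_norm_line[of w 0 v] psi_has_derivative[of "cmod w"] assms in auto)
  then show ?thesis by (simp add: partial_deriv_def radial_def DERIV_imp_deriv)
qed

lemma partial_deriv2_radial:
  assumes z: "z \<noteq> 0"
  shows "partial_deriv v (partial_deriv v (radial \<psi>)) z =
    \<psi>'' (cmod z) * (z \<bullet> v / cmod z)^2 + \<psi>' (cmod z) * ((v \<bullet> v) / cmod z - (z \<bullet> v)^2 / cmod z ^ 3)"
proof -
  let ?P = "\<lambda>t. \<psi>' (cmod (z + t *\<^sub>R v)) * ((z + t *\<^sub>R v) \<bullet> v / cmod (z + t *\<^sub>R v))"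
  \<comment> \<open>The formula for the first partial derivative is available only off the origin,
    but a derivative depends only on the values near the point.\<close>
  have "((\<lambda>t. z + t *\<^sub>R v) \<longlongrightarrow> z + 0 *\<^sub>R v) (nhds 0)"
    by (intro tendsto_intros filterlim_ident)
  then have "\<forall>\<^sub>F t in nhds 0. z + t *\<^sub>R v \<noteq> 0"
    using z by (intro tendsto_imp_eventually_ne[where c = "z + 0 *\<^sub>R v"]) auto
  then have "\<forall>\<^sub>F t in nhds 0. partial_deriv v (radial \<psi>) (z + t *\<^sub>R v) = ?P t"
    by (rule eventually_mono) (rule partial_deriv_radial)
  then have "deriv (\<lambda>t. partial_deriv v (radial \<psi>) (z + t *\<^sub>R v)) 0 = deriv ?P 0"
    by (intro deriv_cong_ev) auto
  moreover have "(?P has_real_derivative (\<psi>'' (cmod z) * (z \<bullet> v / cmod z)^2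
      + \<psi>' (cmod z) * ((v \<bullet> v) / cmod z - (z \<bullet> v)^2 / cmod z ^ 3))) (at 0)"
  proof -
    have n: "((\<lambda>t. cmod (z + t *\<^sub>R v)) has_real_derivative (z \<bullet> v / cmod z)) (at 0)"
      using has_real_derivative_norm_line[of z 0 v] z by simp
    have p: "((\<lambda>t. \<psi>' (cmod (z + t *\<^sub>R v))) has_real_derivative \<psi>'' (cmod z) * (z \<bullet> v / cmod z)) (at 0)"
      by (rule DERIV_chain2[where f = \<psi>']) (use n psi'_has_derivative[of "cmod z"] z in auto)
    have i: "((\<lambda>t. (z + t *\<^sub>R v) \<bullet> v) has_real_derivative (v \<bullet> v)) (at 0)"
      by (simp add: inner_add_left) (auto intro!: derivative_eq_intros)
    have "(?P has_real_derivative (\<psi>'' (cmod z) * (z \<bullet> v / cmod z) * ((z + 0 *\<^sub>R v) \<bullet> v / cmod (z + 0 *\<^sub>R v)) +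
       ((v \<bullet> v) * cmod (z + 0 *\<^sub>R v) - ((z + 0 *\<^sub>R v) \<bullet> v) * (z \<bullet> v / cmod z)) / (cmod (z + 0 *\<^sub>R v) * cmod (z + 0 *\<^sub>R v)) * \<psi>' (cmod (z + 0 *\<^sub>R v)))) (at 0)"
      by (intro DERIV_mult DERIV_divide p i n) (use z in auto)
    then show ?thesis
      by (rule DERIV_cong) (use z in \<open>simp add: field_simps power2_eq_square power3_eq_cube\<close>)
  qed
  ultimately show ?thesis by (simp add: partial_deriv_def DERIV_imp_deriv)
qed

lemma laplacian_radial:
  assumes "z \<noteq> 0"
  shows "laplacian (radial \<psi>) z = lap (cmod z)"
proof -
  have "laplacian (radial \<psi>) z = \<psi>'' (cmod z) * ((Re z)^2 + (Im z)^2) / (cmod z)^2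
      + \<psi>' (cmod z) * (2 / cmod z - ((Re z)^2 + (Im z)^2) / cmod z ^ 3)"
    using assms by (simp add: laplacian_def partial_deriv2_radial Basis_complex_def inner_complex_def power_divide ring_distribs add_divide_distrib diff_divide_distrib)
  also have "(Re z)^2 + (Im z)^2 = (cmod z)^2" by (simp add: cmod_def)
  also have "\<psi>'' (cmod z) * (cmod z)^2 / (cmod z)^2 + \<psi>' (cmod z) * (2 / cmod z - (cmod z)^2 / cmod z ^ 3) = lap (cmod z)"
    using assms by (simp add: lap_def field_simps power2_eq_square power3_eq_cube)
  finally show ?thesis .
qed

lemma lap_pos: "0 < r \<Longrightarrow> 0 < lap r"
  using laplacian_pos[of "of_real r"] laplacian_radial[of "of_real r"] by simp

text \<open>In the variable \<open>t = ln r\<close> the first derivative of the weight is \<open>mom\<close>, and the second one is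
  \<open>r\<^sup>2 * lap r\<close>, of the size of \<open>(r / \<tau> r)\<^sup>2\<close>; \<open>gap\<close> below is the distance from the tangent line.\<close>

definition mom :: "real \<Rightarrow> real" where "mom r = r * \<psi>' r"

lemma mom_has_derivative: "0 < r \<Longrightarrow> (mom has_real_derivative r * lap r) (at r)"
  unfolding mom_def [abs_def] lap_def
  by (rule DERIV_cong[OF DERIV_mult[OF DERIV_ident psi'_has_derivative]]) (auto simp: field_simps)

lemma continuous_on_mom: "continuous_on {0..} mom"
  unfolding mom_def [abs_def] by (intro continuous_intros continuous_on_psi')

lemma mom_mono:
  assumes "0 \<le> r" "r \<le> s"
  shows "mom r \<le> mom s"
proof (rule DERIV_nonneg_imp_increasing_open[of r s mom])
  fix x assume "r < x" "x < s"
  then show "\<exists>y. (mom has_real_derivative y) (at x) \<and> 0 \<le> y"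
    using mom_has_derivative[of x] lap_pos[of x] assms by (intro exI[of _ "x * lap x"]) auto
qed (use assms in \<open>auto intro: continuous_on_subset[OF continuous_on_mom]\<close>)

lemma mom_nonneg: "0 \<le> r \<Longrightarrow> 0 \<le> mom r"
  using mom_mono[of 0 r] by (simp add: mom_def)

lemma psi'_nonneg: "0 \<le> r \<Longrightarrow> 0 \<le> \<psi>' r"
  using mom_nonneg[of r] psi'_0 by (cases "r = 0") (auto simp: mom_def zero_le_mult_iff)

lemma psi_mono:
  assumes "0 \<le> r" "r \<le> s"
  shows "\<psi> r \<le> \<psi> s"
proof (rule DERIV_nonneg_imp_increasing_open[of r s \<psi>])
  fix x assume "r < x" "x < s"
  then show "\<exists>y. (\<psi> has_real_derivative y) (at x) \<and> 0 \<le> y"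
    using psi_has_derivative[of x] psi'_nonneg[of x] assms by (intro exI[of _ "\<psi>' x"]) auto
qed (use assms in \<open>auto intro: continuous_on_subset[OF continuous_on_psi]\<close>)

lemma continuous_on_radial_psi: "continuous_on UNIV (radial \<psi>)"
  unfolding radial_def [abs_def]
  by (rule continuous_on_compose2[OF continuous_on_psi]) (auto intro!: continuous_intros)

lemma continuous_on_radial_psi': "continuous_on UNIV (radial \<psi>')"
  unfolding radial_def [abs_def]
  by (rule continuous_on_compose2[OF continuous_on_psi']) (auto intro!: continuous_intros)

sublocale radial_weight \<psi>
  by unfold_locales (rule continuous_on_radial_psi)

lemma tau_positive: "0 \<le> r \<Longrightarrow> 0 < \<tau> r"
  using tau_pos[of "of_real r"] by (simp add: radial_def)

text \<open>Squaring removes the power \<open>- 1 / 2\<close>. In this form the comparability says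
  that \<open>mom\<close>, whose derivative is \<open>r * lap r\<close>, has slope about
  \<open>r / (\<tau> r)^2\<close>.\<close>

lemma tau_lap_comparable:
  obtains K where "1 \<le> K" "\<And>r. 1 \<le> r \<Longrightarrow> 1 / K \<le> (\<tau> r)^2 * lap r" "\<And>r. 1 \<le> r \<Longrightarrow> (\<tau> r)^2 * lap r \<le> K"
proof -
  obtain K where K: "0 < K" and comp: "\<And>z. 1 \<le> cmod z \<Longrightarrow> inverse K * laplacian (radial \<psi>) z powr (- 1 / 2) \<le> radial \<tau> z"
    "\<And>z. 1 \<le> cmod z \<Longrightarrow> radial \<tau> z \<le> K * laplacian (radial \<psi>) z powr (- 1 / 2)"
    using tau_outside by (auto simp: comparable_on_def)
  have *: "inverse K * lap r powr (- 1 / 2) \<le> \<tau> r" "\<tau> r \<le> K * lap r powr (- 1 / 2)" if "1 \<le> r" for r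
    using comp[of "of_real r"] laplacian_radial[of "of_real r"] that by (auto simp: radial_def)
  have sq: "(lap r powr (- 1 / 2))^2 * lap r = 1" if "1 \<le> r" for r
  proof -
    have "(lap r powr (- 1 / 2))^2 = lap r powr (- 1)"
      unfolding power2_eq_square powr_add[symmetric] by simp
    then show ?thesis using lap_pos[of r] that by (simp add: powr_minus)
  qed
  have lo: "(inverse K)^2 \<le> (\<tau> r)^2 * lap r" if r: "1 \<le> r" for r
  proof -
    have "(inverse K)^2 = (inverse K * lap r powr (- 1 / 2))^2 * lap r"
      using sq[OF r] by (simp only: power_mult_distrib mult.assoc mult_1_right)
    also have "\<dots> \<le> (\<tau> r)^2 * lap r"
      using *[OF r] K r lap_pos[of r] by (intro mult_right_mono power_mono) auto
    finally show ?thesis .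
  qed
  have hi: "(\<tau> r)^2 * lap r \<le> K^2" if r: "1 \<le> r" for r
  proof -
    have "(\<tau> r)^2 * lap r \<le> (K * lap r powr (- 1 / 2))^2 * lap r"
      using *[OF r] tau_positive[of r] r lap_pos[of r] by (intro mult_right_mono power_mono) auto
    also have "\<dots> = K^2"
      using sq[OF r] by (simp only: power_mult_distrib mult.assoc mult_1_right)
    finally show ?thesis .
  qed
  show ?thesis
  proof (rule that[of "max 1 (K^2)"])
    show "1 / max 1 (K^2) \<le> (\<tau> r)^2 * lap r" if "1 \<le> r" for r
    proof -
      have "1 / max 1 (K^2) \<le> 1 / K^2" using K by (intro divide_left_mono) auto
      then show ?thesis using lo[OF that] by (simp add: inverse_eq_divide power_one_over)
    qed
    show "(\<tau> r)^2 * lap r \<le> max 1 (K^2)" if "1 \<le> r" for r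
      using hi[OF that] by simp
  qed simp
qed

lemma tau_has_derivative: "0 < r \<Longrightarrow> (\<tau> has_real_derivative deriv \<tau> r) (at r)"
proof -
  assume r: "0 < r"
  have "(radial \<tau> \<circ> of_real) differentiable (at r)"
    by (rule differentiable_chain_at)
       (auto intro: tau_differentiable bounded_linear_imp_differentiable bounded_linear_of_real)
  then have "(\<lambda>t. \<tau> \<bar>t\<bar>) differentiable (at r)" by (simp add: radial_def o_def)
  then have "\<tau> differentiable (at r)"
    by (rule differentiable_transform_within[of _ _ _ r]) (use r in \<open>auto simp: dist_real_def\<close>)
  then show ?thesis
    by (simp add: DERIV_deriv_iff_real_differentiable)
qed

text \<open>Far out \<open>\<tau>\<close> has Lipschitz constant \<open>1 / 2\<close> because its
  derivative tends to 0, so moving by at most \<open>\<tau> r\<close> changes \<open>\<tau>\<close>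
  by at most \<open>\<tau> r / 2\<close>. Since \<open>\<tau> r < 1 / 2\<close>, the movement stays
  within distance 1 of \<open>r\<close>.\<close>

lemma tau_scale:
  obtains R where "2 \<le> R" "\<And>r. R \<le> r \<Longrightarrow> \<tau> r \<le> 1 / 2"
    "\<And>r \<rho>. \<lbrakk>R \<le> r; \<bar>\<rho> - r\<bar> \<le> \<tau> r\<rbrakk> \<Longrightarrow> \<tau> r / 2 \<le> \<tau> \<rho> \<and> \<tau> \<rho> \<le> 2 * \<tau> r"
proof -
  have "\<forall>\<^sub>F r in at_top. \<tau> r < 1 / 2 \<and> \<bar>deriv \<tau> r\<bar> < 1 / 2"
  proof (rule eventually_conj)
    show "\<forall>\<^sub>F r in at_top. \<tau> r < 1 / 2" using tau_lim by (rule order_tendstoD) simp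
    have "((\<lambda>r. \<bar>deriv \<tau> r\<bar>) \<longlongrightarrow> 0) at_top" using tau_deriv_lim by (rule tendsto_rabs_zero)
    then show "\<forall>\<^sub>F r in at_top. \<bar>deriv \<tau> r\<bar> < 1 / 2" by (rule order_tendstoD) simp
  qed
  then obtain R0 where R0: "\<And>r. R0 \<le> r \<Longrightarrow> \<tau> r < 1 / 2" "\<And>r. R0 \<le> r \<Longrightarrow> \<bar>deriv \<tau> r\<bar> < 1 / 2"
    by (auto simp: eventually_at_top_linorder)
  show ?thesis
  proof (rule that[of "max 2 (R0 + 1)"])
    fix r \<rho> assume r: "max 2 (R0 + 1) \<le> r" and \<rho>: "\<bar>\<rho> - r\<bar> \<le> \<tau> r"
    have t: "\<tau> r < 1 / 2" using R0(1)[of r] r by simp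
    have "norm (\<tau> \<rho> - \<tau> r) \<le> 1 / 2 * norm (\<rho> - r)"
    proof (rule field_differentiable_bound[of "{r - 1..r + 1}" \<tau> "deriv \<tau>"])
      fix x assume "x \<in> {r - 1..r + 1}"
      then have "R0 \<le> x" "0 < x" using r by auto
      then show "(\<tau> has_field_derivative deriv \<tau> x) (at x within {r - 1..r + 1})" "norm (deriv \<tau> x) \<le> 1 / 2"
        using tau_has_derivative R0(2)[of x] by (auto intro: has_field_derivative_at_within)
    qed (use t \<rho> in auto)
    then have "\<bar>\<tau> \<rho> - \<tau> r\<bar> \<le> 1 / 2 * \<tau> r" using \<rho> by simp
    moreover have "0 \<le> \<tau> r" using \<rho> by linarith
    ultimately show "\<tau> r / 2 \<le> \<tau> \<rho> \<and> \<tau> \<rho> \<le> 2 * \<tau> r" by argo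
  qed (use R0 in \<open>auto intro: less_imp_le\<close>)
qed

end

text \<open>The constants are fixed once for all later estimates: \<open>c\<close> governs the
  growth of \<open>gap\<close> and the lower bound of \<open>\<psi>'\<close>, \<open>C\<close> the
  size of \<open>gap\<close> within one step.\<close>

locale scaled_weight = admissible_weight +
  fixes R c C :: real
  assumes R_ge: "2 \<le> R" and c_pos: "0 < c" and c_le: "c \<le> 1" and C_ge: "1 \<le> C"
    and tau_le: "\<And>r. R \<le> r \<Longrightarrow> \<tau> r \<le> 1 / 2"
    and tau_lower: "\<And>r \<rho>. \<lbrakk>R \<le> r; \<bar>\<rho> - r\<bar> \<le> \<tau> r\<rbrakk> \<Longrightarrow> \<tau> r / 2 \<le> \<tau> \<rho>"
    and tau_upper: "\<And>r \<rho>. \<lbrakk>R \<le> r; \<bar>\<rho> - r\<bar> \<le> \<tau> r\<rbrakk> \<Longrightarrow> \<tau> \<rho> \<le> 2 * \<tau> r"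
    and mom_lower: "\<And>r \<rho>. \<lbrakk>R \<le> r; \<bar>\<rho> - r\<bar> \<le> \<tau> r\<rbrakk> \<Longrightarrow> c * r * \<bar>\<rho> - r\<bar> / (\<tau> r)^2 \<le> \<bar>mom \<rho> - mom r\<bar>"
    and mom_upper: "\<And>r \<rho>. \<lbrakk>R \<le> r; \<bar>\<rho> - r\<bar> \<le> \<tau> r\<rbrakk> \<Longrightarrow> \<bar>mom \<rho> - mom r\<bar> \<le> C * r * \<bar>\<rho> - r\<bar> / (\<tau> r)^2"

context admissible_weight
begin

text \<open>The mean value theorem for \<open>mom\<close>, whose derivative \<open>x * lap x\<close>
  is comparable with \<open>r / (\<tau> r)^2\<close> throughout the \<open>\<tau>\<close>-step
  around \<open>r\<close>.\<close>

lemma scaled_weight_exists: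
  obtains R c C where "scaled_weight \<psi> \<psi>' \<psi>'' \<tau> R c C"
proof -
  obtain K where K: "1 \<le> K" and lo: "\<And>r. 1 \<le> r \<Longrightarrow> 1 / K \<le> (\<tau> r)^2 * lap r"
    and hi: "\<And>r. 1 \<le> r \<Longrightarrow> (\<tau> r)^2 * lap r \<le> K"
    by (rule tau_lap_comparable) blast
  obtain R where R: "2 \<le> R" "\<And>r. R \<le> r \<Longrightarrow> \<tau> r \<le> 1 / 2"
    and sc: "\<And>r \<rho>. \<lbrakk>R \<le> r; \<bar>\<rho> - r\<bar> \<le> \<tau> r\<rbrakk> \<Longrightarrow> \<tau> r / 2 \<le> \<tau> \<rho> \<and> \<tau> \<rho> \<le> 2 * \<tau> r"
    by (rule tau_scale) blast
  have main: "1 / (8 * K) * r * \<bar>\<rho> - r\<bar> / (\<tau> r)^2 \<le> \<bar>mom \<rho> - mom r\<bar> \<and> \<bar>mom \<rho> - mom r\<bar> \<le> 8 * K * r * \<bar>\<rho> - r\<bar> / (\<tau> r)^2"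
    if r: "R \<le> r" and \<rho>: "\<bar>\<rho> - r\<bar> \<le> \<tau> r" for r \<rho>
  proof -
    have tp: "0 < \<tau> r" using tau_positive[of r] r R by simp
    have t2: "\<tau> r \<le> 1 / 2" using R r by simp
    \<comment> \<open>The factor 8 is \<open>4 * 2\<close>: replacing \<open>\<tau> x\<close> by
      \<open>\<tau> r\<close> costs 2, squared, and replacing \<open>x\<close> by \<open>r\<close>
      costs another 2.\<close>
    have bd: "1 / (8 * K) * r / (\<tau> r)^2 \<le> x * lap x \<and> x * lap x \<le> 8 * K * r / (\<tau> r)^2" if x: "\<bar>x - r\<bar> \<le> \<tau> r" for x
    proof -
      have x1: "1 \<le> x" "r / 2 \<le> x" "x \<le> 2 * r" using x t2 r R(1) by linarith+
      have tx: "\<tau> r / 2 \<le> \<tau> x" "\<tau> x \<le> 2 * \<tau> r" using sc[OF r x] by auto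
      have lx: "0 < lap x" using lap_pos x1 by simp
      have "1 / K \<le> (\<tau> x)^2 * lap x" using lo x1 by simp
      also have "\<dots> \<le> (2 * \<tau> r)^2 * lap x" using tx tp lx by (intro mult_right_mono power_mono) auto
      finally have l1: "1 / (4 * K) / (\<tau> r)^2 \<le> lap x" using K tp by (simp add: field_simps power2_eq_square)
      have "(\<tau> r / 2)^2 * lap x \<le> (\<tau> x)^2 * lap x" using tx tp lx by (intro mult_right_mono power_mono) auto
      also have "\<dots> \<le> K" using hi x1 by simp
      finally have l2: "lap x \<le> 4 * K / (\<tau> r)^2" using tp by (simp add: field_simps power2_eq_square)
      have "r / 2 * (1 / (4 * K) / (\<tau> r)^2) \<le> x * lap x"
        using l1 x1 K r R by (intro mult_mono) auto
      moreover have "x * lap x \<le> 2 * r * (4 * K / (\<tau> r)^2)"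
        using l2 x1 K r R lx by (intro mult_mono) auto
      ultimately show ?thesis by (simp add: field_simps)
    qed
    have \<rho>p: "0 < \<rho>" "0 < r" using \<rho> t2 r R(1) by linarith+
    have "\<exists>x. \<bar>x - r\<bar> \<le> \<tau> r \<and> \<bar>mom \<rho> - mom r\<bar> = \<bar>\<rho> - r\<bar> * (x * lap x)"
    proof (cases \<rho> r rule: linorder_cases)
      case less
      have "\<exists>z>\<rho>. z < r \<and> mom r - mom \<rho> = (r - \<rho>) * (z * lap z)"
        using less \<rho>p by (intro MVT2 mom_has_derivative) auto
      then obtain z where z: "\<rho> < z" "z < r" "mom r - mom \<rho> = (r - \<rho>) * (z * lap z)" by blast
      have "mom \<rho> \<le> mom r" using less \<rho>p by (intro mom_mono) auto
      then show ?thesis using z \<rho> less by (intro exI[of _ z]) auto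
    next
      case equal
      then show ?thesis using tp by (intro exI[of _ r]) auto
    next
      case greater
      have "\<exists>z>r. z < \<rho> \<and> mom \<rho> - mom r = (\<rho> - r) * (z * lap z)"
        using greater \<rho>p by (intro MVT2 mom_has_derivative) auto
      then obtain z where z: "r < z" "z < \<rho>" "mom \<rho> - mom r = (\<rho> - r) * (z * lap z)" by blast
      have "mom r \<le> mom \<rho>" using greater \<rho>p by (intro mom_mono) auto
      then show ?thesis using z \<rho> greater by (intro exI[of _ z]) auto
    qed
    then obtain x where x: "\<bar>x - r\<bar> \<le> \<tau> r" "\<bar>mom \<rho> - mom r\<bar> = \<bar>\<rho> - r\<bar> * (x * lap x)" by blast
    show ?thesis
      using mult_left_mono[OF conjunct1[OF bd[OF x(1)]], of "\<bar>\<rho> - r\<bar>"] mult_left_mono[OF conjunct2[OF bd[OF x(1)]], of "\<bar>\<rho> - r\<bar>"]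
      unfolding x(2) by (simp add: mult_ac)
  qed
  show ?thesis
  proof (rule that[of R "1 / (8 * K)" "8 * K"], unfold_locales)
    show "0 < 1 / (8 * K)" "1 / (8 * K) \<le> 1" "1 \<le> 8 * K" using K by auto
    fix r \<rho> assume r: "R \<le> r" and \<rho>: "\<bar>\<rho> - r\<bar> \<le> \<tau> r"
    show "\<tau> r / 2 \<le> \<tau> \<rho>" "\<tau> \<rho> \<le> 2 * \<tau> r" using sc[OF r \<rho>] by auto
    show "1 / (8 * K) * r * \<bar>\<rho> - r\<bar> / (\<tau> r)^2 \<le> \<bar>mom \<rho> - mom r\<bar>"
      "\<bar>mom \<rho> - mom r\<bar> \<le> 8 * K * r * \<bar>\<rho> - r\<bar> / (\<tau> r)^2" using main[OF r \<rho>] by auto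
  qed (use R in auto)
qed

end

context scaled_weight
begin

lemma tau_pos': "R \<le> r \<Longrightarrow> 0 < \<tau> r"
  using tau_positive R_ge by auto

lemma mom_step_up: "R \<le> r \<Longrightarrow> mom r + c * r / \<tau> r \<le> mom (r + \<tau> r)"
  using mom_lower[of r "r + \<tau> r"] mom_mono[of r "r + \<tau> r"] tau_pos'[of r] R_ge
  by (simp add: power2_eq_square)

lemma mom_step_down: "R \<le> r \<Longrightarrow> mom (r - \<tau> r) + c * r / \<tau> r \<le> mom r"
  using mom_lower[of r "r - \<tau> r"] mom_mono[of "r - \<tau> r" r] tau_pos'[of r] tau_le[of r] R_ge
  by (simp add: power2_eq_square)

text \<open>\<open>mom\<close> gains \<open>c * r / \<tau> r\<close> between
  \<open>r - \<tau> r\<close> and \<open>r\<close>, and it starts from a non-negative value.\<close>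

lemma psi'_lower: "R \<le> r \<Longrightarrow> c / \<tau> r \<le> \<psi>' r"
proof -
  assume r: "R \<le> r"
  have "0 \<le> mom (r - \<tau> r)" using r R_ge tau_le[of r] by (intro mom_nonneg) auto
  then have "c * r / \<tau> r \<le> mom r" using mom_step_down[OF r] by simp
  then have "r * (c / \<tau> r) \<le> r * \<psi>' r" by (simp add: mom_def mult.commute)
  moreover have "0 < r" using r R_ge by simp
  ultimately show ?thesis by (rule mult_left_le_imp_le)
qed

section \<open>The distance of the weight from its tangent lines in \<open>ln r\<close>\<close>

definition gap :: "real \<Rightarrow> real \<Rightarrow> real" where
  "gap r \<rho> = \<psi> \<rho> - \<psi> r - mom r * ln (\<rho> / r)"

lemma gap_self [simp]: "gap r r = 0"
  by (simp add: gap_def)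

lemma gap_has_derivative:
  assumes "0 < r" "0 < \<rho>"
  shows "(gap r has_real_derivative (mom \<rho> - mom r) / \<rho>) (at \<rho>)"
proof -
  have "((\<lambda>\<rho>. \<psi> \<rho> - \<psi> r - mom r * ln (\<rho> / r)) has_real_derivative (\<psi>' \<rho> - 0 - mom r * (1 / \<rho>))) (at \<rho>)"
    using assms by (intro DERIV_diff DERIV_const DERIV_cmult psi_has_derivative)
      (auto intro!: derivative_eq_intros)
  then show ?thesis
    using assms unfolding gap_def [abs_def] by (auto simp: mom_def field_simps elim!: DERIV_cong)
qed

text \<open>As a function of \<open>ln \<rho>\<close>, \<open>gap r\<close> has slope
  \<open>mom \<rho> - mom r\<close>; this is the integrated form of a lower bound \<open>k\<close>
  for the slope. The case \<open>k = 0\<close> gives monotonicity.\<close>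

lemma gap_minus_log_mono:
  assumes "0 < r" "0 < s" "s \<le> \<rho>" and "\<And>x. s \<le> x \<Longrightarrow> x \<le> \<rho> \<Longrightarrow> k \<le> mom x - mom r"
  shows "gap r s + k * ln (\<rho> / s) \<le> gap r \<rho>"
proof -
  have "gap r s - k * ln s \<le> gap r \<rho> - k * ln \<rho>"
  proof (rule DERIV_nonneg_imp_nondecreasing[OF assms(3)])
    fix x assume x: "s \<le> x" "x \<le> \<rho>"
    show "\<exists>y. ((\<lambda>x. gap r x - k * ln x) has_real_derivative y) (at x) \<and> 0 \<le> y"
    proof (intro exI conjI)
      show "((\<lambda>x. gap r x - k * ln x) has_real_derivative ((mom x - mom r) / x - k * (1 / x))) (at x)"
        using assms x by (intro DERIV_diff DERIV_cmult gap_has_derivative) (auto intro!: derivative_eq_intros)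
      show "0 \<le> (mom x - mom r) / x - k * (1 / x)"
        using assms(1,2) assms(4)[OF x] x by (simp add: diff_divide_distrib[symmetric])
    qed
  qed
  then show ?thesis using assms by (simp add: ln_div algebra_simps)
qed

lemma gap_minus_log_antimono:
  assumes "0 < r" "0 < \<rho>" "\<rho> \<le> s" and "\<And>x. \<rho> \<le> x \<Longrightarrow> x \<le> s \<Longrightarrow> mom x - mom r \<le> - k"
  shows "gap r s + k * ln (s / \<rho>) \<le> gap r \<rho>"
proof -
  have "gap r s + k * ln s \<le> gap r \<rho> + k * ln \<rho>"
  proof (rule DERIV_nonpos_imp_nonincreasing[OF assms(3)])
    fix x assume x: "\<rho> \<le> x" "x \<le> s"
    show "\<exists>y. ((\<lambda>x. gap r x + k * ln x) has_real_derivative y) (at x) \<and> y \<le> 0"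
    proof (intro exI conjI)
      show "((\<lambda>x. gap r x + k * ln x) has_real_derivative ((mom x - mom r) / x + k * (1 / x))) (at x)"
        using assms x by (intro DERIV_add DERIV_cmult gap_has_derivative) (auto intro!: derivative_eq_intros)
      show "(mom x - mom r) / x + k * (1 / x) \<le> 0"
        using assms(1,2) assms(4)[OF x] x by (simp add: field_simps)
    qed
  qed
  then show ?thesis using assms by (simp add: ln_div algebra_simps)
qed

lemma gap_nonneg:
  assumes "0 < r" "0 < \<rho>"
  shows "0 \<le> gap r \<rho>"
proof (cases "r \<le> \<rho>")
  case True
  then show ?thesis using gap_minus_log_mono[of r r \<rho> 0] mom_mono assms by auto
next
  case False
  then show ?thesis using gap_minus_log_antimono[of r \<rho> r 0] mom_mono assms by auto
qed

text \<open>Beyond one \<open>\<tau>\<close>-step the slope of \<open>gap r\<close> in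
  \<open>ln \<rho>\<close> has modulus at least \<open>c * r / \<tau> r\<close>, because
  \<open>mom\<close> has changed by that much and is monotone. Within the step
  \<open>\<bar>ln (\<rho> / r)\<bar>\<close> is at most \<open>2 * \<tau> r / r\<close>, and the
  subtracted \<open>2 * c\<close> pays for it.\<close>

lemma gap_lower:
  assumes r: "R \<le> r" and \<rho>: "0 < \<rho>"
  shows "c * r / \<tau> r * \<bar>ln (\<rho> / r)\<bar> - 2 * c \<le> gap r \<rho>"
proof -
  have r0: "0 < r" "2 \<le> r" using r R_ge by auto
  have t: "0 < \<tau> r" "\<tau> r \<le> 1 / 2" using tau_pos' tau_le r by auto
  have k: "0 \<le> c * r / \<tau> r" using c_pos r0 t by simp
  have kt: "c * r / \<tau> r * (2 * \<tau> r / r) = 2 * c" using t r0 by simp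
  have up: "ln ((r + \<tau> r) / r) \<le> 2 * \<tau> r / r"
  proof -
    have "ln (1 + \<tau> r / r) \<le> \<tau> r / r" using t r0 by (intro ln_add_one_self_le_self) auto
    also have "\<dots> \<le> 2 * \<tau> r / r" using t r0 by (intro divide_right_mono) auto
    also have "1 + \<tau> r / r = (r + \<tau> r) / r" using r0 by (simp add: add_divide_distrib)
    finally show ?thesis .
  qed
  have dn: "ln (r / (r - \<tau> r)) \<le> 2 * \<tau> r / r"
  proof -
    have "ln (1 + \<tau> r / (r - \<tau> r)) \<le> \<tau> r / (r - \<tau> r)" using t r0 by (intro ln_add_one_self_le_self) auto
    also have "\<dots> \<le> \<tau> r / (r / 2)" using t r0 by (intro divide_left_mono) auto
    also have "1 + \<tau> r / (r - \<tau> r) = r / (r - \<tau> r)" using t r0 by (simp add: field_simps)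
    finally show ?thesis by (simp add: mult.commute)
  qed
  consider "r + \<tau> r \<le> \<rho>" | "\<rho> \<le> r - \<tau> r" | "r \<le> \<rho>" "\<rho> \<le> r + \<tau> r" | "r - \<tau> r \<le> \<rho>" "\<rho> \<le> r"
    by linarith
  then show ?thesis
  proof cases
    case 1
    have "gap r (r + \<tau> r) + c * r / \<tau> r * ln (\<rho> / (r + \<tau> r)) \<le> gap r \<rho>"
    proof (rule gap_minus_log_mono)
      fix x assume "r + \<tau> r \<le> x"
      then have "mom (r + \<tau> r) \<le> mom x" using r0 t by (intro mom_mono) auto
      then show "c * r / \<tau> r \<le> mom x - mom r" using mom_step_up[OF r] by simp
    qed (use r0 t 1 in auto)
    moreover have "0 \<le> gap r (r + \<tau> r)" using r0 t by (intro gap_nonneg) auto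
    moreover have "ln (\<rho> / (r + \<tau> r)) = ln (\<rho> / r) - ln ((r + \<tau> r) / r)" using r0 t \<rho> by (simp add: ln_div)
    moreover have "\<bar>ln (\<rho> / r)\<bar> = ln (\<rho> / r)" using 1 r0 t by simp
    moreover have "c * r / \<tau> r * ln ((r + \<tau> r) / r) \<le> 2 * c" using mult_left_mono[OF up k] kt by simp
    ultimately show ?thesis by (simp add: right_diff_distrib)
  next
    case 2
    have "gap r (r - \<tau> r) + c * r / \<tau> r * ln ((r - \<tau> r) / \<rho>) \<le> gap r \<rho>"
    proof (rule gap_minus_log_antimono)
      fix x assume "\<rho> \<le> x" "x \<le> r - \<tau> r"
      then have "mom x \<le> mom (r - \<tau> r)" using r0 t \<rho> by (intro mom_mono) auto
      then show "mom x - mom r \<le> - (c * r / \<tau> r)" using mom_step_down[OF r] by simp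
    qed (use r0 t 2 \<rho> in auto)
    moreover have "0 \<le> gap r (r - \<tau> r)" using r0 t by (intro gap_nonneg) auto
    moreover have "ln ((r - \<tau> r) / \<rho>) = - ln (\<rho> / r) - ln (r / (r - \<tau> r))" using r0 t \<rho> by (simp add: ln_div)
    moreover have "\<bar>ln (\<rho> / r)\<bar> = - ln (\<rho> / r)" using 2 r0 t \<rho> by (simp add: ln_div)
    moreover have "c * r / \<tau> r * ln (r / (r - \<tau> r)) \<le> 2 * c" using mult_left_mono[OF dn k] kt by simp
    ultimately show ?thesis by (simp add: right_diff_distrib)
  next
    case 3
    have "\<bar>ln (\<rho> / r)\<bar> = ln (\<rho> / r)" using 3 r0 by simp
    also have "\<dots> \<le> ln ((r + \<tau> r) / r)" using 3 r0 \<rho> t by (simp add: divide_right_mono)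
    also have "\<dots> \<le> 2 * \<tau> r / r" by (rule up)
    finally have "c * r / \<tau> r * \<bar>ln (\<rho> / r)\<bar> \<le> 2 * c" using mult_left_mono[OF _ k] kt by metis
    then show ?thesis using gap_nonneg[OF r0(1) \<rho>] by simp
  next
    case 4
    have "\<bar>ln (\<rho> / r)\<bar> = ln (r / \<rho>)" using 4 r0 \<rho> by (simp add: ln_div)
    also have "\<dots> \<le> ln (r / (r - \<tau> r))" using 4 r0 \<rho> t by (simp add: divide_left_mono)
    also have "\<dots> \<le> 2 * \<tau> r / r" by (rule dn)
    finally have "c * r / \<tau> r * \<bar>ln (\<rho> / r)\<bar> \<le> 2 * c" using mult_left_mono[OF _ k] kt by metis
    then show ?thesis using gap_nonneg[OF r0(1) \<rho>] by simp
  qed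
qed

text \<open>Within one step the derivative of \<open>gap r\<close> is at most
  \<open>2 * C / \<tau> r\<close>, the 2 coming from \<open>r / 2 \<le> x\<close>, and the step has
  length \<open>\<tau> r\<close>.\<close>

lemma gap_upper:
  assumes r: "R \<le> r" and \<rho>: "\<bar>\<rho> - r\<bar> \<le> \<tau> r"
  shows "gap r \<rho> \<le> 2 * C"
proof -
  have r0: "0 < r" "2 \<le> r" using r R_ge by auto
  have t: "0 < \<tau> r" "\<tau> r \<le> 1 / 2" using tau_pos' tau_le r by auto
  have bd: "\<bar>(mom x - mom r) / x\<bar> \<le> 2 * C / \<tau> r" if x: "\<bar>x - r\<bar> \<le> \<tau> r" for x
  proof -
    have x0: "r / 2 \<le> x" using x t r0 by auto
    have "\<bar>mom x - mom r\<bar> \<le> C * r * \<bar>x - r\<bar> / (\<tau> r)^2" by (rule mom_upper[OF r x])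
    also have "\<dots> \<le> C * r * \<tau> r / (\<tau> r)^2" using x C_ge r0 by (intro divide_right_mono mult_left_mono) auto
    also have "\<dots> = (2 * C / \<tau> r) * (r / 2)" using t by (simp add: power2_eq_square)
    also have "\<dots> \<le> (2 * C / \<tau> r) * x" using x0 C_ge t by (intro mult_left_mono) auto
    finally show ?thesis using x0 r0 by (simp add: field_simps)
  qed
  have "norm (gap r \<rho> - gap r r) \<le> 2 * C / \<tau> r * norm (\<rho> - r)"
  proof (rule field_differentiable_bound[of "{r - \<tau> r..r + \<tau> r}" _ "\<lambda>x. (mom x - mom r) / x"])
    fix x assume "x \<in> {r - \<tau> r..r + \<tau> r}"
    then have x: "\<bar>x - r\<bar> \<le> \<tau> r" "0 < x" using t r0 by auto
    then show "(gap r has_field_derivative (mom x - mom r) / x) (at x within {r - \<tau> r..r + \<tau> r})"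
      using r0 by (intro has_field_derivative_at_within[OF gap_has_derivative]) auto
    show "norm ((mom x - mom r) / x) \<le> 2 * C / \<tau> r" using bd[OF x(1)] by simp
  qed (use \<rho> t in auto)
  also have "\<dots> \<le> 2 * C / \<tau> r * \<tau> r" using \<rho> t C_ge by (intro mult_left_mono) auto
  finally show ?thesis using t by simp
qed

text \<open>The radius \<open>c / (1 + \<psi>' r)\<close> is at most \<open>\<tau> r\<close>, so
  \<open>mom\<close> changes by at most \<open>C * r / \<tau> r\<close>, which is at most
  \<open>C / c\<close> times \<open>mom r\<close>. Hence \<open>mom\<close>, and with it
  \<open>\<psi>'\<close>, is stable on this scale, and the mean value theorem bounds the oscillation
  of \<open>\<psi>\<close>. The witness for \<open>\<delta>\<close> is \<open>c\<close>.\<close>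

lemma step_radius:
  obtains \<delta> K where "0 < \<delta>" "\<delta> \<le> 1" "1 \<le> K"
    and "\<And>r \<rho>. \<lbrakk>0 \<le> r; 0 \<le> \<rho>; \<bar>\<rho> - r\<bar> \<le> \<delta> / (1 + \<psi>' r)\<rbrakk> \<Longrightarrow> 1 + \<psi>' \<rho> \<le> K * (1 + \<psi>' r)"
    and "\<And>r \<rho>. \<lbrakk>0 \<le> r; 0 \<le> \<rho>; \<bar>\<rho> - r\<bar> \<le> \<delta> / (1 + \<psi>' r)\<rbrakk> \<Longrightarrow> 1 + \<psi>' r \<le> K * (1 + \<psi>' \<rho>)"
    and "\<And>r \<rho>. \<lbrakk>0 \<le> r; 0 \<le> \<rho>; \<bar>\<rho> - r\<bar> \<le> \<delta> / (1 + \<psi>' r)\<rbrakk> \<Longrightarrow> \<bar>\<psi> \<rho> - \<psi> r\<bar> \<le> K"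
proof -
  have "compact (\<psi>' ` {0..R + 2})"
    by (intro compact_continuous_image continuous_on_subset[OF continuous_on_psi']) auto
  then obtain B where "\<And>x. x \<in> {0..R + 2} \<Longrightarrow> norm (\<psi>' x) \<le> B"
    by (meson bounded_iff compact_imp_bounded imageI)
  then have B: "\<psi>' x \<le> B" if "0 \<le> x" "x \<le> R + 2" for x using that by fastforce
  have B0: "0 \<le> B" using B[of 0] psi'_0 R_ge by simp
  \<comment> \<open>One entry for the bounded range and one for each direction of the comparison;
    their outer factor 2 comes from \<open>r / 2 \<le> \<rho> \<le> 2 * r\<close>, and the inner 4
    from moving \<open>r\<close> and \<open>\<tau> r\<close> to \<open>\<rho>\<close>.\<close>
  define K where "K = max (1 + B) (max (2 * (1 + C / c)) (2 * (1 + 4 * C / c)))"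
  have K: "1 \<le> K" "1 + B \<le> K" "2 * (1 + C / c) \<le> K" "2 * (1 + 4 * C / c) \<le> K" using B0 by (auto simp: K_def)
  have comp: "1 + \<psi>' \<rho> \<le> K * (1 + \<psi>' r) \<and> 1 + \<psi>' r \<le> K * (1 + \<psi>' \<rho>)"
    if r: "0 \<le> r" and \<rho>: "0 \<le> \<rho>" and d: "\<bar>\<rho> - r\<bar> \<le> c / (1 + \<psi>' r)" for r \<rho>
  \<comment> \<open>The margin 1 guarantees \<open>R \<le> \<rho>\<close> in the second case, where
    \<open>psi'_lower\<close> is used at \<open>\<rho>\<close> as well.\<close>
  proof (cases "R + 1 \<le> r")
    case False
    have "c / (1 + \<psi>' r) \<le> 1" using psi'_nonneg[OF r] c_le by simp
    then have le: "r \<le> R + 2" "\<rho> \<le> R + 2" using False d by auto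
    have "1 + \<psi>' x \<le> K * (1 + \<psi>' y)" if "0 \<le> x" "x \<le> R + 2" "0 \<le> y" for x y
    proof -
      have "1 + \<psi>' x \<le> K" using B[OF that(1,2)] K by simp
      also have "\<dots> \<le> K * (1 + \<psi>' y)" using K psi'_nonneg[OF that(3)] by simp
      finally show ?thesis .
    qed
    then show ?thesis using le r \<rho> by blast
  next
    case True
    have t: "0 < \<tau> r" "\<tau> r \<le> 1 / 2" using tau_pos'[of r] tau_le[of r] True by auto
    have r2: "2 \<le> r" "R \<le> r" using True R_ge by auto
    have "c / \<tau> r \<le> \<psi>' r" using psi'_lower True by simp
    then have "c / (1 + \<psi>' r) \<le> \<tau> r" using t psi'_nonneg[OF r] by (simp add: field_simps)
    then have d': "\<bar>\<rho> - r\<bar> \<le> \<tau> r" using d by simp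
    have \<rho>': "r / 2 \<le> \<rho>" "\<rho> \<le> 2 * r" "R \<le> \<rho>" using d' t True R_ge by auto
    have "\<bar>mom \<rho> - mom r\<bar> \<le> C * r * \<bar>\<rho> - r\<bar> / (\<tau> r)^2" by (rule mom_upper[OF r2(2) d'])
    also have "\<dots> \<le> C * r * \<tau> r / (\<tau> r)^2" using d' C_ge r2 by (intro divide_right_mono mult_left_mono) auto
    also have "\<dots> = C / c * (r * (c / \<tau> r))" using t c_pos by (simp add: power2_eq_square)
    finally have m: "\<bar>mom \<rho> - mom r\<bar> \<le> C / c * (r * (c / \<tau> r))" .
    have Cc: "0 \<le> C / c" using C_ge c_pos by simp
    have mr: "C / c * (r * (c / \<tau> r)) \<le> C / c * mom r"
      using psi'_lower[OF r2(2)] r2 Cc unfolding mom_def by (intro mult_left_mono) auto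
    have "r * (c / \<tau> r) \<le> (2 * \<rho>) * (2 * (c / \<tau> \<rho>))"
    proof (rule mult_mono)
      have tr: "\<tau> \<rho> \<le> 2 * \<tau> r" using tau_upper[OF r2(2) d'] by simp
      have tp: "0 < \<tau> \<rho>" using tau_pos'[OF \<rho>'(3)] .
      show "c / \<tau> r \<le> 2 * (c / \<tau> \<rho>)"
        using tr tp t c_pos by (simp add: field_simps)
    qed (use \<rho>' r2 c_pos t tau_pos'[OF \<rho>'(3)] in auto)
    also have "\<dots> \<le> 4 * mom \<rho>"
      using mult_left_mono[OF psi'_lower[OF \<rho>'(3)], of "4 * \<rho>"] \<rho>' r2 unfolding mom_def by simp
    finally have "C / c * (r * (c / \<tau> r)) \<le> C / c * (4 * mom \<rho>)" using Cc by (rule mult_left_mono)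
    then have mr2: "C / c * (r * (c / \<tau> r)) \<le> 4 * C / c * mom \<rho>"
      by (simp only: mult.assoc mult.commute times_divide_eq_left times_divide_eq_right mult.left_commute)
    have a: "\<rho> * \<psi>' \<rho> \<le> (1 + C / c) * (r * \<psi>' r)" and b: "r * \<psi>' r \<le> (1 + 4 * C / c) * (\<rho> * \<psi>' \<rho>)"
      using m mr mr2 unfolding mom_def distrib_right by linarith+
    have "r / 2 * \<psi>' \<rho> \<le> \<rho> * \<psi>' \<rho>" using \<rho>' psi'_nonneg[OF \<rho>] by (intro mult_right_mono) auto
    then have "r / 2 * \<psi>' \<rho> \<le> (1 + C / c) * (r * \<psi>' r)" using a by (rule order_trans)
    moreover have "r / 2 * y \<le> X * (r * w) \<Longrightarrow> y * r \<le> 2 * X * w * r" for X y w by (simp add: mult_ac)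
    ultimately have "\<psi>' \<rho> * r \<le> (2 * (1 + C / c)) * \<psi>' r * r" by blast
    then have "\<psi>' \<rho> \<le> 2 * (1 + C / c) * \<psi>' r" using r2 by simp
    also have "\<dots> \<le> K * \<psi>' r" using K psi'_nonneg[OF r] by (intro mult_right_mono) auto
    finally have 1: "\<psi>' \<rho> \<le> K * \<psi>' r" .
    have "(1 + 4 * C / c) * (\<rho> * \<psi>' \<rho>) \<le> (1 + 4 * C / c) * (2 * r * \<psi>' \<rho>)"
      using \<rho>' psi'_nonneg[OF \<rho>] C_ge c_pos by (intro mult_left_mono mult_right_mono) auto
    with b have "r * \<psi>' r \<le> (1 + 4 * C / c) * (2 * r * \<psi>' \<rho>)" by (rule order_trans)
    moreover have "r * w \<le> X * (2 * r * y) \<Longrightarrow> w * r \<le> 2 * X * y * r" for X y w by (simp add: mult_ac)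
    ultimately have "\<psi>' r * r \<le> (2 * (1 + 4 * C / c)) * \<psi>' \<rho> * r" by blast
    then have "\<psi>' r \<le> 2 * (1 + 4 * C / c) * \<psi>' \<rho>" using r2 by simp
    also have "\<dots> \<le> K * \<psi>' \<rho>" using K psi'_nonneg[OF \<rho>] by (intro mult_right_mono) auto
    finally have 2: "\<psi>' r \<le> K * \<psi>' \<rho>" .
    show ?thesis using 1 2 K by (simp add: distrib_left)
  qed
  show ?thesis
  proof (rule that[of c K])
    fix r \<rho> assume r: "0 \<le> r" and \<rho>: "0 \<le> \<rho>" and d: "\<bar>\<rho> - r\<bar> \<le> c / (1 + \<psi>' r)"
    show "1 + \<psi>' \<rho> \<le> K * (1 + \<psi>' r)" "1 + \<psi>' r \<le> K * (1 + \<psi>' \<rho>)" using comp[OF r \<rho> d] by auto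
    have p: "0 < 1 + \<psi>' r" using psi'_nonneg[OF r] by simp
    have "norm (\<psi> \<rho> - \<psi> r) \<le> K * (1 + \<psi>' r) * norm (\<rho> - r)"
    proof (rule field_differentiable_bound[of "{min r \<rho>..max r \<rho>}" \<psi> \<psi>'])
      fix x assume x: "x \<in> {min r \<rho>..max r \<rho>}"
      then have x0: "0 \<le> x" using r \<rho> by (auto simp: min_def split: if_splits)
      have "\<bar>x - r\<bar> \<le> \<bar>\<rho> - r\<bar>" using x by (auto simp: min_def max_def split: if_splits)
      then have "1 + \<psi>' x \<le> K * (1 + \<psi>' r)" using comp[OF r x0] d by auto
      then show "norm (\<psi>' x) \<le> K * (1 + \<psi>' r)" using psi'_nonneg[OF x0] by simp
      show "(\<psi> has_field_derivative \<psi>' x) (at x within {min r \<rho>..max r \<rho>})"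
        by (rule DERIV_subset[OF psi_deriv[OF x0]]) (use r \<rho> in \<open>auto simp: min_def split: if_splits\<close>)
    qed auto
    also have "\<dots> \<le> K * (1 + \<psi>' r) * (c / (1 + \<psi>' r))" using d K p by (intro mult_left_mono) auto
    also have "\<dots> = K * c" using p by simp
    also have "\<dots> \<le> K" using K c_le by simp
    finally show "\<bar>\<psi> \<rho> - \<psi> r\<bar> \<le> K" by simp
  qed (use c_pos c_le K in auto)
qed

lemma psi'_eventually_ge:
  obtains R1 where "R \<le> R1" "\<And>r. R1 \<le> r \<Longrightarrow> B \<le> \<psi>' r"
proof -
  have "\<forall>\<^sub>F r in at_top. \<tau> r < c / (\<bar>B\<bar> + 1)"
    using tau_lim by (rule order_tendstoD) (use c_pos in auto)
  then obtain R1 where R1: "\<And>r. R1 \<le> r \<Longrightarrow> \<tau> r < c / (\<bar>B\<bar> + 1)"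
    by (auto simp: eventually_at_top_linorder)
  show ?thesis
  proof (rule that[of "max R R1"])
    fix r assume r: "max R R1 \<le> r"
    have "\<bar>B\<bar> + 1 \<le> c / \<tau> r" using R1[of r] r tau_pos'[of r] c_pos by (simp add: field_simps)
    also have "\<dots> \<le> \<psi>' r" using psi'_lower r by simp
    finally show "B \<le> \<psi>' r" by simp
  qed simp
qed

text \<open>The comparison function \<^term>\<open>\<lambda>r. exp (\<eta> * \<psi> r) * (L - exp (R1 - r))\<close> has a derivative that
  dominates \<^term>\<open>\<lambda>r. (1 + \<psi>' r) * exp (\<eta> * \<psi> r)\<close> even where \<^term>\<open>\<psi>'\<close> is small, because the
  correction \<^term>\<open>\<lambda>r. exp (R1 - r)\<close> takes over on \<^term>\<open>{0..R1}\<close>.\<close>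

lemma ray_bound:
  assumes \<eta>: "0 < \<eta>"
  obtains L where "0 < L"
    and "\<And>u z B. \<lbrakk>u holomorphic_on UNIV; u 0 = 0;
      \<And>x. 0 < x \<Longrightarrow> x < 1 \<Longrightarrow> cmod (deriv u (of_real x * z)) \<le> B * ((1 + \<psi>' (x * cmod z)) * exp (\<eta> * \<psi> (x * cmod z)))\<rbrakk>
      \<Longrightarrow> 0 \<le> B \<Longrightarrow> cmod (u z) \<le> L * B * exp (\<eta> * \<psi> (cmod z))"
proof -
  obtain R1 where R1: "R \<le> R1" "\<And>r. R1 \<le> r \<Longrightarrow> 1 \<le> \<psi>' r" by (rule psi'_eventually_ge[of 1]) blast
  \<comment> \<open>\<open>L - exp (R1 - r)\<close> is at least \<open>2 / \<eta>\<close> for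
    positive \<open>r\<close>, so the derivative of \<open>A\<close> contains
    \<open>2 * \<psi>'\<close>: for \<open>r \<ge> R1\<close> the second copy pays for the summand
    1. Also \<open>A 0\<close> is non-negative and may be dropped at the end.\<close>
  define L where "L = exp R1 + 2 / \<eta>"
  define A where "A r = exp (\<eta> * \<psi> r) * (L - exp (R1 - r))" for r
  define A' where "A' r = exp (\<eta> * \<psi> r) * (\<eta> * \<psi>' r * (L - exp (R1 - r)) + exp (R1 - r))" for r
  have L: "0 < L" using \<eta> by (simp add: L_def add_pos_pos)
  have Ader: "(A has_real_derivative A' r) (at r)" if "0 < r" for r
    unfolding A_def [abs_def] A'_def
    by (rule derivative_eq_intros refl psi_has_derivative[OF that])+ (simp add: algebra_simps)
  have Ale: "(1 + \<psi>' r) * exp (\<eta> * \<psi> r) \<le> A' r" if r: "0 < r" for r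
  proof -
    have p: "0 \<le> \<psi>' r" using psi'_nonneg r by simp
    have "exp (R1 - r) \<le> exp R1" using r by simp
    then have "\<eta> * \<psi>' r * (2 / \<eta>) \<le> \<eta> * \<psi>' r * (L - exp (R1 - r))"
      using p \<eta> by (intro mult_left_mono) (auto simp: L_def)
    then have *: "2 * \<psi>' r \<le> \<eta> * \<psi>' r * (L - exp (R1 - r))" using \<eta> by simp
    have "1 + \<psi>' r \<le> 2 * \<psi>' r + exp (R1 - r)"
    proof (cases "R1 \<le> r")
      case True then show ?thesis using R1(2)[of r] exp_ge_zero[of "R1 - r"] by linarith
    next
      case False then have "1 \<le> exp (R1 - r)" by simp
      then show ?thesis using p by linarith
    qed
    then have "1 + \<psi>' r \<le> \<eta> * \<psi>' r * (L - exp (R1 - r)) + exp (R1 - r)" using * by simp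
    then show ?thesis unfolding A'_def by (subst mult.commute) (rule mult_left_mono, auto)
  qed
  have A0: "0 \<le> A 0" using \<eta> by (simp add: A_def L_def)
  have A1: "A r \<le> L * exp (\<eta> * \<psi> r)" for r
    by (simp add: A_def algebra_simps)
  show ?thesis
  proof (rule that[of L])
    fix u z B
    assume u: "u holomorphic_on UNIV" "u 0 = 0" and B: "0 \<le> B"
      and bd: "\<And>x. 0 < x \<Longrightarrow> x < 1 \<Longrightarrow> cmod (deriv u (of_real x * z)) \<le> B * ((1 + \<psi>' (x * cmod z)) * exp (\<eta> * \<psi> (x * cmod z)))"
    show "cmod (u z) \<le> L * B * exp (\<eta> * \<psi> (cmod z))"
    proof (cases "z = 0")
      case False
      let ?u = "\<lambda>x::real. u (of_real x * z)" and ?A = "\<lambda>x. B * A (x * cmod z)"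
      have ud: "(u has_field_derivative deriv u w) (at w)" for w
        using holomorphic_derivI[OF u(1)] by simp
      have "norm (?u 1 - ?u 0) \<le> ?A 1 - ?A 0"
      proof (rule differentiable_bound_general[of 0 1])
        show "continuous_on {0..1} ?u"
          by (rule continuous_on_compose2[OF holomorphic_on_imp_continuous_on[OF u(1)]]) (auto intro!: continuous_intros)
        show "continuous_on {0..1} ?A"
          unfolding A_def
          by (intro continuous_intros continuous_on_compose2[OF continuous_on_psi]) auto
        fix x :: real assume x: "0 < x" "x < 1"
        show "(?u has_vector_derivative (z * deriv u (of_real x * z))) (at x)"
        proof -
          have "((\<lambda>x. of_real x * z) has_vector_derivative z) (at x)"
            by (auto intro!: derivative_eq_intros)
          from field_vector_diff_chain_at[OF this ud] show ?thesis by (simp add: o_def)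
        qed
        show "(?A has_vector_derivative (B * (A' (x * cmod z) * cmod z))) (at x)"
          unfolding has_real_derivative_iff_has_vector_derivative[symmetric]
          by (rule DERIV_cmult, rule DERIV_chain2[OF Ader]) (use x False in \<open>auto intro!: derivative_eq_intros\<close>)
        have "B * ((1 + \<psi>' (x * cmod z)) * exp (\<eta> * \<psi> (x * cmod z))) \<le> B * A' (x * cmod z)"
          using Ale[of "x * cmod z"] x False B by (intro mult_left_mono) auto
        then have "cmod (deriv u (of_real x * z)) \<le> B * A' (x * cmod z)" using bd[OF x] by simp
        then have "cmod z * cmod (deriv u (of_real x * z)) \<le> cmod z * (B * A' (x * cmod z))"
          by (rule mult_left_mono) simp
        then show "norm (z * deriv u (of_real x * z)) \<le> B * (A' (x * cmod z) * cmod z)"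
          by (simp add: norm_mult mult_ac)
      qed simp
      also have "\<dots> \<le> B * A (cmod z)" using A0 B by simp
      also have "\<dots> \<le> B * (L * exp (\<eta> * \<psi> (cmod z)))" using A1 B by (intro mult_left_mono) auto
      finally show ?thesis using u(2) by (simp add: mult_ac)
    qed (use u(2) L B in simp)
  qed (rule L)
qed

section \<open>Point evaluations and test functions\<close>

text \<open>Cauchy's estimate on the circle of radius
  \<open>\<delta> / (1 + \<psi>' (cmod a))\<close>: the weight varies there by at most
  \<open>K\<close>, and the reciprocal radius is the factor \<open>1 + \<psi>'\<close>.\<close>

lemma weighted_Cauchy:
  obtains K where "0 < K"
    and "\<And>u a B. \<lbrakk>u holomorphic_on UNIV; \<And>z. cmod (u z) \<le> B * exp (radial \<psi> z)\<rbrakk> \<Longrightarrow>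
      cmod (deriv u a) \<le> K * B * ((1 + radial \<psi>' a) * exp (radial \<psi> a))"
proof -
  obtain \<delta> K where d: "0 < \<delta>" and
    K: "\<And>r \<rho>. \<lbrakk>0 \<le> r; 0 \<le> \<rho>; \<bar>\<rho> - r\<bar> \<le> \<delta> / (1 + \<psi>' r)\<rbrakk> \<Longrightarrow> \<bar>\<psi> \<rho> - \<psi> r\<bar> \<le> K"
    by (rule step_radius) blast
  show ?thesis
  proof (rule that)
    show "0 < exp K / \<delta>" using d by simp
    fix u a B
    assume u: "u holomorphic_on UNIV" and bd: "\<And>z. cmod (u z) \<le> B * exp (radial \<psi> z)"
    have "0 \<le> B * exp (radial \<psi> 0)" using bd[of 0] norm_ge_zero order_trans by blast
    then have B: "0 \<le> B" by (simp add: zero_le_mult_iff)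
    have p: "0 < 1 + \<psi>' (cmod a)" using psi'_nonneg[of "cmod a"] by simp
    let ?h = "\<delta> / (1 + \<psi>' (cmod a))"
    have "cmod ((deriv ^^ 1) u a) \<le> fact 1 * (B * exp (\<psi> (cmod a) + K)) / ?h ^ 1"
    proof (rule Cauchy_inequality)
      fix x assume "cmod (a - x) = ?h"
      then have "\<bar>cmod x - cmod a\<bar> \<le> ?h" using norm_triangle_ineq3[of x a] by (simp add: norm_minus_commute)
      then have "\<psi> (cmod x) \<le> \<psi> (cmod a) + K" using K[of "cmod a" "cmod x"] by simp
      then have "B * exp (radial \<psi> x) \<le> B * exp (\<psi> (cmod a) + K)"
        using B by (intro mult_left_mono) (auto simp: radial_def)
      then show "cmod (u x) \<le> B * exp (\<psi> (cmod a) + K)" using bd[of x] by simp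
    qed (use u d p in \<open>auto intro: holomorphic_on_subset holomorphic_on_imp_continuous_on\<close>)
    then show "cmod (deriv u a) \<le> exp K / \<delta> * B * ((1 + radial \<psi>' a) * exp (radial \<psi> a))"
      by (simp add: radial_def exp_add field_simps)
  qed
qed

text \<open>Multiplying \<^term>\<open>f\<close> by \<open>(w / a) powr (- mom (cmod a))\<close> replaces the weight by \<^term>\<open>gap (cmod a)\<close>,
  which is bounded on the disc of radius \<^term>\<open>\<tau> (cmod a)\<close>.\<close>

lemma weighted_submean:
  fixes q :: real
  assumes q: "0 < q"
  obtains K where "0 < K"
    and "\<And>f z. \<lbrakk>f \<in> fock_space \<psi> (ennreal q); R \<le> cmod z\<rbrakk> \<Longrightarrow>
      cmod (f z) \<le> K * \<tau> (cmod z) powr (- (2 / q)) * exp (radial \<psi> z) * fock_norm \<psi> (ennreal q) f"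
proof -
  obtain S where S: "0 < S" and sub: "\<And>h a r. \<lbrakk>0 < r; continuous_on (cball a r) h; h holomorphic_on ball a r\<rbrakk> \<Longrightarrow>
      ennreal (cmod (h a) powr q * r^2) \<le> ennreal S * (\<integral>\<^sup>+z\<in>cball a r. ennreal (cmod (h z) powr q) \<partial>lborel)"
    using submean_powr[OF q] by blast
  define K where "K = S * exp (2 * C * q)"
  have K: "0 < K" using S by (simp add: K_def)
  show ?thesis
  proof (rule that)
    show "0 < K powr (1 / q)" using K by simp
    fix f a assume f: "f \<in> fock_space \<psi> (ennreal q)" and a: "R \<le> cmod a"
    define r where "r = cmod a"
    have r: "R \<le> r" "2 \<le> r" using a R_ge by (auto simp: r_def)
    have a0: "a \<noteq> 0" using r by (auto simp: r_def)
    have t: "0 < \<tau> r" "\<tau> r \<le> 1 / 2" using tau_pos' tau_le r by auto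
    have hol: "f holomorphic_on UNIV" using f by (rule fock_space_holomorphic)
    \<comment> \<open>The disc of radius \<open>\<tau> r\<close> about \<open>a\<close> lies in the
      half-plane \<open>Re (w / a) > 0\<close>, so the principal branch of the logarithm is
      holomorphic on it.\<close>
    define h where "h w = f w * exp (- of_real (mom r) * Ln (w / a))" for w
    have near: "0 < Re (w / a)" "0 < cmod w" "\<bar>cmod w - r\<bar> \<le> \<tau> r" if w: "w \<in> cball a (\<tau> r)" for w
    proof -
      have d: "cmod (w - a) \<le> \<tau> r" using w by (simp add: dist_norm norm_minus_commute)
      have "cmod (w / a - 1) = cmod (w - a) / r" using a0 by (simp add: r_def norm_divide[symmetric] diff_divide_distrib)
      also have "\<dots> < 1" using d t r by simp
      finally have "\<bar>Re (w / a - 1)\<bar> < 1" using abs_Re_le_cmod le_less_trans by blast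
      then show "0 < Re (w / a)" by simp
      show "\<bar>cmod w - r\<bar> \<le> \<tau> r" using d norm_triangle_ineq3[of w a] by (simp add: r_def)
      then show "0 < cmod w" using t r by linarith
    qed
    have holh: "h holomorphic_on {w. 0 < Re (w / a)}"
      unfolding h_def
      by (intro holomorphic_intros holomorphic_on_subset[OF hol]) (auto simp: complex_nonpos_Reals_iff a0)
    have sub': "cball a (\<tau> r) \<subseteq> {w. 0 < Re (w / a)}" using near(1) by blast
    have norm_h: "cmod (h w) powr q = fock_density q f w * exp (q * (\<psi> r + gap r (cmod w)))" if w: "w \<in> cball a (\<tau> r)" for w
    proof -
      have w0: "w \<noteq> 0" using near(2)[OF w] by auto
      have "cmod (h w) = cmod (f w) * exp (- (mom r * ln (cmod w / r)))"
        using w0 a0 by (simp add: h_def norm_mult norm_divide r_def)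
      then have "cmod (h w) powr q = cmod (f w) powr q * exp (- (mom r * ln (cmod w / r)) * q)"
        by (simp add: powr_mult exp_powr_real)
      also have "- (mom r * ln (cmod w / r)) * q = - (q * radial \<psi> w) + q * (\<psi> r + gap r (cmod w))"
        by (simp add: gap_def radial_def algebra_simps)
      finally show ?thesis by (simp only: exp_add mult.assoc)
    qed
    have ha: "h a = f a" using a0 by (simp add: h_def)
    have "ennreal (cmod (h a) powr q * (\<tau> r)^2) \<le> ennreal S * (\<integral>\<^sup>+w\<in>cball a (\<tau> r). ennreal (cmod (h w) powr q) \<partial>lborel)"
      using t(1) sub' subset_trans[OF ball_subset_cball[of a "\<tau> r"] sub']
      by (intro sub holomorphic_on_imp_continuous_on holomorphic_on_subset[OF holh])
    also have "\<dots> \<le> ennreal S * (\<integral>\<^sup>+w. ennreal (exp (q * (\<psi> r + 2 * C))) * ennreal (fock_density q f w) \<partial>lborel)"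
    proof (intro mult_left_mono nn_integral_mono)
      fix w
      show "ennreal (cmod (h w) powr q) * indicator (cball a (\<tau> r)) w \<le> ennreal (exp (q * (\<psi> r + 2 * C))) * ennreal (fock_density q f w)"
      proof (cases "w \<in> cball a (\<tau> r)")
        case True
        have "gap r (cmod w) \<le> 2 * C" using gap_upper[OF r(1)] near(3)[OF True] by blast
        then have "exp (q * (\<psi> r + gap r (cmod w))) \<le> exp (q * (\<psi> r + 2 * C))" using q by simp
        then have "cmod (h w) powr q \<le> exp (q * (\<psi> r + 2 * C)) * fock_density q f w"
          unfolding norm_h[OF True] by (subst mult.commute) (rule mult_right_mono, auto)
        then show ?thesis using True by (subst ennreal_mult''[symmetric]) (auto intro: ennreal_leI)
      qed simp
    qed simp
    also have "(\<integral>\<^sup>+w. ennreal (exp (q * (\<psi> r + 2 * C))) * ennreal (fock_density q f w) \<partial>lborel)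
        = ennreal (exp (q * (\<psi> r + 2 * C))) * ennreal (fock_norm \<psi> (ennreal q) f powr q)"
      using measurable_fock_density[OF hol, of q] nn_integral_fock_density[OF q f] by (subst nn_integral_cmult) auto
    also have "ennreal S * (ennreal (exp (q * (\<psi> r + 2 * C))) * ennreal (fock_norm \<psi> (ennreal q) f powr q))
        = ennreal (S * (exp (q * (\<psi> r + 2 * C)) * fock_norm \<psi> (ennreal q) f powr q))"
      using S by (simp add: ennreal_mult)
    finally have "cmod (f a) powr q * (\<tau> r)^2 \<le> S * (exp (q * (\<psi> r + 2 * C)) * fock_norm \<psi> (ennreal q) f powr q)"
      using S by (simp add: ennreal_le_iff ha)
    also have "\<dots> = K * exp (q * \<psi> r) * fock_norm \<psi> (ennreal q) f powr q"
      by (simp add: K_def ring_distribs exp_add mult_ac)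
    finally have "cmod (f a) powr q \<le> K * exp (q * \<psi> r) * fock_norm \<psi> (ennreal q) f powr q / (\<tau> r)^2"
      using t by (simp add: pos_le_divide_eq)
    also have "\<dots> = K * \<tau> r powr (- 2) * exp (q * \<psi> r) * fock_norm \<psi> (ennreal q) f powr q"
      using t by (simp add: powr_minus field_simps)
    also have "\<dots> = (K powr (1 / q) * \<tau> r powr (- (2 / q)) * exp (\<psi> r) * fock_norm \<psi> (ennreal q) f) powr q"
      using q K t fock_norm_nonneg[OF f] by (simp add: powr_mult powr_powr exp_powr_real mult.commute)
    finally have "cmod (f a) \<le> K powr (1 / q) * \<tau> r powr (- (2 / q)) * exp (\<psi> r) * fock_norm \<psi> (ennreal q) f"
      by (rule powr_le_imp_le[rotated 2]) (use q fock_norm_nonneg[OF f] in auto)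
    then show "cmod (f a) \<le> K powr (1 / q) * \<tau> (cmod a) powr (- (2 / q)) * exp (radial \<psi> a) * fock_norm \<psi> (ennreal q) f"
      by (simp add: r_def radial_def)
  qed
qed

lemma tau_eventually_le:
  assumes "0 < e"
  obtains R1 where "R \<le> R1" "\<And>r. R1 \<le> r \<Longrightarrow> \<tau> r \<le> e"
proof -
  have "\<forall>\<^sub>F r in at_top. \<tau> r < e"
    using tau_lim assms by (rule order_tendstoD)
  then obtain R1 where "\<And>r. R1 \<le> r \<Longrightarrow> \<tau> r < e" by (auto simp: eventually_at_top_linorder)
  then show ?thesis by (intro that[of "max R R1"]) (auto intro: less_imp_le)
qed

text \<open>The monomial of degree about \<^term>\<open>mom (cmod a)\<close> peaks at the modulus of \<^term>\<open>a\<close>; multiplying it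
  by a power of a Fejer-type mean of length comparable to \<^term>\<open>cmod a / \<tau> (cmod a)\<close> also localises
  the argument, while the linear growth of \<^const>\<open>gap\<close> in the logarithm of the modulus absorbs the radial growth of this factor.\<close>

lemma test_function:
  fixes k :: nat
  obtains R1 K where "R \<le> R1" "0 < K"
    and "\<And>a. R1 \<le> cmod a \<Longrightarrow> \<exists>F. F holomorphic_on UNIV \<and> F a = of_real (exp (radial \<psi> a)) \<and>
      (\<forall>z. cmod (F z) \<le> K * exp (radial \<psi> z) / (1 + dist a z / \<tau> (cmod a)) ^ k)"
proof -
  \<comment> \<open>This choice gives
    \<open>1 + L * k \<le> b * (k + 1) * \<sigma> = c / 2 * \<sigma>\<close>. The left side is the
    slope lost to rounding the degree and to the \<open>k\<close>-th power of \<open>S\<close>; the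
    right side is below the slope that \<open>gap_lower\<close> provides.\<close>
  define b where "b = c / (2 * (real k + 1))"
  have b: "0 < b" "b \<le> 1" using c_pos c_le by (auto simp: b_def field_simps)
  obtain R1 where R1: "R \<le> R1" "\<And>r. R1 \<le> r \<Longrightarrow> \<tau> r \<le> b" using tau_eventually_le[OF b(1)] by blast
  \<comment> \<open>The 1 comes from the trivial bound \<open>S1\<close>, the \<open>4 / b\<close>
    from \<open>S2\<close> together with \<open>b * \<sigma> \<le> 2 * L\<close>.\<close>
  define K1 where "K1 = 1 + 4 / b"
  have K1: "1 \<le> K1" using b by (simp add: K1_def)
  show ?thesis
  proof (rule that[of R1 "K1 ^ k * exp (2 * c)"])
    fix a assume a: "R1 \<le> cmod a"
    define r where "r = cmod a"
    have r: "R \<le> r" "2 \<le> r" "R1 \<le> r" using a R1 R_ge by (auto simp: r_def)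
    have a0: "a \<noteq> 0" using r by (auto simp: r_def)
    have t: "0 < \<tau> r" "\<tau> r \<le> b" using tau_pos' R1 r by auto
    define \<sigma> where "\<sigma> = r / \<tau> r"
    have \<sigma>: "0 < \<sigma>" "2 \<le> b * \<sigma>"
    proof -
      show "0 < \<sigma>" using r t by (simp add: \<sigma>_def)
      have "2 * \<tau> r \<le> b * r" using mult_mono[OF r(2) t(2)] r t b by (simp add: mult.commute)
      then show "2 \<le> b * \<sigma>" using t by (simp add: \<sigma>_def field_simps)
    qed
    define L where "L = nat \<lfloor>b * \<sigma>\<rfloor>"
    have L: "real L \<le> b * \<sigma>" "b * \<sigma> \<le> 2 * real L" "0 < L"
    proof -
      have "real L = of_int \<lfloor>b * \<sigma>\<rfloor>" using \<sigma> by (simp add: L_def)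
      then show "real L \<le> b * \<sigma>" "b * \<sigma> \<le> 2 * real L" using \<sigma> by linarith+
      then show "0 < L" using \<sigma> by (cases L) auto
    qed
    have N1: "1 \<le> mom r"
    proof -
      have "2 \<le> c * \<sigma>"
      proof -
        have "b \<le> c" using c_pos by (simp add: b_def field_simps)
        then show ?thesis using \<sigma> mult_right_mono[of b c \<sigma>] by linarith
      qed
      also have "c * \<sigma> \<le> mom r"
        using mult_left_mono[OF psi'_lower[OF r(1)], of r] r by (simp add: mom_def \<sigma>_def mult.commute)
      finally show ?thesis by simp
    qed
    define m where "m = nat \<lfloor>mom r\<rfloor>"
    have m: "real m \<le> mom r" "mom r \<le> real m + 1" "0 < m"
    proof -
      have "real m = of_int \<lfloor>mom r\<rfloor>" using N1 by (simp add: m_def)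
      then show "real m \<le> mom r" "mom r \<le> real m + 1" by linarith+
      show "0 < m" using N1 by (simp add: m_def)
    qed
    \<comment> \<open>A mean of powers of \<open>w\<close> with value 1 at \<open>w = 1\<close>.
      Since \<open>(1 - w) * L * S w = 1 - w ^ L\<close>, it decays like the reciprocal of
      \<open>L * cmod (1 - w)\<close> near the unit circle, and for \<open>w = z / a\<close> this
      product is comparable with \<open>dist a z / \<tau> r\<close>.\<close>
    define S where "S w = (\<Sum>j<L. w ^ j) / of_nat L" for w :: complex
    define F where "F z = of_real (exp (\<psi> r)) * (z / a) ^ m * S (z / a) ^ k" for z
    have S1: "cmod (S w) \<le> max 1 (cmod w) ^ L" for w
    proof -
      have "cmod (\<Sum>j<L. w ^ j) \<le> (\<Sum>j<L. max 1 (cmod w) ^ L)"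
      proof (rule sum_norm_le)
        fix j assume "j \<in> {..<L}"
        have "cmod (w ^ j) \<le> max 1 (cmod w) ^ j" by (simp add: norm_power power_mono)
        also have "\<dots> \<le> max 1 (cmod w) ^ L" using \<open>j \<in> {..<L}\<close> by (intro power_increasing) auto
        finally show "cmod (w ^ j) \<le> max 1 (cmod w) ^ L" .
      qed
      then show ?thesis using L(3) by (simp add: S_def norm_divide field_simps)
    qed
    have S2: "cmod (S w) * (real L * cmod (1 - w)) \<le> 2 * max 1 (cmod w) ^ L" for w
    proof -
      have "(1 - w) * (\<Sum>j<L. w ^ j) = 1 - w ^ L" by (simp add: one_diff_power_eq)
      then have "cmod (S w) * (real L * cmod (1 - w)) = cmod (1 - w ^ L)"
        using L(3) by (simp add: S_def norm_divide norm_mult[symmetric] mult.commute)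
      also have "\<dots> \<le> 1 + cmod w ^ L" using norm_triangle_ineq4[of 1 "w ^ L"] by (simp add: norm_power)
      also have "\<dots> \<le> max 1 (cmod w) ^ L + max 1 (cmod w) ^ L" by (intro add_mono power_mono) auto
      finally show ?thesis by simp
    qed
    have S3: "cmod (S (z / a)) * (1 + dist a z / \<tau> r) \<le> K1 * max 1 (cmod (z / a)) ^ L" for z
    proof -
      let ?w = "z / a"
      have "dist a z = r * cmod (1 - ?w)"
        using a0 by (simp add: dist_norm r_def norm_mult[symmetric] right_diff_distrib)
      then have "dist a z / \<tau> r = \<sigma> * cmod (1 - ?w)" by (simp add: \<sigma>_def)
      also have "\<dots> \<le> (2 / b * real L) * cmod (1 - ?w)"
        using L(2) b by (intro mult_right_mono) (auto simp: field_simps)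
      finally have "cmod (S ?w) * (dist a z / \<tau> r) \<le> cmod (S ?w) * ((2 / b * real L) * cmod (1 - ?w))"
        by (rule mult_left_mono) simp
      also have "\<dots> = 2 / b * (cmod (S ?w) * (real L * cmod (1 - ?w)))" by simp
      also have "\<dots> \<le> 2 / b * (2 * max 1 (cmod ?w) ^ L)" using b by (intro mult_left_mono S2) auto
      finally show ?thesis using S1[of ?w] by (simp add: K1_def ring_distribs)
    qed
    have "F holomorphic_on UNIV" unfolding F_def S_def
      by (intro holomorphic_intros) (use a0 L in auto)
    moreover have "F a = of_real (exp (radial \<psi> a))"
      using a0 L by (simp add: F_def S_def radial_def r_def)
    moreover have "cmod (F z) \<le> K1 ^ k * exp (2 * c) * exp (radial \<psi> z) / (1 + dist a z / \<tau> r) ^ k" for z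
    proof (cases "z = 0")
      case True
      then show ?thesis using m t K1 by (simp add: F_def power_0_left)
    next
      case False
      define l where "l = ln (cmod z / r)"
      have zr: "cmod (z / a) = exp l" using False a0 by (simp add: l_def r_def norm_divide)
      have mx: "max 1 (cmod (z / a)) = exp (max 0 l)" unfolding zr by (simp add: max_def)
      have p: "0 < 1 + dist a z / \<tau> r" using t by (simp add: add_pos_nonneg)
      have "(real m - mom r) * l + real (L * k) * max 0 l \<le> (1 + real (L * k)) * \<bar>l\<bar>"
      proof -
        have "(real m - mom r) * l \<le> \<bar>real m - mom r\<bar> * \<bar>l\<bar>" by (metis abs_ge_self abs_mult)
        also have "\<dots> \<le> 1 * \<bar>l\<bar>" using m by (intro mult_right_mono) auto
        finally have "(real m - mom r) * l \<le> 1 * \<bar>l\<bar>" .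
        moreover have "real (L * k) * max 0 l \<le> real (L * k) * \<bar>l\<bar>" by (intro mult_left_mono) auto
        ultimately show ?thesis by (simp add: distrib_right)
      qed
      also have "\<dots> \<le> c * \<sigma> * \<bar>l\<bar>"
      proof (rule mult_right_mono)
        have "1 + real (L * k) \<le> b * \<sigma> + b * \<sigma> * k"
          using L(1) \<sigma> mult_right_mono[OF L(1), of "real k"] by simp
        also have "\<dots> = (b * (real k + 1)) * \<sigma>" by (simp add: algebra_simps)
        also have "b * (real k + 1) = c / 2" unfolding b_def by (simp add: divide_simps)
        also have "c / 2 * \<sigma> \<le> c * \<sigma>" using c_pos \<sigma> by simp
        finally show "1 + real (L * k) \<le> c * \<sigma>" .
      qed simp
      also have "\<dots> \<le> gap r (cmod z) + 2 * c"
        using gap_lower[OF r(1), of "cmod z"] False by (simp add: l_def \<sigma>_def)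
      also have "gap r (cmod z) = \<psi> (cmod z) - \<psi> r - mom r * l" by (simp add: gap_def l_def)
      finally have ex: "\<psi> r + real m * l + real (L * k) * max 0 l \<le> 2 * c + \<psi> (cmod z)"
        by (simp add: algebra_simps)
      have "cmod (F z) * (1 + dist a z / \<tau> r) ^ k = exp (\<psi> r) * exp l ^ m * (cmod (S (z / a)) * (1 + dist a z / \<tau> r)) ^ k"
        by (simp add: F_def norm_mult norm_power zr power_mult_distrib)
      also have "\<dots> \<le> exp (\<psi> r) * exp l ^ m * (K1 * max 1 (cmod (z / a)) ^ L) ^ k"
        using p by (intro mult_left_mono power_mono S3) auto
      also have "\<dots> = K1 ^ k * exp (\<psi> r + real m * l + real (L * k) * max 0 l)"
        unfolding mx by (simp add: power_mult_distrib exp_add mult_ac flip: exp_of_nat_mult power_mult)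
      also have "\<dots> \<le> K1 ^ k * exp (2 * c + \<psi> (cmod z))" using ex K1 by (intro mult_left_mono) auto
      finally show ?thesis using p by (simp add: pos_le_divide_eq exp_add radial_def mult_ac)
    qed
    ultimately show "\<exists>F. F holomorphic_on UNIV \<and> F a = of_real (exp (radial \<psi> a)) \<and>
      (\<forall>z. cmod (F z) \<le> K1 ^ k * exp (2 * c) * exp (radial \<psi> z) / (1 + dist a z / \<tau> (cmod a)) ^ k)"
      unfolding r_def by blast
  qed (use R1 K1 in auto)
qed

text \<open>Evaluation at \<open>z\<close> has norm of the size of \<open>\<tau> (cmod z) powr (- decay p) * exp (radial \<psi> z)\<close>.\<close>

definition decay :: "ennreal \<Rightarrow> real" where
  "decay p = (if p = \<infinity> then 0 else 2 / enn2real p)"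

lemma fock_evaluation:
  assumes p: "0 < p"
  obtains K where "0 < K"
    and "\<And>f z. \<lbrakk>f \<in> fock_space \<psi> p; R \<le> cmod z\<rbrakk> \<Longrightarrow>
      cmod (f z) \<le> K * \<tau> (cmod z) powr (- decay p) * exp (radial \<psi> z) * fock_norm \<psi> p f"
  using p
proof (cases p rule: ennreal_exponent_cases)
  case 1
  show ?thesis
  proof (rule that[of 1])
    fix f z assume f: "f \<in> fock_space \<psi> p" and "R \<le> cmod z"
    then have "0 < \<tau> (cmod z)" using tau_pos' by simp
    then show "cmod (f z) \<le> 1 * \<tau> (cmod z) powr (- decay p) * exp (radial \<psi> z) * fock_norm \<psi> p f"
      using fock_norm_infinity_bound[of f \<psi> z] f 1 by (simp add: decay_def mult.commute)
  qed simp
next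
  case (2 q)
  then show ?thesis using weighted_submean[OF 2(1)] that by (simp add: decay_def) blast
qed

text \<open>The functions of \<open>test_function\<close> rescaled so that they attain the bound of
  \<open>fock_evaluation\<close> at \<open>a\<close> up to a constant. The extra smallness away from
  \<open>a\<close> makes them tend to 0 locally uniformly as \<open>a\<close> tends to infinity,
  which the compactness argument requires.\<close>

lemma fock_test_function:
  assumes p: "0 < p"
  obtains R1 K where "R \<le> R1" "0 < K"
    and "\<And>a. R1 \<le> cmod a \<Longrightarrow> \<exists>f \<in> fock_space \<psi> p. fock_norm \<psi> p f \<le> K \<and>
      cmod (f a) = \<tau> (cmod a) powr (- decay p) * exp (radial \<psi> a) \<and>
      (\<forall>z. 1 \<le> dist a z \<longrightarrow> cmod (f z) \<le> K * \<tau> (cmod a) * exp (radial \<psi> z))"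
proof -
  \<comment> \<open>The first condition leaves one spare factor \<open>\<tau>\<close> at distance at
    least 1 from \<open>a\<close> after rescaling; the second makes the \<open>p\<close>-th power
    decay with exponent 4, as in \<open>nn_integral_bump\<close>.\<close>
  obtain k :: nat where k: "decay p + 1 \<le> k" "p \<noteq> \<infinity> \<Longrightarrow> 4 / enn2real p \<le> k"
    using real_arch_simple[of "max (decay p + 1) (4 / enn2real p)"] by auto
  obtain R1 K where R1: "R \<le> R1" and K: "0 < K"
    and tf: "\<And>a. R1 \<le> cmod a \<Longrightarrow> \<exists>F. F holomorphic_on UNIV \<and> F a = of_real (exp (radial \<psi> a)) \<and>
      (\<forall>z. cmod (F z) \<le> K * exp (radial \<psi> z) / (1 + dist a z / \<tau> (cmod a)) ^ k)"
    by (rule test_function[of k]) blast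
  obtain B where B: "0 < B" and bump: "\<And>(a::complex) \<kappa>. 0 < \<kappa> \<Longrightarrow> (\<integral>\<^sup>+z. ennreal (1 / (1 + dist a z / \<kappa>)^4) \<partial>lborel) \<le> ennreal (B * \<kappa>^2)"
    by (rule nn_integral_bump) blast
  define K' where "K' = max K (K * B powr (1 / enn2real p))"
  have K': "0 < K'" "K \<le> K'" "K * B powr (1 / enn2real p) \<le> K'" using K by (auto simp: K'_def)
  show ?thesis
  proof (rule that[OF R1 K'(1)])
    fix a assume a: "R1 \<le> cmod a"
    define t where "t = \<tau> (cmod a)"
    have t: "0 < t" "t \<le> 1 / 2" using a R1 tau_pos' tau_le by (auto simp: t_def)
    obtain F where F: "F holomorphic_on UNIV" "F a = of_real (exp (radial \<psi> a))"
      and Fb: "\<And>z. cmod (F z) \<le> K * exp (radial \<psi> z) / (1 + dist a z / t) ^ k"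
      using tf[OF a] unfolding t_def by blast
    define f where "f z = of_real (t powr (- decay p)) * F z" for z
    have hol: "f holomorphic_on UNIV" unfolding f_def by (intro holomorphic_intros F)
    have one: "1 \<le> 1 + dist a z / t" for z using t by simp
    have fb: "cmod (f z) \<le> t powr (- decay p) * (K * exp (radial \<psi> z) / (1 + dist a z / t) ^ k)" for z
      using mult_left_mono[OF Fb, of "t powr (- decay p)" z] by (simp add: f_def norm_mult)
    have fa: "cmod (f a) = t powr (- decay p) * exp (radial \<psi> a)"
      by (simp add: f_def norm_mult F)
    have far: "cmod (f z) \<le> K' * t * exp (radial \<psi> z)" if z: "1 \<le> dist a z" for z
    proof -
      have "(1 / t) ^ k \<le> (1 + dist a z / t) ^ k"
        using z t by (intro power_mono) (auto simp: field_simps)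
      then have le: "1 / (1 + dist a z / t) ^ k \<le> t ^ k"
        using t by (simp add: power_one_over field_simps)
      have "cmod (f z) \<le> t powr (- decay p) * (K * exp (radial \<psi> z)) * (1 / (1 + dist a z / t) ^ k)"
        using fb[of z] by simp
      also have "\<dots> \<le> t powr (- decay p) * (K * exp (radial \<psi> z)) * t ^ k"
        using le K by (intro mult_left_mono) auto
      also have "\<dots> = K * exp (radial \<psi> z) * t powr (real k - decay p)"
        using t by (simp add: powr_diff powr_minus powr_realpow field_simps)
      also have "\<dots> \<le> K * exp (radial \<psi> z) * t powr 1"
        using t k K by (intro mult_left_mono powr_mono') auto
      also have "\<dots> \<le> K' * t * exp (radial \<psi> z)"
        using K' t mult_right_mono[of K K' "t * exp (radial \<psi> z)"] by (simp add: mult_ac)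
      finally show ?thesis .
    qed
    have "f \<in> fock_space \<psi> p \<and> fock_norm \<psi> p f \<le> K'"
      using p
    proof (cases p rule: ennreal_exponent_cases)
      case 1
      have "cmod (f z) \<le> K * exp (radial \<psi> z)" for z
      proof -
        have "cmod (f z) \<le> K * exp (radial \<psi> z) / (1 + dist a z / t) ^ k"
          using fb[of z] 1 t by (simp add: decay_def)
        also have "\<dots> \<le> K * exp (radial \<psi> z) / 1"
          using K one[of z] by (intro divide_left_mono one_le_power) auto
        finally show ?thesis by simp
      qed
      then show ?thesis using fock_space_infinityI[OF hol, of K] 1 K' by fastforce
    next
      case (2 q)
      have kq: "4 \<le> real k * q" using k(2) 2 by (simp add: field_simps)
      have dens: "fock_density q f z \<le> K powr q * t powr (- 2) * (1 / (1 + dist a z / t) ^ 4)" for z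
      proof -
        have "cmod (f z) powr q \<le> (t powr (- decay p) * (K * exp (radial \<psi> z) / (1 + dist a z / t) ^ k)) powr q"
          using 2 by (intro powr_mono2 fb) auto
        also have "\<dots> = t powr (- 2) * (K powr q * exp (q * radial \<psi> z) / (1 + dist a z / t) powr (real k * q))"
        proof -
          have "((1 + dist a z / t) ^ k) powr q = (1 + dist a z / t) powr (real k * q)"
            using one[of z] by (simp add: powr_powr flip: powr_realpow)
          moreover have "(t powr (- decay p)) powr q = t powr (- 2)"
            using 2 by (simp add: powr_powr decay_def)
          ultimately show ?thesis using K one[of z]
            by (simp add: powr_mult powr_divide exp_powr_real mult.commute)
        qed
        also have "\<dots> \<le> t powr (- 2) * (K powr q * exp (q * radial \<psi> z) / (1 + dist a z / t) powr 4)"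
          using one[of z] kq by (intro mult_left_mono divide_left_mono powr_mono) auto
        finally have "cmod (f z) powr q * exp (- (q * radial \<psi> z))
            \<le> t powr (- 2) * (K powr q * exp (q * radial \<psi> z) / (1 + dist a z / t) powr 4) * exp (- (q * radial \<psi> z))"
          by (rule mult_right_mono) simp
        also have "\<dots> = K powr q * t powr (- 2) * (1 / (1 + dist a z / t) ^ 4)"
          using one[of z] by (simp add: exp_minus powr_numeral)
        finally show ?thesis .
      qed
      \<comment> \<open>The factor \<open>t powr (- 2)\<close> from the normalisation cancels the
        area \<open>t^2\<close> of the bump, so the norm does not depend on
        \<open>a\<close>.\<close>
      have "(\<integral>\<^sup>+z. ennreal (fock_density q f z) \<partial>lborel)
          \<le> (\<integral>\<^sup>+z. ennreal (K powr q * t powr (- 2)) * ennreal (1 / (1 + dist a z / t) ^ 4) \<partial>lborel)"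
        using dens by (intro nn_integral_mono) (simp add: ennreal_leI flip: ennreal_mult'')
      also have "\<dots> = ennreal (K powr q * t powr (- 2)) * (\<integral>\<^sup>+z. ennreal (1 / (1 + dist a z / t) ^ 4) \<partial>lborel)"
        by (rule nn_integral_cmult) measurable
      also have "\<dots> \<le> ennreal (K powr q * t powr (- 2)) * ennreal (B * t^2)"
        by (intro mult_left_mono bump t) auto
      also have "\<dots> = ennreal (K powr q * t powr (- 2) * (B * t^2))"
        using B by (simp add: ennreal_mult'')
      also have "K powr q * t powr (- 2) * (B * t^2) = (K * B powr (1 / q)) powr q"
        using t B K 2 by (simp add: powr_minus powr_mult powr_powr)
      also have "ennreal ((K * B powr (1 / q)) powr q) \<le> ennreal (K' powr q)"
        using K' 2 K by (intro ennreal_leI powr_mono2) auto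
      finally show ?thesis
        using fock_space_finiteI[OF 2(1) hol, of K'] K' 2 by simp
    qed
    then show "\<exists>f \<in> fock_space \<psi> p. fock_norm \<psi> p f \<le> K' \<and>
      cmod (f a) = \<tau> (cmod a) powr (- decay p) * exp (radial \<psi> a) \<and>
      (\<forall>z. 1 \<le> dist a z \<longrightarrow> cmod (f z) \<le> K' * \<tau> (cmod a) * exp (radial \<psi> z))"
      using fa far unfolding t_def by blast
  qed
qed

section \<open>Operators into the space with the supremum norm\<close>

text \<open>The size of the derivative of a function of size \<open>exp (radial \<psi>)\<close>:
  \<open>weighted_Cauchy\<close> passes from the function to the derivative,
  \<open>volterra_majorized\<close> back.\<close>

definition majorant :: "complex \<Rightarrow> real" where
  "majorant w = (1 + radial \<psi>' w) * exp (radial \<psi> w)"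

lemma one_le_majorant: "1 \<le> majorant w"
  using mult_mono[of 1 "1 + radial \<psi>' w" 1 "exp (radial \<psi> w)"] psi'_nonneg[of "cmod w"] psi_nonneg[of "cmod w"]
  by (simp add: majorant_def radial_def)

lemma holomorphic_bounded_on_cball:
  assumes "f holomorphic_on UNIV"
  obtains G where "0 < G" "\<And>z. cmod z \<le> S \<Longrightarrow> cmod (f z) \<le> G"
proof -
  have "compact (f ` cball 0 S)"
    using assms by (intro compact_continuous_image holomorphic_on_imp_continuous_on[OF holomorphic_on_subset]) auto
  then obtain G where G: "0 < G" "\<And>x. x \<in> f ` cball 0 S \<Longrightarrow> norm x \<le> G"
    using compact_imp_bounded bounded_pos by metis
  then show ?thesis by (intro that[of G]) auto
qed

text \<open>\<open>ray_bound\<close> with exponent 1. The hypothesis concerns only the disc of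
  radius \<open>cmod z\<close>, so locally uniform smallness of \<open>f\<close> yields pointwise
  smallness of \<open>volterra g f\<close>.\<close>

lemma volterra_majorized:
  obtains L where "0 < L"
    and "\<And>f g z B. \<lbrakk>f holomorphic_on UNIV; g holomorphic_on UNIV; 0 \<le> B;
      \<And>w. cmod w \<le> cmod z \<Longrightarrow> cmod (f w * deriv g w) \<le> B * majorant w\<rbrakk> \<Longrightarrow>
      cmod (volterra g f z) \<le> L * B * exp (radial \<psi> z)"
proof -
  obtain L where L: "0 < L"
    and ray: "\<And>u z B. \<lbrakk>u holomorphic_on UNIV; u 0 = 0;
      \<And>x. 0 < x \<Longrightarrow> x < 1 \<Longrightarrow> cmod (deriv u (of_real x * z)) \<le> B * ((1 + \<psi>' (x * cmod z)) * exp (1 * \<psi> (x * cmod z)))\<rbrakk>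
      \<Longrightarrow> 0 \<le> B \<Longrightarrow> cmod (u z) \<le> L * B * exp (1 * \<psi> (cmod z))"
    by (rule ray_bound[OF zero_less_one]) blast
  show ?thesis
  proof (rule that[OF L])
    fix f g z B
    assume f: "f holomorphic_on UNIV" and g: "g holomorphic_on UNIV" and B: "0 \<le> B"
      and bd: "\<And>w. cmod w \<le> cmod z \<Longrightarrow> cmod (f w * deriv g w) \<le> B * majorant w"
    have "cmod (volterra g f z) \<le> L * B * exp (1 * \<psi> (cmod z))"
    proof (rule ray[OF holomorphic_on_volterra[OF f g] volterra_0 _ B])
      fix x :: real assume x: "0 < x" "x < 1"
      then have "cmod (of_real x * z) = x * cmod z" "x * cmod z \<le> cmod z"
        by (auto simp: norm_mult mult_left_le_one_le)
      then show "cmod (deriv (volterra g f) (of_real x * z)) \<le> B * ((1 + \<psi>' (x * cmod z)) * exp (1 * \<psi> (x * cmod z)))"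
        using bd[of "of_real x * z"] by (simp add: deriv_volterra[OF f g] majorant_def radial_def)
    qed
    then show "cmod (volterra g f z) \<le> L * B * exp (radial \<psi> z)" by (simp add: radial_def)
  qed
qed

text \<open>Far out the sharp point evaluation meets the hypothesis on \<open>g'\<close>; on the
  remaining disc both factors are bounded and the majorant is at least 1.\<close>

lemma product_majorant:
  assumes p: "0 < p" and g: "g holomorphic_on UNIV" and B: "0 \<le> B"
    and bd: "\<And>z. S \<le> cmod z \<Longrightarrow> cmod (deriv g z) * \<tau> (cmod z) powr (- decay p) \<le> B * (1 + radial \<psi>' z)"
  obtains K where "0 < K" "\<And>f w. f \<in> fock_space \<psi> p \<Longrightarrow> cmod (f w * deriv g w) \<le> K * fock_norm \<psi> p f * majorant w"
proof -
  obtain E where E: "0 < E" and ev: "\<And>f z. \<lbrakk>f \<in> fock_space \<psi> p; R \<le> cmod z\<rbrakk> \<Longrightarrow>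
      cmod (f z) \<le> E * \<tau> (cmod z) powr (- decay p) * exp (radial \<psi> z) * fock_norm \<psi> p f"
    by (rule fock_evaluation[OF p]) blast
  define S' where "S' = max R S"
  obtain E' where E': "0 < E'" and ev': "\<And>f z. \<lbrakk>f \<in> fock_space \<psi> p; cmod z \<le> S'\<rbrakk> \<Longrightarrow> cmod (f z) \<le> E' * fock_norm \<psi> p f"
    using fock_local_bound[OF p, of S'] by blast
  obtain G where G: "0 < G" "\<And>z. cmod z \<le> S' \<Longrightarrow> cmod (deriv g z) \<le> G"
    using holomorphic_bounded_on_cball[OF holomorphic_deriv[OF g open_UNIV], of S'] by blast
  show ?thesis
  proof (rule that)
    show "0 < E * B + E' * G" using E E' B G by (simp add: add_nonneg_pos)
    fix f w assume f: "f \<in> fock_space \<psi> p"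
    have N: "0 \<le> fock_norm \<psi> p f" by (rule fock_norm_nonneg[OF f])
    have M: "1 \<le> majorant w" by (rule one_le_majorant)
    show "cmod (f w * deriv g w) \<le> (E * B + E' * G) * fock_norm \<psi> p f * majorant w"
    proof (cases "S' \<le> cmod w")
      case True
      have "cmod (f w * deriv g w) \<le> (E * \<tau> (cmod w) powr (- decay p) * exp (radial \<psi> w) * fock_norm \<psi> p f) * cmod (deriv g w)"
        unfolding norm_mult using ev[OF f, of w] True by (intro mult_right_mono) (auto simp: S'_def)
      also have "\<dots> = E * exp (radial \<psi> w) * fock_norm \<psi> p f * (cmod (deriv g w) * \<tau> (cmod w) powr (- decay p))"
        by (simp add: mult_ac)
      also have "\<dots> \<le> E * exp (radial \<psi> w) * fock_norm \<psi> p f * (B * (1 + radial \<psi>' w))"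
        using bd[of w] True E N by (intro mult_left_mono) (auto simp: S'_def)
      also have "\<dots> = E * B * fock_norm \<psi> p f * majorant w" by (simp add: majorant_def mult_ac)
      also have "\<dots> \<le> (E * B + E' * G) * fock_norm \<psi> p f * majorant w"
        using N M E' G by (intro mult_right_mono) auto
      finally show ?thesis .
    next
      case False
      then have "cmod (f w * deriv g w) \<le> E' * fock_norm \<psi> p f * G"
        unfolding norm_mult using ev'[OF f] G(2) E' N by (intro mult_mono) auto
      also have "\<dots> \<le> E' * fock_norm \<psi> p f * G * majorant w"
        using E' N G M by (intro mult_left_mono[of 1 "majorant w", simplified]) auto
      also have "\<dots> = E' * G * fock_norm \<psi> p f * majorant w" by (simp add: mult_ac)
      also have "\<dots> \<le> (E * B + E' * G) * fock_norm \<psi> p f * majorant w"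
        using N M E B by (intro mult_right_mono) auto
      finally show ?thesis .
    qed
  qed
qed

lemma volterra_bounded_if:
  assumes p: "0 < p" and g: "g holomorphic_on UNIV"
    and bd: "\<And>z. S \<le> cmod z \<Longrightarrow> cmod (deriv g z) * \<tau> (cmod z) powr (- decay p) \<le> B * (1 + radial \<psi>' z)"
  shows "bounded_operator \<psi> p \<infinity> (volterra g)"
proof -
  have bd': "cmod (deriv g z) * \<tau> (cmod z) powr (- decay p) \<le> \<bar>B\<bar> * (1 + radial \<psi>' z)" if "S \<le> cmod z" for z
  proof -
    have "B * (1 + radial \<psi>' z) \<le> \<bar>B\<bar> * (1 + radial \<psi>' z)"
      using psi'_nonneg[of "cmod z"] by (intro mult_right_mono) (auto simp: radial_def)
    then show ?thesis using bd[OF that] by simp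
  qed
  obtain K where K: "0 < K" "\<And>f w. f \<in> fock_space \<psi> p \<Longrightarrow> cmod (f w * deriv g w) \<le> K * fock_norm \<psi> p f * majorant w"
    by (rule product_majorant[OF p g abs_ge_zero bd']) blast+
  obtain L where L: "0 < L"
    and vol: "\<And>f g z B. \<lbrakk>f holomorphic_on UNIV; g holomorphic_on UNIV; 0 \<le> B;
      \<And>w. cmod w \<le> cmod z \<Longrightarrow> cmod (f w * deriv g w) \<le> B * majorant w\<rbrakk> \<Longrightarrow>
      cmod (volterra g f z) \<le> L * B * exp (radial \<psi> z)"
    by (rule volterra_majorized) blast
  have "volterra g f \<in> fock_space \<psi> \<infinity> \<and> fock_norm \<psi> \<infinity> (volterra g f) \<le> L * K * fock_norm \<psi> p f"
    if f: "f \<in> fock_space \<psi> p" for f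
  proof -
    have hf: "f holomorphic_on UNIV" by (rule fock_space_holomorphic[OF f])
    have N: "0 \<le> fock_norm \<psi> p f" by (rule fock_norm_nonneg[OF f])
    have "cmod (volterra g f z) \<le> L * K * fock_norm \<psi> p f * exp (radial \<psi> z)" for z
      using vol[OF hf g, of "K * fock_norm \<psi> p f" z] K(1) K(2)[OF f] N by (simp add: mult_ac)
    then show ?thesis using fock_space_infinityI[OF holomorphic_on_volterra[OF hf g]] by blast
  qed
  then show ?thesis unfolding bounded_operator_def by blast
qed

text \<open>At the peak \<open>a\<close> of a test function, \<open>weighted_Cauchy\<close> bounds
  the derivative \<open>f a * deriv g a\<close> of the image, and the modulus of \<open>f a\<close>
  is known exactly.\<close>

lemma volterra_bounded_only_if:
  assumes p: "0 < p" and g: "g holomorphic_on UNIV" and b: "bounded_operator \<psi> p \<infinity> (volterra g)"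
  shows "\<exists>B S. \<forall>z. S \<le> cmod z \<longrightarrow> cmod (deriv g z) * \<tau> (cmod z) powr (- decay p) \<le> B * (1 + radial \<psi>' z)"
proof -
  obtain A where A: "\<And>f. f \<in> fock_space \<psi> p \<Longrightarrow> volterra g f \<in> fock_space \<psi> \<infinity>"
    "\<And>f. f \<in> fock_space \<psi> p \<Longrightarrow> fock_norm \<psi> \<infinity> (volterra g f) \<le> A * fock_norm \<psi> p f"
    using b by (auto simp: bounded_operator_def)
  obtain R1 K where R1: "R \<le> R1" and K: "0 < K"
    and tf: "\<And>a. R1 \<le> cmod a \<Longrightarrow> \<exists>f \<in> fock_space \<psi> p. fock_norm \<psi> p f \<le> K \<and>
      cmod (f a) = \<tau> (cmod a) powr (- decay p) * exp (radial \<psi> a) \<and>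
      (\<forall>z. 1 \<le> dist a z \<longrightarrow> cmod (f z) \<le> K * \<tau> (cmod a) * exp (radial \<psi> z))"
    by (rule fock_test_function[OF p]) blast
  obtain Q where Q: "0 < Q" and Cau: "\<And>u a B. \<lbrakk>u holomorphic_on UNIV; \<And>z. cmod (u z) \<le> B * exp (radial \<psi> z)\<rbrakk> \<Longrightarrow>
      cmod (deriv u a) \<le> Q * B * ((1 + radial \<psi>' a) * exp (radial \<psi> a))"
    by (rule weighted_Cauchy) blast
  show ?thesis
  proof (intro exI allI impI)
    fix a assume a: "R1 \<le> cmod a"
    obtain f where f: "f \<in> fock_space \<psi> p" "fock_norm \<psi> p f \<le> K"
      "cmod (f a) = \<tau> (cmod a) powr (- decay p) * exp (radial \<psi> a)"
      using tf[OF a] by blast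
    have hf: "f holomorphic_on UNIV" by (rule fock_space_holomorphic[OF f(1)])
    have "A * fock_norm \<psi> p f \<le> \<bar>A\<bar> * K"
      using f(2) fock_norm_nonneg[OF f(1)] by (intro mult_mono) auto
    then have "fock_norm \<psi> \<infinity> (volterra g f) \<le> \<bar>A\<bar> * K" using A(2)[OF f(1)] by simp
    then have "cmod (volterra g f z) \<le> (\<bar>A\<bar> * K) * exp (radial \<psi> z)" for z
      by (rule order_trans[OF fock_norm_infinity_bound[OF A(1)[OF f(1)], of z] mult_right_mono]) simp_all
    then have "cmod (deriv (volterra g f) a) \<le> Q * (\<bar>A\<bar> * K) * ((1 + radial \<psi>' a) * exp (radial \<psi> a))"
      by (rule Cau[OF holomorphic_on_volterra[OF hf g]])
    then have "(cmod (deriv g a) * \<tau> (cmod a) powr (- decay p)) * exp (radial \<psi> a) \<le> (Q * (\<bar>A\<bar> * K) * (1 + radial \<psi>' a)) * exp (radial \<psi> a)"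
      by (simp add: deriv_volterra[OF hf g] norm_mult f(3) mult_ac)
    then show "cmod (deriv g a) * \<tau> (cmod a) powr (- decay p) \<le> (Q * (\<bar>A\<bar> * K)) * (1 + radial \<psi>' a)"
      by simp
  qed
qed

section \<open>Compactness into the space with the supremum norm\<close>

lemma fock_Montel:
  assumes p: "0 < p" and F: "\<And>n::nat. F n \<in> fock_space \<psi> p" "\<And>n. fock_norm \<psi> p (F n) \<le> M"
  obtains f r where "f holomorphic_on UNIV" "strict_mono (r :: nat \<Rightarrow> nat)"
    "\<And>z. (\<lambda>n. F (r n) z) \<longlonglongrightarrow> f z"
    "\<And>S. uniform_limit (cball 0 S) (\<lambda>n. F (r n)) f sequentially"
proof -
  have bdd: "\<exists>B. \<forall>h \<in> range F. \<forall>z \<in> K. cmod (h z) \<le> B" if K: "compact K" for K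
  proof -
    obtain S where S: "\<And>z. z \<in> K \<Longrightarrow> cmod z \<le> S" using compact_imp_bounded[OF K] by (auto simp: bounded_iff)
    obtain E where E: "0 < E" "\<And>f z. \<lbrakk>f \<in> fock_space \<psi> p; cmod z \<le> S\<rbrakk> \<Longrightarrow> cmod (f z) \<le> E * fock_norm \<psi> p f"
      using fock_local_bound[OF p] by blast
    have "cmod (F n z) \<le> E * M" if "z \<in> K" for n z
      by (rule order_trans[OF E(2)[OF F(1)[of n] S[OF that]] mult_left_mono[OF F(2)[of n]]]) (use E(1) in simp)
    then show ?thesis by blast
  qed
  obtain f r where fr: "f holomorphic_on UNIV" "strict_mono (r :: nat \<Rightarrow> nat)"
    "\<And>x. x \<in> UNIV \<Longrightarrow> ((\<lambda>n. F (r n) x) \<longlonglongrightarrow> f x)"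
    "\<And>K. \<lbrakk>compact K; K \<subseteq> UNIV\<rbrakk> \<Longrightarrow> uniform_limit K (F \<circ> r) f sequentially"
  proof (rule Montel[of UNIV "range F" F])
    show "h holomorphic_on UNIV" if "h \<in> range F" for h
      using that F(1) fock_space_holomorphic by auto
  qed (use bdd in auto)
  have "uniform_limit (cball 0 S) (\<lambda>n. F (r n)) f sequentially" for S
    using fr(4)[of "cball 0 S"] by (simp add: o_def)
  then show ?thesis using that fr by blast
qed

text \<open>Along a Montel subsequence the differences are uniformly small on a large disc, while
  outside it both terms obey the evaluation bound and \<open>g'\<close> is small relative to it.
  Together they give a small multiple of \<open>majorant\<close> on the whole plane.\<close>

lemma volterra_compact_if:
  assumes p: "0 < p" and g: "g holomorphic_on UNIV"
    and lim: "\<And>e. 0 < e \<Longrightarrow> \<exists>S. \<forall>z. S \<le> cmod z \<longrightarrow> cmod (deriv g z) * \<tau> (cmod z) powr (- decay p) \<le> e * (1 + radial \<psi>' z)"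
  shows "compact_operator \<psi> p \<infinity> (volterra g)"
proof (rule compact_operatorI)
  obtain S where "\<And>z. S \<le> cmod z \<Longrightarrow> cmod (deriv g z) * \<tau> (cmod z) powr (- decay p) \<le> 1 * (1 + radial \<psi>' z)"
    using lim[of 1] by auto
  then have "bounded_operator \<psi> p \<infinity> (volterra g)" by (rule volterra_bounded_if[OF p g])
  then show maps: "volterra g f \<in> fock_space \<psi> \<infinity>" if "f \<in> fock_space \<psi> p" for f
    using that by (simp add: bounded_operator_def)
  fix F M
  assume F: "\<And>n::nat. F n \<in> fock_space \<psi> p" "\<And>n. fock_norm \<psi> p (F n) \<le> M"
  obtain E where E: "0 < E" and ev: "\<And>f z. \<lbrakk>f \<in> fock_space \<psi> p; R \<le> cmod z\<rbrakk> \<Longrightarrow>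
      cmod (f z) \<le> E * \<tau> (cmod z) powr (- decay p) * exp (radial \<psi> z) * fock_norm \<psi> p f"
    by (rule fock_evaluation[OF p]) blast
  obtain L where L: "0 < L"
    and vol: "\<And>f g z B. \<lbrakk>f holomorphic_on UNIV; g holomorphic_on UNIV; 0 \<le> B;
      \<And>w. cmod w \<le> cmod z \<Longrightarrow> cmod (f w * deriv g w) \<le> B * majorant w\<rbrakk> \<Longrightarrow>
      cmod (volterra g f z) \<le> L * B * exp (radial \<psi> z)"
    by (rule volterra_majorized) blast
  obtain f r where f: "f holomorphic_on UNIV" and r: "strict_mono (r :: nat \<Rightarrow> nat)"
    and pt: "\<And>z. (\<lambda>n. F (r n) z) \<longlonglongrightarrow> f z"
    and ul: "\<And>S. uniform_limit (cball 0 S) (\<lambda>n. F (r n)) f sequentially"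
    using fock_Montel[where F = F, OF p F] by blast
  have hF: "F n holomorphic_on UNIV" for n by (rule fock_space_holomorphic[OF F(1)])
  have M: "0 \<le> M" by (rule order_trans[OF fock_norm_nonneg[OF F(1)[of 0]] F(2)])
  have Fb: "cmod (F n z) \<le> E * M * (\<tau> (cmod z) powr (- decay p) * exp (radial \<psi> z))" if "R \<le> cmod z" for n z
  proof -
    have "cmod (F n z) \<le> E * \<tau> (cmod z) powr (- decay p) * exp (radial \<psi> z) * fock_norm \<psi> p (F n)"
      by (rule ev[OF F(1) that])
    also have "\<dots> \<le> E * \<tau> (cmod z) powr (- decay p) * exp (radial \<psi> z) * M"
      using E F(2) by (intro mult_left_mono) auto
    finally show ?thesis by (simp add: mult_ac)
  qed
  have fb: "cmod (f z) \<le> E * M * (\<tau> (cmod z) powr (- decay p) * exp (radial \<psi> z))" if "R \<le> cmod z" for z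
    by (rule LIMSEQ_le_const2[OF tendsto_norm[OF pt]]) (use Fb[OF that] in auto)
  have key: "\<forall>\<^sub>F n in sequentially. \<forall>z. cmod (volterra g (F (r n)) z - volterra g f z) \<le> L * e * exp (radial \<psi> z)"
    if e: "0 < e" for e
  proof -
    \<comment> \<open>\<open>2 * E * M\<close> bounds the difference of two functions that each
      satisfy the evaluation bound with \<open>E * M\<close>; the 1 keeps the denominator positive
      when \<open>M = 0\<close>.\<close>
    define e' where "e' = e / (2 * E * M + 1)"
    have EM: "0 < 2 * E * M + 1" using E M by (simp add: add_nonneg_pos)
    have e': "0 < e'" using e EM by (simp add: e'_def)
    obtain S0 where S0: "\<And>z. S0 \<le> cmod z \<Longrightarrow> cmod (deriv g z) * \<tau> (cmod z) powr (- decay p) \<le> e' * (1 + radial \<psi>' z)"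
      using lim[OF e'] by auto
    define S where "S = max R S0"
    obtain G where G: "0 < G" "\<And>z. cmod z \<le> S \<Longrightarrow> cmod (deriv g z) \<le> G"
      using holomorphic_bounded_on_cball[OF holomorphic_deriv[OF g open_UNIV], of S] by blast
    have "\<forall>\<^sub>F n in sequentially. \<forall>z\<in>cball 0 S. dist (F (r n) z) (f z) < e / G"
      using ul[of S] e G(1) by (auto simp: uniform_limit_iff)
    then show ?thesis
    proof (rule eventually_mono)
      fix n assume n: "\<forall>z\<in>cball 0 S. dist (F (r n) z) (f z) < e / G"
      have bd: "cmod ((F (r n) w - f w) * deriv g w) \<le> e * majorant w" for w
      proof (cases "S \<le> cmod w")
        case True
        then have w: "R \<le> cmod w" "S0 \<le> cmod w" by (auto simp: S_def)
        have "cmod (F (r n) w - f w) \<le> 2 * (E * M * (\<tau> (cmod w) powr (- decay p) * exp (radial \<psi> w)))"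
          using norm_triangle_ineq4[of "F (r n) w" "f w"] Fb[OF w(1), of "r n"] fb[OF w(1)] by simp
        then have "cmod ((F (r n) w - f w) * deriv g w) \<le> 2 * (E * M * (\<tau> (cmod w) powr (- decay p) * exp (radial \<psi> w))) * cmod (deriv g w)"
          unfolding norm_mult by (rule mult_right_mono) simp
        also have "\<dots> = 2 * E * M * exp (radial \<psi> w) * (cmod (deriv g w) * \<tau> (cmod w) powr (- decay p))" by (simp add: mult_ac)
        also have "\<dots> \<le> 2 * E * M * exp (radial \<psi> w) * (e' * (1 + radial \<psi>' w))"
          using E M S0[OF w(2)] by (intro mult_left_mono) auto
        also have "\<dots> = 2 * E * M * e' * majorant w" by (simp add: majorant_def mult_ac)
        also have "\<dots> \<le> e * majorant w"
        proof (rule mult_right_mono)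
          have "2 * E * M * e' \<le> (2 * E * M + 1) * e'" using e' by (intro mult_right_mono) auto
          then show "2 * E * M * e' \<le> e" using EM by (simp add: e'_def)
        qed (use one_le_majorant[of w] in simp)
        finally show ?thesis .
      next
        case False
        then have "cmod (F (r n) w - f w) * cmod (deriv g w) \<le> e / G * G"
          using n G(2)[of w] G(1) e by (intro mult_mono) (auto simp: dist_norm less_imp_le)
        then have "cmod ((F (r n) w - f w) * deriv g w) \<le> e * 1" using G(1) by (simp add: norm_mult)
        also have "\<dots> \<le> e * majorant w" using e one_le_majorant by (intro mult_left_mono) auto
        finally show ?thesis .
      qed
      have "(\<lambda>w. F (r n) w - f w) holomorphic_on UNIV" by (intro holomorphic_intros hF f)
      then show "\<forall>z. cmod (volterra g (F (r n)) z - volterra g f z) \<le> L * e * exp (radial \<psi> z)"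
        using vol[of "\<lambda>w. F (r n) w - f w" g e] e bd g by (simp add: volterra_diff[OF hF f g])
    qed
  qed
  have hd: "(\<lambda>z. volterra g (F (r n)) z - volterra g f z) holomorphic_on UNIV" for n
    by (intro holomorphic_intros holomorphic_on_volterra hF f g)
  \<comment> \<open>The Montel limit \<open>f\<close> is known only through pointwise bounds. Its
    image lies in the target because it differs from some \<open>volterra g (F (r n))\<close> by a
    member of that space.\<close>
  have Vf: "volterra g f \<in> fock_space \<psi> \<infinity>"
  proof -
    obtain n where "\<forall>z. cmod (volterra g (F (r n)) z - volterra g f z) \<le> L * 1 * exp (radial \<psi> z)"
      using eventually_happens'[OF _ key[OF zero_less_one]] by auto
    then have "(\<lambda>z. volterra g (F (r n)) z - volterra g f z) \<in> fock_space \<psi> \<infinity>"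
      by (intro fock_space_infinityI(1)[OF hd]) blast
    from fock_space_diff[OF _ maps[OF F(1)[of "r n"]] this] show ?thesis by simp
  qed
  have "(\<lambda>n. fock_norm \<psi> \<infinity> (\<lambda>z. volterra g (F (r n)) z - volterra g f z)) \<longlonglongrightarrow> 0"
  proof (rule LIMSEQ_I)
    fix e :: real assume e: "0 < e"
    then have "0 < e / (2 * L)" using L by simp
    from key[OF this] obtain N where N: "\<And>n z. N \<le> n \<Longrightarrow> cmod (volterra g (F (r n)) z - volterra g f z) \<le> L * (e / (2 * L)) * exp (radial \<psi> z)"
      by (auto simp: eventually_sequentially)
    show "\<exists>N. \<forall>n\<ge>N. norm (fock_norm \<psi> \<infinity> (\<lambda>z. volterra g (F (r n)) z - volterra g f z) - 0) < e"
    proof (intro exI allI impI)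
      fix n assume n: "N \<le> n"
      have "fock_norm \<psi> \<infinity> (\<lambda>z. volterra g (F (r n)) z - volterra g f z) \<le> L * (e / (2 * L))"
        "(\<lambda>z. volterra g (F (r n)) z - volterra g f z) \<in> fock_space \<psi> \<infinity>"
        using fock_space_infinityI[OF hd N[OF n]] by auto
      then show "norm (fock_norm \<psi> \<infinity> (\<lambda>z. volterra g (F (r n)) z - volterra g f z) - 0) < e"
        using fock_norm_nonneg e L by fastforce
    qed
  qed
  then show "\<exists>r u. strict_mono r \<and> u \<in> fock_space \<psi> \<infinity> \<and> (\<lambda>n. fock_norm \<psi> \<infinity> (\<lambda>z. volterra g (F (r n)) z - u z)) \<longlonglongrightarrow> 0"
    using r Vf by blast
qed simp

text \<open>If the condition fails along points \<open>a n\<close> tending to infinity, the test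
  functions peaking there are bounded and their images tend to 0 pointwise. A norm limit of a
  subsequence of images must then be 0, and \<open>weighted_Cauchy\<close> at the peaks contradicts
  the failure.\<close>

lemma volterra_compact_only_if:
  assumes p: "0 < p" and g: "g holomorphic_on UNIV" and comp: "compact_operator \<psi> p \<infinity> (volterra g)" and e: "0 < e"
  shows "\<exists>S. \<forall>z. S \<le> cmod z \<longrightarrow> cmod (deriv g z) * \<tau> (cmod z) powr (- decay p) \<le> e * (1 + radial \<psi>' z)"
proof (rule ccontr)
  assume neg: "\<not> ?thesis"
  obtain R1 K where R1: "R \<le> R1" and K: "0 < K"
    and tf: "\<And>a. R1 \<le> cmod a \<Longrightarrow> \<exists>f \<in> fock_space \<psi> p. fock_norm \<psi> p f \<le> K \<and>
      cmod (f a) = \<tau> (cmod a) powr (- decay p) * exp (radial \<psi> a) \<and>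
      (\<forall>z. 1 \<le> dist a z \<longrightarrow> cmod (f z) \<le> K * \<tau> (cmod a) * exp (radial \<psi> z))"
    by (rule fock_test_function[OF p]) blast
  obtain Q where Q: "0 < Q" and Cau: "\<And>u a B. \<lbrakk>u holomorphic_on UNIV; \<And>z. cmod (u z) \<le> B * exp (radial \<psi> z)\<rbrakk> \<Longrightarrow>
      cmod (deriv u a) \<le> Q * B * ((1 + radial \<psi>' a) * exp (radial \<psi> a))"
    by (rule weighted_Cauchy) blast
  obtain L where L: "0 < L"
    and vol: "\<And>f g z B. \<lbrakk>f holomorphic_on UNIV; g holomorphic_on UNIV; 0 \<le> B;
      \<And>w. cmod w \<le> cmod z \<Longrightarrow> cmod (f w * deriv g w) \<le> B * majorant w\<rbrakk> \<Longrightarrow>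
      cmod (volterra g f z) \<le> L * B * exp (radial \<psi> z)"
    by (rule volterra_majorized) blast
  have "\<forall>n. \<exists>a. max R1 (real n) \<le> cmod a \<and> e * (1 + radial \<psi>' a) < cmod (deriv g a) * \<tau> (cmod a) powr (- decay p)"
  proof
    fix n
    have "\<not> (\<forall>z. max R1 (real n) \<le> cmod z \<longrightarrow> cmod (deriv g z) * \<tau> (cmod z) powr (- decay p) \<le> e * (1 + radial \<psi>' z))"
      using neg by blast
    then show "\<exists>a. max R1 (real n) \<le> cmod a \<and> e * (1 + radial \<psi>' a) < cmod (deriv g a) * \<tau> (cmod a) powr (- decay p)"
      by (meson not_le)
  qed
  then obtain a where a: "\<And>n. max R1 (real n) \<le> cmod (a n)"
    "\<And>n. e * (1 + radial \<psi>' (a n)) < cmod (deriv g (a n)) * \<tau> (cmod (a n)) powr (- decay p)"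
    by metis
  have "\<forall>n. \<exists>f \<in> fock_space \<psi> p. fock_norm \<psi> p f \<le> K \<and>
      cmod (f (a n)) = \<tau> (cmod (a n)) powr (- decay p) * exp (radial \<psi> (a n)) \<and>
      (\<forall>z. 1 \<le> dist (a n) z \<longrightarrow> cmod (f z) \<le> K * \<tau> (cmod (a n)) * exp (radial \<psi> z))"
    using tf a(1) by auto
  then obtain F where F: "\<And>n. F n \<in> fock_space \<psi> p" "\<And>n. fock_norm \<psi> p (F n) \<le> K"
    and Fa: "\<And>n. cmod (F n (a n)) = \<tau> (cmod (a n)) powr (- decay p) * exp (radial \<psi> (a n))"
    and Fz: "\<And>n z. 1 \<le> dist (a n) z \<Longrightarrow> cmod (F n z) \<le> K * \<tau> (cmod (a n)) * exp (radial \<psi> z)"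
    by metis
  have hF: "F n holomorphic_on UNIV" for n by (rule fock_space_holomorphic[OF F(1)])
  have maps: "volterra g (F n) \<in> fock_space \<psi> \<infinity>" for n using comp F(1) by (simp add: compact_operator_def)
  obtain r u where r: "strict_mono (r :: nat \<Rightarrow> nat)" and u: "u \<in> fock_space \<psi> \<infinity>"
    and conv: "(\<lambda>n. fock_norm \<psi> \<infinity> (\<lambda>z. volterra g (F (r n)) z - u z)) \<longlonglongrightarrow> 0"
    using compact_operatorD[where F = F, OF _ comp F] by auto
  have mem: "(\<lambda>z. volterra g (F n) z - u z) \<in> fock_space \<psi> \<infinity>" for n
    by (rule fock_space_diff[OF _ maps u]) simp
  have "filterlim (\<lambda>n. cmod (a n)) at_top sequentially"
    using a(1) by (intro filterlim_at_top_mono[OF filterlim_real_sequentially]) auto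
  then have \<tau>0: "(\<lambda>n. \<tau> (cmod (a n))) \<longlonglongrightarrow> 0"
    by (rule filterlim_compose[OF tau_lim])
  \<comment> \<open>Once \<open>a n\<close> is farther than 1 from the disc of radius
    \<open>cmod z\<close>, the test function is of size \<open>\<tau> (cmod (a n))\<close> on this
    disc, and \<open>volterra_majorized\<close> looks no farther.\<close>
  have V0: "(\<lambda>n. volterra g (F n) z) \<longlonglongrightarrow> 0" for z
  proof -
    obtain G where G: "0 < G" "\<And>w. cmod w \<le> cmod z \<Longrightarrow> cmod (deriv g w) \<le> G"
      using holomorphic_bounded_on_cball[OF holomorphic_deriv[OF g open_UNIV], of "cmod z"] by blast
    show ?thesis
    proof (rule Lim_null_comparison)
      show "(\<lambda>n. L * (K * \<tau> (cmod (a n)) * G) * exp (radial \<psi> z)) \<longlonglongrightarrow> 0"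
        using \<tau>0 by (auto intro!: tendsto_eq_intros)
      have "\<forall>\<^sub>F n in sequentially. cmod z + 1 \<le> real n"
        using real_arch_simple[of "cmod z + 1"] by (metis eventually_sequentiallyI of_nat_le_iff order_trans)
      then show "\<forall>\<^sub>F n in sequentially. cmod (volterra g (F n) z) \<le> L * (K * \<tau> (cmod (a n)) * G) * exp (radial \<psi> z)"
      proof (rule eventually_mono)
        fix n assume n: "cmod z + 1 \<le> real n"
        have t: "0 \<le> \<tau> (cmod (a n))" using tau_positive[of "cmod (a n)"] by simp
        show "cmod (volterra g (F n) z) \<le> L * (K * \<tau> (cmod (a n)) * G) * exp (radial \<psi> z)"
        proof (rule vol[OF hF g])
          show "0 \<le> K * \<tau> (cmod (a n)) * G" using K t G by simp
          fix w assume w: "cmod w \<le> cmod z"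
          have "1 \<le> dist (a n) w" using a(1)[of n] n w norm_triangle_ineq2[of "a n" w] by (simp add: dist_norm)
          then have "cmod (F n w * deriv g w) \<le> K * \<tau> (cmod (a n)) * exp (radial \<psi> w) * G"
            unfolding norm_mult using Fz G(2)[OF w] K t by (intro mult_mono) auto
          also have "\<dots> = K * \<tau> (cmod (a n)) * G * (1 * exp (radial \<psi> w))" by simp
          also have "\<dots> \<le> K * \<tau> (cmod (a n)) * G * majorant w"
            unfolding majorant_def using K t G psi'_nonneg[of "cmod w"]
            by (intro mult_left_mono mult_right_mono) (auto simp: radial_def)
          finally show "cmod (F n w * deriv g w) \<le> K * \<tau> (cmod (a n)) * G * majorant w" .
        qed
      qed
    qed
  qed
  have "u z = 0" for z
  proof -
    have "(\<lambda>n. volterra g (F (r n)) z - u z) \<longlonglongrightarrow> 0"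
    proof (rule Lim_null_comparison)
      show "\<forall>\<^sub>F n in sequentially. cmod (volterra g (F (r n)) z - u z)
          \<le> fock_norm \<psi> \<infinity> (\<lambda>z. volterra g (F (r n)) z - u z) * exp (radial \<psi> z)"
        using fock_norm_infinity_bound[OF mem, of _ z] by (intro always_eventually allI)
      show "(\<lambda>n. fock_norm \<psi> \<infinity> (\<lambda>z. volterra g (F (r n)) z - u z) * exp (radial \<psi> z)) \<longlonglongrightarrow> 0"
        using conv by (auto intro!: tendsto_eq_intros)
    qed
    moreover have "(\<lambda>n. volterra g (F (r n)) z - u z) \<longlonglongrightarrow> 0 - u z"
      using LIMSEQ_subseq_LIMSEQ[OF V0 r, of z] by (intro tendsto_intros) (simp add: o_def)
    ultimately show ?thesis using LIMSEQ_unique by fastforce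
  qed
  then have "(\<lambda>n. fock_norm \<psi> \<infinity> (volterra g (F (r n)))) \<longlonglongrightarrow> 0" using conv by simp
  then have "\<forall>\<^sub>F n in sequentially. fock_norm \<psi> \<infinity> (volterra g (F (r n))) < e / Q"
    by (rule order_tendstoD) (use e Q in auto)
  then obtain n where n: "fock_norm \<psi> \<infinity> (volterra g (F (r n))) < e / Q"
    using eventually_happens'[OF sequentially_bot] by blast
  let ?b = "a (r n)"
  have "cmod (deriv (volterra g (F (r n))) ?b) \<le> Q * fock_norm \<psi> \<infinity> (volterra g (F (r n))) * ((1 + radial \<psi>' ?b) * exp (radial \<psi> ?b))"
    by (rule Cau[OF holomorphic_on_volterra[OF hF g] fock_norm_infinity_bound[OF maps]])
  then have "(cmod (deriv g ?b) * \<tau> (cmod ?b) powr (- decay p)) * exp (radial \<psi> ?b)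
      \<le> (Q * fock_norm \<psi> \<infinity> (volterra g (F (r n))) * (1 + radial \<psi>' ?b)) * exp (radial \<psi> ?b)"
    by (simp add: deriv_volterra[OF hF g] norm_mult Fa mult_ac)
  then have "cmod (deriv g ?b) * \<tau> (cmod ?b) powr (- decay p) \<le> Q * fock_norm \<psi> \<infinity> (volterra g (F (r n))) * (1 + radial \<psi>' ?b)"
    by simp
  also have "\<dots> \<le> e * (1 + radial \<psi>' ?b)"
    using n Q psi'_nonneg[of "cmod ?b"] by (intro mult_right_mono) (auto simp: radial_def field_simps)
  finally show False using a(2)[of "r n"] by simp
qed

end

section \<open>Averages over discs of radius comparable to the inverse slope\<close>

locale stepped_weight = scaled_weight +
  fixes \<delta> K :: real
  assumes step_pos: "0 < \<delta>" and step_le: "\<delta> \<le> 1" and K_ge: "1 \<le> K"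
    and step_psi'_upper: "\<And>r \<rho>. \<lbrakk>0 \<le> r; 0 \<le> \<rho>; \<bar>\<rho> - r\<bar> \<le> \<delta> / (1 + \<psi>' r)\<rbrakk> \<Longrightarrow> 1 + \<psi>' \<rho> \<le> K * (1 + \<psi>' r)"
    and step_psi'_lower: "\<And>r \<rho>. \<lbrakk>0 \<le> r; 0 \<le> \<rho>; \<bar>\<rho> - r\<bar> \<le> \<delta> / (1 + \<psi>' r)\<rbrakk> \<Longrightarrow> 1 + \<psi>' r \<le> K * (1 + \<psi>' \<rho>)"
    and step_psi: "\<And>r \<rho>. \<lbrakk>0 \<le> r; 0 \<le> \<rho>; \<bar>\<rho> - r\<bar> \<le> \<delta> / (1 + \<psi>' r)\<rbrakk> \<Longrightarrow> \<bar>\<psi> \<rho> - \<psi> r\<bar> \<le> K"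

lemma (in scaled_weight) stepped_weight_exists:
  obtains \<delta> K where "stepped_weight \<psi> \<psi>' \<psi>'' \<tau> R c C \<delta> K"
proof (rule step_radius)
  fix \<delta> K
  assume "0 < \<delta>" "\<delta> \<le> 1" "1 \<le> K"
    and "\<And>r \<rho>. \<lbrakk>0 \<le> r; 0 \<le> \<rho>; \<bar>\<rho> - r\<bar> \<le> \<delta> / (1 + \<psi>' r)\<rbrakk> \<Longrightarrow> 1 + \<psi>' \<rho> \<le> K * (1 + \<psi>' r)"
    and "\<And>r \<rho>. \<lbrakk>0 \<le> r; 0 \<le> \<rho>; \<bar>\<rho> - r\<bar> \<le> \<delta> / (1 + \<psi>' r)\<rbrakk> \<Longrightarrow> 1 + \<psi>' r \<le> K * (1 + \<psi>' \<rho>)"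
    and "\<And>r \<rho>. \<lbrakk>0 \<le> r; 0 \<le> \<rho>; \<bar>\<rho> - r\<bar> \<le> \<delta> / (1 + \<psi>' r)\<rbrakk> \<Longrightarrow> \<bar>\<psi> \<rho> - \<psi> r\<bar> \<le> K"
  then have "stepped_weight \<psi> \<psi>' \<psi>'' \<tau> R c C \<delta> K" by unfold_locales
  then show ?thesis by (rule that)
qed

context stepped_weight
begin

definition slope :: "complex \<Rightarrow> real" where "slope z = 1 + radial \<psi>' z"

definition rad :: "complex \<Rightarrow> real" where "rad z = \<delta> / slope z"

lemma slope_ge_1: "1 \<le> slope z"
  using psi'_nonneg[of "cmod z"] by (simp add: slope_def radial_def)

lemma slope_pos: "0 < slope z"
  using slope_ge_1[of z] by simp

lemma rad_pos: "0 < rad z" and rad_le: "rad z \<le> 1"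
  using step_pos step_le slope_ge_1[of z] by (simp_all add: rad_def)

lemma measurable_slope [measurable]: "slope \<in> borel_measurable borel"
  unfolding slope_def [abs_def]
  by (intro borel_measurable_continuous_onI continuous_intros continuous_on_radial_psi')

lemma measurable_rad [measurable]: "rad \<in> borel_measurable borel"
  unfolding rad_def [abs_def] by measurable

lemma measurable_radial_psi [measurable]: "radial \<psi> \<in> borel_measurable borel"
  by (intro borel_measurable_continuous_onI continuous_weight)

lemma
  assumes "dist a z \<le> rad a"
  shows slope_upper: "slope z \<le> K * slope a" and slope_lower: "slope a \<le> K * slope z"
    and psi_near: "\<bar>radial \<psi> z - radial \<psi> a\<bar> \<le> K" and rad_near: "rad a \<le> K * rad z"
proof -
  have "\<bar>cmod z - cmod a\<bar> \<le> \<delta> / (1 + \<psi>' (cmod a))"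
    using assms norm_triangle_ineq3[of z a] by (simp add: dist_norm norm_minus_commute rad_def slope_def radial_def)
  from step_psi'_upper[OF _ _ this] step_psi'_lower[OF _ _ this] step_psi[OF _ _ this]
  show u: "slope z \<le> K * slope a" and "slope a \<le> K * slope z" "\<bar>radial \<psi> z - radial \<psi> a\<bar> \<le> K"
    by (auto simp: slope_def radial_def)
  show "rad a \<le> K * rad z"
    using u step_pos slope_pos[of a] slope_pos[of z] by (simp add: rad_def field_simps)
qed

text \<open>Up to the constant \<open>pi * \<delta>^2\<close>, the mean of \<open>F\<close> over
  \<open>cball a (rad a)\<close>, whose area is
  \<open>pi * \<delta>^2 / (slope a)^2\<close>.\<close>

definition average :: "(complex \<Rightarrow> ennreal) \<Rightarrow> complex \<Rightarrow> ennreal" where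
  "average F a = ennreal ((slope a)^2) * (\<integral>\<^sup>+z\<in>cball a (rad a). F z \<partial>lborel)"

lemma measurable_average_pair:
  fixes F :: "complex \<Rightarrow> ennreal"
  assumes [measurable]: "F \<in> borel_measurable borel"
  shows "(\<lambda>(a, z). F z * indicator (cball a (rad a)) z) \<in> borel_measurable (lborel \<Otimes>\<^sub>M lborel)"
proof -
  have "(\<lambda>(a, z). F z * indicator (cball a (rad a)) z) = (\<lambda>(a, z). if dist a z \<le> rad a then F z else 0)"
    by (auto simp: fun_eq_iff)
  then show ?thesis by simp
qed

lemma measurable_average [measurable]:
  assumes [measurable]: "F \<in> borel_measurable borel"
  shows "average F \<in> borel_measurable borel"
proof -
  have "(\<lambda>a. \<integral>\<^sup>+z. F z * indicator (cball a (rad a)) z \<partial>lborel) \<in> borel_measurable lborel"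
    by (rule lborel.borel_measurable_nn_integral[OF measurable_average_pair[OF assms]])
  then have [measurable]: "(\<lambda>a. \<integral>\<^sup>+z. F z * indicator (cball a (rad a)) z \<partial>lborel) \<in> borel_measurable borel" by simp
  show ?thesis unfolding average_def [abs_def] by measurable
qed

text \<open>Fubini: a point \<open>z\<close> counts only for centres \<open>a\<close> in
  \<open>cball z (K * rad z)\<close>, where the slopes are comparable. In \<open>K^4\<close> one
  square comes from the slopes and one from the area of this disc.\<close>

lemma nn_integral_average:
  assumes [measurable]: "F \<in> borel_measurable borel"
  shows "(\<integral>\<^sup>+a. average F a \<partial>lborel) \<le> ennreal (pi * K^4) * (\<integral>\<^sup>+z. F z \<partial>lborel)"
proof -
  note [measurable] = measurable_average_pair[OF assms]
  have m: "(\<lambda>(a, z). ennreal ((slope a)^2) * (F z * indicator (cball a (rad a)) z)) \<in> borel_measurable (lborel \<Otimes>\<^sub>M lborel)"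
  proof -
    have "(\<lambda>(a, z). ennreal ((slope a)^2) * (F z * indicator (cball a (rad a)) z))
        = (\<lambda>x. ennreal ((slope (fst x))^2) * (\<lambda>(a, z). F z * indicator (cball a (rad a)) z) x)"
      by (auto simp: fun_eq_iff)
    also have "\<dots> \<in> borel_measurable (lborel \<Otimes>\<^sub>M lborel)" by measurable
    finally show ?thesis .
  qed
  have "(\<integral>\<^sup>+a. average F a \<partial>lborel) = (\<integral>\<^sup>+a. (\<integral>\<^sup>+z. ennreal ((slope a)^2) * (F z * indicator (cball a (rad a)) z) \<partial>lborel) \<partial>lborel)"
    unfolding average_def
  proof (rule nn_integral_cong)
    fix a
    have "(\<lambda>z. F z * indicator (cball a (rad a)) z) \<in> borel_measurable lborel"
      by (auto intro!: borel_measurable_times_ennreal borel_measurable_indicator simp: assms)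
    then show "ennreal ((slope a)^2) * (\<integral>\<^sup>+z. F z * indicator (cball a (rad a)) z \<partial>lborel)
      = (\<integral>\<^sup>+z. ennreal ((slope a)^2) * (F z * indicator (cball a (rad a)) z) \<partial>lborel)"
      by (rule nn_integral_cmult[symmetric])
  qed
  also have "\<dots> = (\<integral>\<^sup>+z. (\<integral>\<^sup>+a. ennreal ((slope a)^2) * (F z * indicator (cball a (rad a)) z) \<partial>lborel) \<partial>lborel)"
    by (rule lborel_pair.Fubini'[OF m, symmetric])
  also have "\<dots> \<le> (\<integral>\<^sup>+z. ennreal (pi * K^4) * F z \<partial>lborel)"
  proof (rule nn_integral_mono)
    fix z
    have "(\<integral>\<^sup>+a. ennreal ((slope a)^2) * (F z * indicator (cball a (rad a)) z) \<partial>lborel)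
      \<le> (\<integral>\<^sup>+a. (ennreal ((K * slope z)^2) * F z) * indicator (cball z (K * rad z)) a \<partial>lborel)"
    proof (rule nn_integral_mono)
      fix a
      show "ennreal ((slope a)^2) * (F z * indicator (cball a (rad a)) z) \<le> (ennreal ((K * slope z)^2) * F z) * indicator (cball z (K * rad z)) a"
      proof (cases "z \<in> cball a (rad a)")
        case True
        then have d: "dist a z \<le> rad a" by simp
        have "(slope a)^2 \<le> (K * slope z)^2" using slope_lower[OF d] slope_pos[of a] by (intro power_mono) auto
        then have "ennreal ((slope a)^2) * F z \<le> ennreal ((K * slope z)^2) * F z"
          by (intro mult_right_mono ennreal_leI) auto
        moreover have "a \<in> cball z (K * rad z)" using rad_near[OF d] d by (simp add: dist_commute)
        ultimately show ?thesis using True by simp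
      qed simp
    qed
    also have "\<dots> = (ennreal ((K * slope z)^2) * F z) * ennreal (pi * (K * rad z)^2)"
      using K_ge rad_pos[of z] by (subst nn_integral_cmult_indicator) (simp_all add: emeasure_cball_complex less_imp_le)
    also have "\<dots> = (ennreal ((K * slope z)^2) * ennreal (pi * (K * rad z)^2)) * F z"
      by (simp only: mult_ac)
    also have "ennreal ((K * slope z)^2) * ennreal (pi * (K * rad z)^2) = ennreal (pi * K^4 * \<delta>^2)"
    proof -
      have "(K * slope z)^2 * (pi * (K * rad z)^2) = pi * K^4 * \<delta>^2"
        using slope_pos[of z] by (simp add: rad_def field_simps eval_nat_numeral)
      then show ?thesis by (simp only: ennreal_mult''[symmetric] pi_ge_zero zero_le_power2 mult_nonneg_nonneg)
    qed
    also have "ennreal (pi * K^4 * \<delta>^2) * F z \<le> ennreal (pi * K^4) * F z"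
    proof (intro mult_right_mono ennreal_leI)
      have "pi * K^4 * \<delta>^2 \<le> pi * K^4 * 1"
        using step_pos step_le K_ge by (intro mult_left_mono) (auto simp: power_le_one)
      then show "pi * K^4 * \<delta>^2 \<le> pi * K^4" by simp
    qed simp
    finally show "(\<integral>\<^sup>+a. ennreal ((slope a)^2) * (F z * indicator (cball a (rad a)) z) \<partial>lborel) \<le> ennreal (pi * K^4) * F z" .
  qed
  also have "\<dots> = ennreal (pi * K^4) * (\<integral>\<^sup>+z. F z \<partial>lborel)"
    by (rule nn_integral_cmult) simp
  finally show ?thesis .
qed

text \<open>The Cauchy estimate in integrated form. In \<open>rad a powr (q + 2)\<close> the power
  \<open>q\<close> of the slope produces the quotient \<open>deriv u a / slope a\<close>, and the
  remaining square is the normalisation of \<open>average\<close>.\<close>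

lemma nn_integral_deriv_le:
  assumes q: "0 < q" and u: "u \<in> fock_space \<psi> (ennreal q)"
  shows "(\<integral>\<^sup>+a. ennreal ((cmod (deriv u a) / slope a) powr q * exp (- (q * radial \<psi> a))) \<partial>lborel) < \<infinity>"
proof -
  have hol: "u holomorphic_on UNIV" by (rule fock_space_holomorphic[OF u])
  note [measurable] = measurable_fock_density[OF hol, of q]
  obtain S where S: "0 < S" and sub: "\<And>h a r. \<lbrakk>0 < r; continuous_on (cball a r) h; h holomorphic_on ball a r\<rbrakk> \<Longrightarrow>
      ennreal (cmod (deriv h a) powr q * r powr (q + 2)) \<le> ennreal S * (\<integral>\<^sup>+z\<in>cball a r. ennreal (cmod (h z) powr q) \<partial>lborel)"
    using submean_powr_deriv[OF q] by blast
  define A where "A = S * exp (q * K) * \<delta> powr (- (q + 2))"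
  have A: "0 < A" using S step_pos by (simp add: A_def)
  have "(\<integral>\<^sup>+a. ennreal ((cmod (deriv u a) / slope a) powr q * exp (- (q * radial \<psi> a))) \<partial>lborel)
      \<le> (\<integral>\<^sup>+a. ennreal A * average (\<lambda>z. ennreal (fock_density q u z)) a \<partial>lborel)"
  proof (rule nn_integral_mono)
    fix a
    let ?E = "exp (- (q * radial \<psi> a))"
    let ?I = "\<integral>\<^sup>+z\<in>cball a (rad a). ennreal (fock_density q u z) \<partial>lborel"
    let ?c = "\<delta> powr (- (q + 2)) * (slope a)^2 * ?E"
    have m: "(\<lambda>z. ennreal (fock_density q u z) * indicator (cball a (rad a)) z) \<in> borel_measurable lborel"
      by (intro borel_measurable_times_ennreal borel_measurable_indicator) simp_all
    have "(cmod (deriv u a) / slope a) powr q * ?E = ?c * (cmod (deriv u a) powr q * rad a powr (q + 2))"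
    proof -
      have "slope a powr (q + 2) = slope a powr q * (slope a)^2"
        using slope_pos[of a] by (simp add: powr_add powr_numeral)
      then have "rad a powr (q + 2) = \<delta> powr (q + 2) / (slope a powr q * (slope a)^2)"
        using step_pos slope_pos[of a] by (simp add: rad_def powr_divide)
      moreover have "\<delta> powr (- (q + 2)) = 1 / \<delta> powr (q + 2)" by (simp only: powr_minus_divide)
      moreover have "\<delta> powr (q + 2) \<noteq> 0" "slope a powr q \<noteq> 0" "slope a \<noteq> 0" using step_pos slope_pos[of a] by auto
      moreover have "(cmod (deriv u a) / slope a) powr q = cmod (deriv u a) powr q / slope a powr q"
        using slope_pos[of a] by (simp add: powr_divide)
      ultimately show ?thesis by simp
    qed
    then have "ennreal ((cmod (deriv u a) / slope a) powr q * ?E) = ennreal ?c * ennreal (cmod (deriv u a) powr q * rad a powr (q + 2))"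
      by (simp only: ennreal_mult'' mult_nonneg_nonneg powr_ge_zero)
    also have "\<dots> \<le> ennreal ?c * (ennreal S * (\<integral>\<^sup>+z\<in>cball a (rad a). ennreal (cmod (u z) powr q) \<partial>lborel))"
      by (intro mult_left_mono sub rad_pos holomorphic_on_imp_continuous_on holomorphic_on_subset[OF hol]) auto
    also have "\<dots> \<le> ennreal ?c * (ennreal S * (\<integral>\<^sup>+z. ennreal (exp (q * K) / ?E) * (ennreal (fock_density q u z) * indicator (cball a (rad a)) z) \<partial>lborel))"
    proof (intro mult_left_mono nn_integral_mono)
      fix z
      show "ennreal (cmod (u z) powr q) * indicator (cball a (rad a)) z \<le> ennreal (exp (q * K) / ?E) * (ennreal (fock_density q u z) * indicator (cball a (rad a)) z)"
      proof (cases "z \<in> cball a (rad a)")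
        case True
        then have "q * radial \<psi> z \<le> q * (K + radial \<psi> a)" using psi_near[of a z] q by (intro mult_left_mono) auto
        then have "1 \<le> exp (q * K) / ?E * exp (- (q * radial \<psi> z))"
          by (simp add: exp_minus divide_inverse algebra_simps flip: exp_add) (simp add: divide_simps flip: exp_add)
        then have "cmod (u z) powr q * 1 \<le> cmod (u z) powr q * (exp (q * K) / ?E * exp (- (q * radial \<psi> z)))"
          by (rule mult_left_mono) simp
        then have "cmod (u z) powr q \<le> exp (q * K) / ?E * fock_density q u z" by (simp add: mult_ac)
        then show ?thesis using True by (subst mult.assoc[symmetric], subst ennreal_mult''[symmetric]) (auto intro: ennreal_leI)
      qed simp
    qed simp_all
    also have "\<dots> = ennreal ?c * (ennreal S * (ennreal (exp (q * K) / ?E) * ?I))"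
      by (subst nn_integral_cmult[OF m]) simp
    also have "\<dots> = (ennreal ?c * (ennreal S * ennreal (exp (q * K) / ?E))) * ?I"
      by (simp only: mult.assoc)
    also have "ennreal ?c * (ennreal S * ennreal (exp (q * K) / ?E)) = ennreal (A * (slope a)^2)"
    proof -
      have "?c * (S * (exp (q * K) / ?E)) = A * (slope a)^2" by (simp add: A_def)
      moreover have "0 \<le> S * (exp (q * K) / ?E)" "0 \<le> exp (q * K) / ?E" using S by simp_all
      ultimately show ?thesis by (metis ennreal_mult'')
    qed
    also have "ennreal (A * (slope a)^2) * ?I = ennreal A * average (\<lambda>z. ennreal (fock_density q u z)) a"
      unfolding average_def by (simp only: ennreal_mult'' zero_le_power2 mult.assoc)
    finally show "ennreal ((cmod (deriv u a) / slope a) powr q * ?E) \<le> ennreal A * average (\<lambda>z. ennreal (fock_density q u z)) a" .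
  qed
  also have "\<dots> = ennreal A * (\<integral>\<^sup>+a. average (\<lambda>z. ennreal (fock_density q u z)) a \<partial>lborel)"
    by (rule nn_integral_cmult) simp
  also have "\<dots> \<le> ennreal A * (ennreal (pi * K^4) * (\<integral>\<^sup>+z. ennreal (fock_density q u z) \<partial>lborel))"
    by (intro mult_left_mono nn_integral_average) simp_all
  also have "\<dots> < \<infinity>"
    by (simp add: nn_integral_fock_density[OF q u] ennreal_mult_less_top)
  finally show ?thesis .
qed

text \<open>Fubini's theorem and the dilations of the plane move the radial
  integration onto the weight; this replaces polar coordinates.\<close>

lemma nn_integral_dilation:
  assumes [measurable]: "F \<in> borel_measurable borel" and x: "0 < x"
  shows "(\<integral>\<^sup>+z. F z \<partial>lborel) = ennreal (1 / x^2) * (\<integral>\<^sup>+w. F (of_real (1 / x) * w) \<partial>(lborel :: complex measure))"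
proof -
  have "(\<integral>\<^sup>+z. F z \<partial>lborel) = (\<integral>\<^sup>+z. F z \<partial>density (distr lborel borel (\<lambda>w::complex. 0 + (1 / x) *\<^sub>R w)) (\<lambda>_. \<bar>1 / x\<bar> ^ DIM(complex)))"
    using lborel_affine[of "1 / x" "0::complex"] x by simp
  also have "\<dots> = (\<integral>\<^sup>+w. ennreal (1 / x^2) * F (of_real (1 / x) * w) \<partial>(lborel :: complex measure))"
    using x by (simp add: nn_integral_density nn_integral_distr scaleR_conv_of_real power_divide)
  also have "\<dots> = ennreal (1 / x^2) * (\<integral>\<^sup>+w. F (of_real (1 / x) * w) \<partial>lborel)"
    by (rule nn_integral_cmult) measurable
  finally show ?thesis .
qed

lemma nn_integral_powr_Icc:
  assumes "0 \<le> a"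
  shows "(\<integral>\<^sup>+x\<in>{0..1}. ennreal (x powr a) \<partial>lborel) = ennreal (1 / (a + 1))"
proof -
  have "((\<lambda>x. x powr a) has_integral (1 powr (a + 1) / (a + 1))) {0..1}"
    using assms by (intro has_integral_powr_from_0) auto
  then have "((\<lambda>x. x powr a) has_integral (1 / (a + 1))) {0..1}" by simp
  from nn_integral_has_integral_lebesgue[OF _ this] show ?thesis
    using assms by (simp add: nn_integral_completion ennreal_mult ennreal_indicator mult.commute)
qed

text \<open>\<open>gap_nonneg\<close> exponentiated: the weight lies above its tangent line in the
  logarithm.\<close>

lemma weight_tangent:
  assumes l: "0 < l" and r: "0 < r" and s: "0 < s"
  shows "exp (- (l * \<psi> s)) \<le> exp (- (l * \<psi> r)) * (r / s) powr (l * mom r)"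
proof -
  have "\<psi> r + mom r * ln (s / r) \<le> \<psi> s" using gap_nonneg[of r s] r s by (simp add: gap_def)
  then have "l * (\<psi> r + mom r * ln (s / r)) \<le> l * \<psi> s" using l by simp
  moreover have "ln (s / r) = - ln (r / s)" using r s by (simp add: ln_div)
  ultimately have "- (l * \<psi> s) \<le> - (l * \<psi> r) + l * mom r * ln (r / s)" by (simp add: algebra_simps)
  then have "exp (- (l * \<psi> s)) \<le> exp (- (l * \<psi> r) + l * mom r * ln (r / s))" by simp
  also have "\<dots> = exp (- (l * \<psi> r)) * (r / s) powr (l * mom r)"
    unfolding exp_add using r s by (simp add: powr_def)
  finally show ?thesis .
qed

text \<open>At a radius where \<open>l * mom\<close> has reached 4, the tangent line already forces
  decay of order 4. This order is integrable over the plane and beats the factor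
  \<open>1 / x^3\<close> in the next lemma.\<close>

lemma weight_decay:
  assumes l: "0 < l"
  obtains A where "0 < A" and "\<And>s. 0 \<le> s \<Longrightarrow> exp (- (l * \<psi> s)) \<le> A / (1 + s)^4"
proof -
  obtain R2 where R2: "R \<le> R2" "\<And>r. R2 \<le> r \<Longrightarrow> 4 / l \<le> \<psi>' r" by (rule psi'_eventually_ge) blast
  have R2': "2 \<le> R2" using R2 R_ge by simp
  have "4 \<le> 1 * (l * \<psi>' R2)" using R2(2)[of R2] l by (simp add: field_simps)
  also have "\<dots> \<le> R2 * (l * \<psi>' R2)"
    using R2' l psi'_nonneg[of R2] by (intro mult_right_mono) auto
  finally have m: "4 \<le> l * mom R2" by (simp add: mom_def mult_ac)
  show ?thesis
  proof (rule that)
    show "0 < (1 + R2)^4" using R2' by simp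
    fix s :: real assume s: "0 \<le> s"
    have le1: "exp (- (l * \<psi> t)) \<le> 1" if "0 \<le> t" for t using l psi_nonneg[OF that] by simp
    show "exp (- (l * \<psi> s)) \<le> (1 + R2)^4 / (1 + s)^4"
    proof (cases "s \<le> R2")
      case True
      have "(1 + s)^4 \<le> (1 + R2)^4" using True s by (intro power_mono) auto
      then have "1 \<le> (1 + R2)^4 / (1 + s)^4" using s by simp
      then show ?thesis by (rule order_trans[OF le1[OF s]])
    next
      case False
      have "exp (- (l * \<psi> s)) \<le> exp (- (l * \<psi> R2)) * (R2 / s) powr (l * mom R2)"
        using weight_tangent[OF l] R2' False by simp
      also have "\<dots> \<le> 1 * (R2 / s) powr 4"
        using le1[of R2] R2' False m by (intro mult_mono powr_mono') auto
      also have "\<dots> = (R2 / s)^4" using R2' False by (simp add: powr_numeral)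
      also have "\<dots> \<le> ((1 + R2) / (1 + s))^4" using R2' False by (intro power_mono) (auto simp: field_simps)
      finally show ?thesis by (simp add: power_divide)
    qed
  qed
qed

text \<open>The integral arises from the substitution \<open>w = x * z\<close>: the factor
  \<open>1 / x^3\<close> is the Jacobian \<open>1 / x^2\<close> times the \<open>1 / x\<close> in
  \<open>cmod z = cmod w / x\<close>. For large \<open>r\<close> the tangent at \<open>r\<close>
  turns the integrand into \<open>x powr (m - 3)\<close> with \<open>m = l * mom r\<close>, and the
  resulting \<open>1 / (m - 2)\<close> cancels \<open>(1 + \<psi>' r) * r\<close>. The bound
  \<open>1 / 2 \<le> r\<close> keeps \<open>1 / r^3\<close> bounded in the remaining range.\<close>

lemma radial_tail:
  assumes l: "0 < l"
  obtains A where "0 < A"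
    and "\<And>r. 1 / 2 \<le> r \<Longrightarrow> ennreal ((1 + \<psi>' r) * r) * (\<integral>\<^sup>+x\<in>{0<..1}. ennreal (1 / x^3 * exp (- (l * \<psi> (r / x)))) \<partial>lborel)
      \<le> ennreal (A * exp (- (l * \<psi> r)))"
proof -
  obtain R2 where R2: "R \<le> R2" "\<And>r. R2 \<le> r \<Longrightarrow> max 1 (3 / l) \<le> \<psi>' r" by (rule psi'_eventually_ge) blast
  have R2': "2 \<le> R2" using R2 R_ge by simp
  have mom_big: "3 \<le> l * mom r" if "R2 \<le> r" for r
  proof -
    have "3 / l \<le> \<psi>' r" using R2(2)[OF that] by simp
    then have "3 \<le> l * \<psi>' r" using l by (simp add: field_simps)
    then have "3 \<le> 1 * (l * \<psi>' r)" by simp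
    also have "\<dots> \<le> r * (l * \<psi>' r)"
      using that R2' l psi'_nonneg[of r] by (intro mult_right_mono) auto
    finally show ?thesis by (simp add: mom_def mult_ac)
  qed
  note tangent = weight_tangent[OF l]
  obtain A0 where A0: "0 < A0" and dec: "\<And>s. 0 \<le> s \<Longrightarrow> exp (- (l * \<psi> s)) \<le> A0 / (1 + s)^4"
    by (rule weight_decay[OF l]) blast
  \<comment> \<open>For \<open>r \<ge> R2\<close>,
    \<open>(1 + \<psi>' r) * r \<le> 2 / l * m\<close> and \<open>m / (m - 2) \<le> 3\<close> give
    \<open>6 / l\<close>. The second entry covers the radii below \<open>R2\<close>.\<close>
  define A where "A = max (6 / l) ((1 + \<psi>' R2 * R2) * R2 * 2 * (8 * A0) * exp (l * \<psi> R2))"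
  show ?thesis
  proof (rule that)
    show "0 < A" using l by (simp add: A_def less_max_iff_disj)
    fix r :: real assume r: "1 / 2 \<le> r"
    have p: "0 \<le> \<psi>' r" "0 < r" using psi'_nonneg[of r] r by auto
    let ?J = "\<integral>\<^sup>+x\<in>{0<..1}. ennreal (1 / x^3 * exp (- (l * \<psi> (r / x)))) \<partial>lborel"
    show "ennreal ((1 + \<psi>' r) * r) * ?J \<le> ennreal (A * exp (- (l * \<psi> r)))"
    proof (cases "R2 \<le> r")
      case True
      define m where "m = l * mom r"
      have m: "3 \<le> m" using mom_big[OF True] by (simp add: m_def)
      have "?J \<le> (\<integral>\<^sup>+x. ennreal (exp (- (l * \<psi> r))) * (ennreal (x powr (m - 3)) * indicator {0..1} x) \<partial>lborel)"
      proof (rule nn_integral_mono)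
        fix x :: real
        show "ennreal (1 / x^3 * exp (- (l * \<psi> (r / x)))) * indicator {0<..1} x \<le> ennreal (exp (- (l * \<psi> r))) * (ennreal (x powr (m - 3)) * indicator {0..1} x)"
        proof (cases "x \<in> {0<..1}")
          case True
          then have x: "0 < x" "x \<le> 1" by auto
          have "1 / x^3 * exp (- (l * \<psi> (r / x))) \<le> 1 / x^3 * (exp (- (l * \<psi> r)) * x powr m)"
            using tangent[of r "r / x"] x p by (intro mult_left_mono) (auto simp: m_def)
          also have "\<dots> = exp (- (l * \<psi> r)) * x powr (m - 3)"
            using x by (simp add: powr_diff powr_numeral)
          finally show ?thesis using x by (simp add: ennreal_leI flip: ennreal_mult'')
        qed simp
      qed
      also have "\<dots> = ennreal (exp (- (l * \<psi> r))) * (\<integral>\<^sup>+x\<in>{0..1}. ennreal (x powr (m - 3)) \<partial>lborel)"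
        by (rule nn_integral_cmult) measurable
      also have "\<dots> = ennreal (exp (- (l * \<psi> r))) * ennreal (1 / (m - 2))"
        using nn_integral_powr_Icc[of "m - 3"] m by simp
      finally have "ennreal ((1 + \<psi>' r) * r) * ?J \<le> ennreal ((1 + \<psi>' r) * r) * (ennreal (exp (- (l * \<psi> r))) * ennreal (1 / (m - 2)))"
        by (rule mult_left_mono) simp
      also have "\<dots> = ennreal ((1 + \<psi>' r) * r * (exp (- (l * \<psi> r)) * (1 / (m - 2))))"
      proof -
        have "0 \<le> exp (- (l * \<psi> r)) * (1 / (m - 2))" "0 \<le> 1 / (m - 2)" using m by simp_all
        then show ?thesis by (metis ennreal_mult'')
      qed
      also have "\<dots> \<le> ennreal (A * exp (- (l * \<psi> r)))"
      proof (rule ennreal_leI)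
        have "1 \<le> \<psi>' r" using R2(2)[OF True] by simp
        then have "(1 + \<psi>' r) * r \<le> 2 * \<psi>' r * r" using p by (intro mult_right_mono) auto
        also have "\<dots> = 2 / l * m" using l by (simp add: m_def mom_def)
        finally have "(1 + \<psi>' r) * r * (1 / (m - 2)) \<le> 2 / l * m * (1 / (m - 2))" using m by (intro mult_right_mono) auto
        also have "\<dots> = 2 / l * (m / (m - 2))" by simp
        also have "\<dots> \<le> 2 / l * 3" using m l by (intro mult_left_mono) (auto simp: field_simps)
        also have "\<dots> \<le> A" by (simp add: A_def)
        finally have "(1 + \<psi>' r) * r * (1 / (m - 2)) * exp (- (l * \<psi> r)) \<le> A * exp (- (l * \<psi> r))" by (rule mult_right_mono) simp
        then show "(1 + \<psi>' r) * r * (exp (- (l * \<psi> r)) * (1 / (m - 2))) \<le> A * exp (- (l * \<psi> r))" by (simp add: mult_ac)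
      qed
      finally show ?thesis .
    next
      case False
      have "?J \<le> (\<integral>\<^sup>+x. ennreal (8 * A0) * indicator {0<..1} (x::real) \<partial>lborel)"
      proof (rule nn_integral_mono)
        fix x :: real
        show "ennreal (1 / x^3 * exp (- (l * \<psi> (r / x)))) * indicator {0<..1} x \<le> ennreal (8 * A0) * indicator {0<..1} x"
        proof (cases "x \<in> {0<..1}")
          case True
          then have x: "0 < x" "x \<le> 1" by auto
          have y: "0 < r / x" using x p by simp
          have "(r / x)^3 * 1 \<le> (1 + r / x)^3 * (1 + r / x)" using y by (intro mult_mono power_mono) auto
          then have "(r / x)^3 \<le> (1 + r / x)^4" by (simp add: power4_eq_xxxx power3_eq_cube mult_ac)
          then have "A0 / (1 + r / x)^4 \<le> A0 / (r / x)^3" using A0 y by (intro divide_left_mono) auto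
          then have "1 / x^3 * exp (- (l * \<psi> (r / x))) \<le> 1 / x^3 * (A0 / (r / x)^3)"
            using dec[of "r / x"] x y by (intro mult_left_mono) auto
          also have "\<dots> = A0 * (1 / r)^3" using x by (simp add: power_divide)
          also have "\<dots> \<le> A0 * 2^3" using r A0 p by (intro mult_left_mono power_mono) (auto simp: field_simps)
          finally have "1 / x^3 * exp (- (l * \<psi> (r / x))) \<le> 8 * A0" by simp
          then show ?thesis using True by (simp add: ennreal_leI)
        qed simp
      qed
      also have "\<dots> = ennreal (8 * A0)" by (subst nn_integral_cmult_indicator) auto
      finally have "ennreal ((1 + \<psi>' r) * r) * ?J \<le> ennreal ((1 + \<psi>' r) * r) * ennreal (8 * A0)"
        by (rule mult_left_mono) simp
      also have "\<dots> = ennreal ((1 + \<psi>' r) * r * (8 * A0))" using A0 p by (simp add: ennreal_mult)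
      also have "\<dots> \<le> ennreal (A * exp (- (l * \<psi> r)))"
      proof (rule ennreal_leI)
        have rr: "r \<le> R2" using False by simp
        have "(1 + \<psi>' r) * r = r + mom r" by (simp add: mom_def algebra_simps)
        also have "\<dots> \<le> R2 + mom R2" using mom_mono[of r R2] rr p by simp
        also have "\<dots> \<le> (1 + \<psi>' R2 * R2) * R2 * 2"
        proof -
          have "0 \<le> mom R2" using mom_nonneg[of R2] R2' by simp
          then have "mom R2 * 1 \<le> mom R2 * R2" using R2' by (intro mult_left_mono) auto
          moreover have "(1 + \<psi>' R2 * R2) * R2 * 2 = 2 * R2 + 2 * (mom R2 * R2)" by (simp add: mom_def algebra_simps)
          ultimately show ?thesis using \<open>0 \<le> mom R2\<close> R2' by linarith
        qed
        finally have a: "(1 + \<psi>' r) * r * (8 * A0) \<le> (1 + \<psi>' R2 * R2) * R2 * 2 * (8 * A0)"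
          using A0 by (intro mult_right_mono) auto
        have e: "1 \<le> exp (l * \<psi> R2) * exp (- (l * \<psi> r))"
          using psi_mono[of r R2] rr p l by (simp flip: exp_add)
        have "0 \<le> (1 + \<psi>' R2 * R2) * R2 * 2 * (8 * A0)" using R2' A0 psi'_nonneg[of R2] by simp
        from mult_left_mono[OF e this] have "(1 + \<psi>' R2 * R2) * R2 * 2 * (8 * A0)
          \<le> ((1 + \<psi>' R2 * R2) * R2 * 2 * (8 * A0) * exp (l * \<psi> R2)) * exp (- (l * \<psi> r))" by (simp only: mult_1_right mult.assoc)
        also have "\<dots> \<le> A * exp (- (l * \<psi> r))" by (intro mult_right_mono) (auto simp: A_def)
        finally show "(1 + \<psi>' r) * r * (8 * A0) \<le> A * exp (- (l * \<psi> r))" using a by (rule order_trans[rotated])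
      qed
      finally show ?thesis .
    qed
  qed
qed

section \<open>A dominating function for the Volterra operator\<close>

definition symbol_density :: "real \<Rightarrow> (complex \<Rightarrow> complex) \<Rightarrow> complex \<Rightarrow> real" where
  "symbol_density q g w = (cmod (deriv g w) / slope w) powr q"

lemma symbol_density_nonneg [simp]: "0 \<le> symbol_density q g w"
  by (simp add: symbol_density_def)

lemma measurable_symbol_density [measurable]:
  assumes "g holomorphic_on UNIV"
  shows "symbol_density q g \<in> borel_measurable borel"
proof -
  have [measurable]: "deriv g \<in> borel_measurable borel"
    using holomorphic_deriv[OF assms open_UNIV]
    by (intro borel_measurable_continuous_onI holomorphic_on_imp_continuous_on)
  show ?thesis unfolding symbol_density_def [abs_def] by measurable
qed

abbreviation mean_density :: "real \<Rightarrow> (complex \<Rightarrow> complex) \<Rightarrow> complex \<Rightarrow> ennreal" where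
  "mean_density q g \<equiv> average (\<lambda>v. ennreal (symbol_density q g v))"

text \<open>The centre \<open>w'\<close> of the mean may differ from \<open>w\<close>. This freedom
  later allows the value at one point of a ray to be compared with the means at all points of a
  segment.\<close>

lemma symbol_density_le_mean:
  assumes q: "0 < q" and g: "g holomorphic_on UNIV"
  obtains A where "0 < A"
    and "\<And>w w'. dist w w' \<le> rad w / (2 * K) \<Longrightarrow> ennreal (symbol_density q g w) \<le> ennreal A * mean_density q g w'"
proof -
  obtain S where S: "0 < S" and sub: "\<And>h a r. \<lbrakk>0 < r; continuous_on (cball a r) h; h holomorphic_on ball a r\<rbrakk> \<Longrightarrow>
      ennreal (cmod (h a) powr q * r^2) \<le> ennreal S * (\<integral>\<^sup>+z\<in>cball a r. ennreal (cmod (h z) powr q) \<partial>lborel)"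
    using submean_powr[OF q] by blast
  \<comment> \<open>\<open>4 * K^2 / \<delta>^2\<close> stems from the radius \<open>r1\<close>, a
    further \<open>K^2\<close> from passing to the slope at \<open>w'\<close>, and
    \<open>K powr q\<close> from exchanging the slope at \<open>v\<close> for that at
    \<open>w\<close>.\<close>
  define A where "A = 4 * S * K powr q * K^4 / \<delta>^2"
  have A: "0 < A" using S K_ge step_pos by (simp add: A_def)
  have hol: "deriv g holomorphic_on UNIV" by (rule holomorphic_deriv[OF g open_UNIV])
  note [measurable] = measurable_symbol_density[OF g, of q]
  show ?thesis
  proof (rule that[OF A])
    fix w w' assume d: "dist w w' \<le> rad w / (2 * K)"
    define r1 where "r1 = rad w / (2 * K)"
    have r1: "0 < r1" "r1 \<le> rad w" "2 * r1 \<le> rad w'"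
    proof -
      show "0 < r1" using rad_pos[of w] K_ge by (simp add: r1_def)
      have "rad w / (2 * K) \<le> rad w / 1" using rad_pos[of w] K_ge by (intro divide_left_mono) auto
      then show "r1 \<le> rad w" by (simp add: r1_def)
      then have "dist w w' \<le> rad w" using d by (simp add: r1_def)
      from rad_near[OF this] show "2 * r1 \<le> rad w'" using K_ge by (simp add: r1_def field_simps)
    qed
    have dw: "dist w w' \<le> rad w" using d r1 by (simp add: r1_def)
    let ?c = "1 / (r1^2 * slope w powr q)"
    let ?I = "\<integral>\<^sup>+v\<in>cball w' (rad w'). ennreal (symbol_density q g v) \<partial>lborel"
    have c: "0 \<le> ?c" by simp
    have "symbol_density q g w = ?c * (cmod (deriv g w) powr q * r1^2)"
      using r1 slope_pos[of w] by (simp add: symbol_density_def powr_divide)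
    then have "ennreal (symbol_density q g w) = ennreal ?c * ennreal (cmod (deriv g w) powr q * r1^2)"
      by (simp only: ennreal_mult'' mult_nonneg_nonneg powr_ge_zero zero_le_power2)
    also have "\<dots> \<le> ennreal ?c * (ennreal S * (\<integral>\<^sup>+v\<in>cball w r1. ennreal (cmod (deriv g v) powr q) \<partial>lborel))"
      by (intro mult_left_mono sub r1 holomorphic_on_imp_continuous_on holomorphic_on_subset[OF hol]) auto
    also have "\<dots> \<le> ennreal ?c * (ennreal S * (\<integral>\<^sup>+v. ennreal ((K * slope w) powr q) * (ennreal (symbol_density q g v) * indicator (cball w' (rad w')) v) \<partial>lborel))"
    proof (intro mult_left_mono nn_integral_mono)
      fix v
      show "ennreal (cmod (deriv g v) powr q) * indicator (cball w r1) v
        \<le> ennreal ((K * slope w) powr q) * (ennreal (symbol_density q g v) * indicator (cball w' (rad w')) v)"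
      proof (cases "v \<in> cball w r1")
        case True
        then have v: "dist w v \<le> rad w" "dist w v \<le> r1" using r1 by auto
        have in': "v \<in> cball w' (rad w')"
          using v(2) d r1 dist_triangle[of w' v w] by (simp add: r1_def[symmetric] dist_commute)
        have "cmod (deriv g v) = slope v * (cmod (deriv g v) / slope v)" using slope_pos[of v] by simp
        also have "\<dots> \<le> (K * slope w) * (cmod (deriv g v) / slope v)"
          using slope_upper[OF v(1)] slope_pos[of v] by (intro mult_right_mono) auto
        finally have "cmod (deriv g v) powr q \<le> ((K * slope w) * (cmod (deriv g v) / slope v)) powr q"
          using q by (intro powr_mono2) auto
        also have "\<dots> = (K * slope w) powr q * symbol_density q g v"
          unfolding symbol_density_def by (rule powr_mult)
        finally have "ennreal (cmod (deriv g v) powr q) \<le> ennreal ((K * slope w) powr q) * ennreal (symbol_density q g v)"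
          by (subst ennreal_mult''[symmetric]) (auto intro: ennreal_leI)
        then show ?thesis using True in' by simp
      qed simp
    qed simp_all
    also have "(\<integral>\<^sup>+v. ennreal ((K * slope w) powr q) * (ennreal (symbol_density q g v) * indicator (cball w' (rad w')) v) \<partial>lborel)
      = ennreal ((K * slope w) powr q) * ?I"
      by (rule nn_integral_cmult) (auto intro!: borel_measurable_times_ennreal borel_measurable_indicator)
    also have "ennreal ?c * (ennreal S * (ennreal ((K * slope w) powr q) * ?I)) = (ennreal ?c * (ennreal S * ennreal ((K * slope w) powr q))) * ?I"
      by (simp only: mult.assoc)
    also have "ennreal ?c * (ennreal S * ennreal ((K * slope w) powr q)) = ennreal (?c * (S * (K * slope w) powr q))"
      using S c by (metis ennreal_mult'' mult_nonneg_nonneg less_imp_le powr_ge_zero)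
    also have "\<dots> * ?I \<le> ennreal (A * (slope w')^2) * ?I"
    proof (intro mult_right_mono ennreal_leI)
      have "?c * (S * (K * slope w) powr q) = S * K powr q / r1^2"
        using slope_pos[of w] K_ge by (simp add: powr_mult)
      also have "\<dots> = S * K powr q * (4 * K^2 / \<delta>^2) * (slope w)^2"
        using K_ge step_pos slope_pos[of w] by (simp add: r1_def rad_def field_simps power2_eq_square)
      also have "\<dots> \<le> S * K powr q * (4 * K^2 / \<delta>^2) * (K * slope w')^2"
        using slope_lower[OF dw] slope_pos[of w] S by (intro mult_left_mono power_mono) auto
      also have "\<dots> = A * (slope w')^2" by (simp add: A_def power_mult_distrib eval_nat_numeral)
      finally show "?c * (S * (K * slope w) powr q) \<le> A * (slope w')^2" .
    qed simp
    also have "\<dots> = ennreal A * mean_density q g w'"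
      unfolding average_def by (simp only: ennreal_mult'' zero_le_power2 mult.assoc)
    finally show "ennreal (symbol_density q g w) \<le> ennreal A * mean_density q g w'" .
  qed
qed

text \<open>The slope compensates for the length, about \<open>1 / slope\<close>, of the segment
  over which the integrand is stable. The cut-off keeps to the radii treated by
  \<open>radial_tail\<close>.\<close>

definition ray_density :: "real \<Rightarrow> (complex \<Rightarrow> complex) \<Rightarrow> complex \<Rightarrow> ennreal" where
  "ray_density q g w = mean_density q g w * ennreal (exp (q / 2 * radial \<psi> w) * slope w) * indicator {w. 1 / 2 \<le> cmod w} w"

lemma measurable_ray_density [measurable]:
  assumes "g holomorphic_on UNIV"
  shows "ray_density q g \<in> borel_measurable borel"
proof -
  note [measurable] = measurable_symbol_density[OF assms, of q]
  show ?thesis unfolding ray_density_def [abs_def] by measurable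
qed

text \<open>The value at \<open>w0 = x0 * z\<close> is bounded by the ray density, up to constants
  and the slope, at every point of the segment of length \<open>rad w0 / (2 * K)\<close> that ends
  at \<open>w0\<close> on the side of the origin. Integrating over this segment gives the claim;
  \<open>cmod z\<close> converts the parameter into length.\<close>

lemma ray_density_dominates:
  assumes q: "0 < q" and g: "g holomorphic_on UNIV"
  obtains A where "0 < A"
    and "\<And>z x0. \<lbrakk>0 \<le> x0; x0 \<le> 1; 1 \<le> cmod (of_real x0 * z)\<rbrakk> \<Longrightarrow>
      ennreal (symbol_density q g (of_real x0 * z) * exp (q / 2 * radial \<psi> (of_real x0 * z)))
        \<le> ennreal A * (\<integral>\<^sup>+x\<in>{0<..1}. ray_density q g (of_real x * z) * ennreal (cmod z) \<partial>lborel)"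
proof -
  obtain A where A: "0 < A"
    and le: "\<And>w w'. dist w w' \<le> rad w / (2 * K) \<Longrightarrow> ennreal (symbol_density q g w) \<le> ennreal A * mean_density q g w'"
    by (rule symbol_density_le_mean[OF q g]) blast
  define A' where "A' = A * exp (q / 2 * K) * K * (2 * K / \<delta>)"
  have A': "0 < A'" using A K_ge step_pos by (simp add: A'_def)
  note [measurable] = measurable_ray_density[OF g, of q]
  show ?thesis
  proof (rule that[OF A'])
    fix z x0
    assume x0: "0 \<le> x0" "x0 \<le> 1" and far: "1 \<le> cmod (of_real x0 * z)"
    define w0 where "w0 = of_real x0 * z"
    \<comment> \<open>The length of the segment in the parameter \<open>x\<close>. The segment has
      length at most \<open>1 / 2\<close> while \<open>cmod w0\<close> is at least 1, so it stays
      inside \<open>{0<..1}\<close> and outside the disc of radius \<open>1 / 2\<close>.\<close>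
    define h where "h = rad w0 / (2 * K) / cmod z"
    have z: "0 < cmod z" using far by (cases "z = 0") auto
    have nw0: "cmod w0 = x0 * cmod z" using x0 by (simp add: w0_def norm_mult)
    have r2: "rad w0 / (2 * K) \<le> 1 / 2"
      using rad_le[of w0] rad_pos[of w0] K_ge by (simp add: field_simps)
    have h: "0 < h" "h * cmod z = rad w0 / (2 * K)" using rad_pos[of w0] K_ge z by (simp_all add: h_def)
    have hx: "h < x0"
    proof -
      have "h * cmod z < x0 * cmod z" using h r2 far nw0 by (simp add: w0_def[symmetric])
      then show ?thesis using z by simp
    qed
    let ?s = "symbol_density q g w0 * exp (q / 2 * radial \<psi> w0)"
    let ?B = "A * exp (q / 2 * K) * K / (slope w0 * cmod z)"
    have B: "0 < ?B" using A K_ge slope_pos[of w0] z by simp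
    have pt: "ennreal ?s \<le> ennreal ?B * (ray_density q g (of_real x * z) * ennreal (cmod z))" if x: "x \<in> {x0 - h..x0}" for x
    proof -
      let ?w = "of_real x * z"
      have "w0 - ?w = of_real (x0 - x) * z" by (simp add: w0_def algebra_simps)
      then have "dist w0 ?w = \<bar>x0 - x\<bar> * cmod z" by (simp only: dist_norm norm_mult norm_of_real)
      also have "\<dots> \<le> h * cmod z" using x z by (intro mult_right_mono) auto
      finally have d: "dist w0 ?w \<le> rad w0 / (2 * K)" using h by simp
      have d': "dist w0 ?w \<le> rad w0"
      proof -
        have "rad w0 / (2 * K) \<le> rad w0 / 1" using rad_pos[of w0] K_ge by (intro divide_left_mono) auto
        then show ?thesis using d by simp
      qed
      have half: "1 / 2 \<le> cmod ?w"
        using norm_triangle_ineq2[of w0 "w0 - ?w"] d r2 far by (simp add: dist_norm w0_def[symmetric])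
      have e: "exp (q / 2 * radial \<psi> w0) \<le> exp (q / 2 * K) * exp (q / 2 * radial \<psi> ?w)"
      proof -
        have "q / 2 * radial \<psi> w0 \<le> q / 2 * (K + radial \<psi> ?w)" using psi_near[OF d'] q by (intro mult_left_mono) auto
        then show ?thesis by (simp add: distrib_left flip: exp_add)
      qed
      have sl: "slope w0 \<le> K * slope ?w" using slope_lower[OF d'] .
      have "exp (q / 2 * radial \<psi> w0) \<le> exp (q / 2 * K) * exp (q / 2 * radial \<psi> ?w) * (K * slope ?w / slope w0)"
      proof -
        have "1 \<le> K * slope ?w / slope w0" using sl slope_pos[of w0] by simp
        then have "exp (q / 2 * K) * exp (q / 2 * radial \<psi> ?w) * 1 \<le> exp (q / 2 * K) * exp (q / 2 * radial \<psi> ?w) * (K * slope ?w / slope w0)"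
          by (intro mult_left_mono) auto
        then show ?thesis using e by simp
      qed
      then have "ennreal ?s \<le> ennreal (symbol_density q g w0) * ennreal (exp (q / 2 * K) * exp (q / 2 * radial \<psi> ?w) * (K * slope ?w / slope w0))"
        by (subst ennreal_mult) (auto intro!: mult_left_mono ennreal_leI)
      also have "\<dots> \<le> (ennreal A * mean_density q g ?w) * ennreal (exp (q / 2 * K) * exp (q / 2 * radial \<psi> ?w) * (K * slope ?w / slope w0))"
        by (intro mult_right_mono le d) simp
      also have "\<dots> = (ennreal A * ennreal (exp (q / 2 * K) * exp (q / 2 * radial \<psi> ?w) * (K * slope ?w / slope w0))) * mean_density q g ?w"
        by (simp only: mult_ac)
      also have "ennreal A * ennreal (exp (q / 2 * K) * exp (q / 2 * radial \<psi> ?w) * (K * slope ?w / slope w0))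
          = ennreal (?B * (exp (q / 2 * radial \<psi> ?w) * slope ?w * cmod z))"
      proof -
        have "A * (exp (q / 2 * K) * exp (q / 2 * radial \<psi> ?w) * (K * slope ?w / slope w0)) = ?B * (exp (q / 2 * radial \<psi> ?w) * slope ?w * cmod z)"
          using z by simp
        moreover have "0 \<le> exp (q / 2 * K) * exp (q / 2 * radial \<psi> ?w) * (K * slope ?w / slope w0)"
          using K_ge slope_pos[of ?w] slope_pos[of w0] by simp
        ultimately show ?thesis by (metis ennreal_mult'')
      qed
      also have "\<dots> = ennreal ?B * (ennreal (exp (q / 2 * radial \<psi> ?w) * slope ?w) * ennreal (cmod z))"
      proof -
        have "0 \<le> cmod z" "0 \<le> exp (q / 2 * radial \<psi> ?w) * slope ?w * cmod z" using slope_pos[of ?w] by simp_all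
        then show ?thesis by (metis ennreal_mult'')
      qed
      also have "\<dots> * mean_density q g ?w = ennreal ?B * (ray_density q g ?w * ennreal (cmod z))"
        unfolding ray_density_def using half by (simp add: mult_ac)
      finally show ?thesis .
    qed
    have "ennreal ?s * ennreal h = (\<integral>\<^sup>+x. ennreal ?s * indicator {x0 - h..x0} x \<partial>lborel)"
      using h by (subst nn_integral_cmult_indicator) auto
    also have "\<dots> \<le> (\<integral>\<^sup>+x. ennreal ?B * (ray_density q g (of_real x * z) * ennreal (cmod z) * indicator {0<..1} x) \<partial>lborel)"
    proof (rule nn_integral_mono)
      fix x
      show "ennreal ?s * indicator {x0 - h..x0} x \<le> ennreal ?B * (ray_density q g (of_real x * z) * ennreal (cmod z) * indicator {0<..1} x)"
      proof (cases "x \<in> {x0 - h..x0}")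
        case True
        then have "x \<in> {0<..1}" using hx x0 by auto
        then show ?thesis using pt[OF True] True by simp
      qed simp
    qed
    also have "\<dots> = ennreal ?B * (\<integral>\<^sup>+x\<in>{0<..1}. ray_density q g (of_real x * z) * ennreal (cmod z) \<partial>lborel)"
      by (rule nn_integral_cmult) measurable
    finally have "ennreal (1 / h) * (ennreal ?s * ennreal h) \<le> ennreal (1 / h) * (ennreal ?B * (\<integral>\<^sup>+x\<in>{0<..1}. ray_density q g (of_real x * z) * ennreal (cmod z) \<partial>lborel))"
      by (rule mult_left_mono) simp
    also have "ennreal (1 / h) * (ennreal ?s * ennreal h) = ennreal ?s"
    proof -
      have "1 / h * (?s * h) = ?s" using h by simp
      moreover have "0 \<le> h" "0 \<le> ?s * h" using h by simp_all
      ultimately show ?thesis by (metis ennreal_mult'')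
    qed
    also have "ennreal (1 / h) * (ennreal ?B * (\<integral>\<^sup>+x\<in>{0<..1}. ray_density q g (of_real x * z) * ennreal (cmod z) \<partial>lborel))
        = ennreal A' * (\<integral>\<^sup>+x\<in>{0<..1}. ray_density q g (of_real x * z) * ennreal (cmod z) \<partial>lborel)"
    proof -
      have "1 / h * ?B = A'"
        using rad_pos[of w0] slope_pos[of w0] z K_ge step_pos by (simp add: h_def A'_def rad_def field_simps)
      then have "ennreal (1 / h) * ennreal ?B = ennreal A'" using B by (metis ennreal_mult'' less_imp_le)
      then show ?thesis by (simp only: mult.assoc[symmetric])
    qed
    finally show "ennreal (symbol_density q g (of_real x0 * z) * exp (q / 2 * radial \<psi> (of_real x0 * z)))
        \<le> ennreal A' * (\<integral>\<^sup>+x\<in>{0<..1}. ray_density q g (of_real x * z) * ennreal (cmod z) \<partial>lborel)"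
      by (simp add: w0_def)
  qed
qed

text \<open>After Fubini and the dilation \<open>w = x * z\<close>, \<open>radial_tail\<close>
  integrates out \<open>x\<close>. Its right-hand side cancels the factor
  \<open>exp (q / 2 * radial \<psi> w)\<close> of the ray density, so only the local mean of the
  symbol density is left.\<close>

lemma nn_integral_ray_density:
  assumes q: "0 < q" and g: "g holomorphic_on UNIV"
    and fin: "(\<integral>\<^sup>+w. ennreal (symbol_density q g w) \<partial>lborel) < \<infinity>"
  shows "(\<integral>\<^sup>+z. (\<integral>\<^sup>+x\<in>{0<..1}. ray_density q g (of_real x * z) * ennreal (cmod z) \<partial>lborel) * ennreal (exp (- (q / 2 * radial \<psi> z))) \<partial>lborel) < \<infinity>"
proof -
  note [measurable] = measurable_ray_density[OF g, of q] measurable_symbol_density[OF g, of q]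
  let ?l = "q / 2"
  obtain A where A: "0 < A"
    and tail: "\<And>r. 1 / 2 \<le> r \<Longrightarrow> ennreal ((1 + \<psi>' r) * r) * (\<integral>\<^sup>+x\<in>{0<..1}. ennreal (1 / x^3 * exp (- (?l * \<psi> (r / x)))) \<partial>lborel)
      \<le> ennreal (A * exp (- (?l * \<psi> r)))"
    using radial_tail[of ?l] q by auto
  have m1: "(\<lambda>(z, x). (ray_density q g (of_real x * z) * ennreal (cmod z) * indicator {0<..1} x) * ennreal (exp (- (?l * radial \<psi> z))))
      \<in> borel_measurable (lborel \<Otimes>\<^sub>M lborel)" by measurable
  have "(\<integral>\<^sup>+z. (\<integral>\<^sup>+x\<in>{0<..1}. ray_density q g (of_real x * z) * ennreal (cmod z) \<partial>lborel) * ennreal (exp (- (?l * radial \<psi> z))) \<partial>lborel)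
    = (\<integral>\<^sup>+z. (\<integral>\<^sup>+x. (ray_density q g (of_real x * z) * ennreal (cmod z) * indicator {0<..1} x) * ennreal (exp (- (?l * radial \<psi> z))) \<partial>lborel) \<partial>lborel)"
    by (intro nn_integral_cong nn_integral_multc[symmetric]) measurable
  also have "\<dots> = (\<integral>\<^sup>+x. (\<integral>\<^sup>+z. (ray_density q g (of_real x * z) * ennreal (cmod z) * indicator {0<..1} x) * ennreal (exp (- (?l * radial \<psi> z))) \<partial>lborel) \<partial>lborel)"
    by (rule lborel_pair.Fubini'[OF m1, symmetric])
  also have "\<dots> = (\<integral>\<^sup>+x. (\<integral>\<^sup>+w. (ray_density q g w * ennreal (cmod w)) * (ennreal (1 / x^3 * exp (- (?l * \<psi> (cmod w / x)))) * indicator {0<..1} x) \<partial>lborel) \<partial>lborel)"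
  proof (rule nn_integral_cong)
    fix x :: real
    show "(\<integral>\<^sup>+z. (ray_density q g (of_real x * z) * ennreal (cmod z) * indicator {0<..1} x) * ennreal (exp (- (?l * radial \<psi> z))) \<partial>lborel)
      = (\<integral>\<^sup>+w. (ray_density q g w * ennreal (cmod w)) * (ennreal (1 / x^3 * exp (- (?l * \<psi> (cmod w / x)))) * indicator {0<..1} x) \<partial>lborel)"
    proof (cases "x \<in> {0<..1}")
      case True
      then have x: "0 < x" by simp
      have "(\<integral>\<^sup>+z. (ray_density q g (of_real x * z) * ennreal (cmod z)) * ennreal (exp (- (?l * radial \<psi> z))) \<partial>lborel)
        = ennreal (1 / x^2) * (\<integral>\<^sup>+w. (ray_density q g (of_real x * (of_real (1 / x) * w)) * ennreal (cmod (of_real (1 / x) * w))) * ennreal (exp (- (?l * radial \<psi> (of_real (1 / x) * w)))) \<partial>lborel)"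
        by (rule nn_integral_dilation[OF _ x]) measurable
      also have "\<dots> = (\<integral>\<^sup>+w. ennreal (1 / x^2) * ((ray_density q g (of_real x * (of_real (1 / x) * w)) * ennreal (cmod (of_real (1 / x) * w))) * ennreal (exp (- (?l * radial \<psi> (of_real (1 / x) * w))))) \<partial>lborel)"
        by (rule nn_integral_cmult[symmetric]) measurable
      also have "\<dots> = (\<integral>\<^sup>+w. (ray_density q g w * ennreal (cmod w)) * ennreal (1 / x^3 * exp (- (?l * \<psi> (cmod w / x)))) \<partial>lborel)"
      proof (rule nn_integral_cong)
        fix w :: complex
        have n: "cmod (of_real (1 / x) * w) = cmod w / x" using x by (simp add: norm_mult norm_divide)
        have s: "of_real x * (of_real (1 / x) * w) = w" using x by simp
        have "ennreal (1 / x^2) * (ennreal (cmod w / x) * ennreal (exp (- (?l * \<psi> (cmod w / x)))))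
            = ennreal (1 / x^2 * (cmod w / x * exp (- (?l * \<psi> (cmod w / x)))))"
        proof -
          have "0 \<le> exp (- (?l * \<psi> (cmod w / x)))" "0 \<le> cmod w / x * exp (- (?l * \<psi> (cmod w / x)))" using x by simp_all
          then show ?thesis by (metis ennreal_mult'')
        qed
        also have "1 / x^2 * (cmod w / x * exp (- (?l * \<psi> (cmod w / x)))) = cmod w * (1 / x^3 * exp (- (?l * \<psi> (cmod w / x))))"
          by (simp add: power2_eq_square power3_eq_cube)
        also have "ennreal \<dots> = ennreal (cmod w) * ennreal (1 / x^3 * exp (- (?l * \<psi> (cmod w / x))))"
          using x by (intro ennreal_mult) auto
        finally have e: "ennreal (1 / x^2) * (ennreal (cmod w / x) * ennreal (exp (- (?l * \<psi> (cmod w / x)))))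
            = ennreal (cmod w) * ennreal (1 / x^3 * exp (- (?l * \<psi> (cmod w / x))))" .
        show "ennreal (1 / x^2) * ((ray_density q g (of_real x * (of_real (1 / x) * w)) * ennreal (cmod (of_real (1 / x) * w))) * ennreal (exp (- (?l * radial \<psi> (of_real (1 / x) * w)))))
          = (ray_density q g w * ennreal (cmod w)) * ennreal (1 / x^3 * exp (- (?l * \<psi> (cmod w / x))))"
          unfolding s radial_def n using e by (simp only: mult.assoc mult.left_commute[of _ "ray_density q g w"])
      qed
      finally show ?thesis using True by simp
    qed simp
  qed
  also have "\<dots> = (\<integral>\<^sup>+w. (\<integral>\<^sup>+x. (ray_density q g w * ennreal (cmod w)) * (ennreal (1 / x^3 * exp (- (?l * \<psi> (cmod w / x)))) * indicator {0<..1} x) \<partial>lborel) \<partial>lborel)"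
  proof (rule lborel_pair.Fubini')
    have "(\<lambda>(w, x). (ray_density q g w * ennreal (cmod w)) * (ennreal (1 / x^3 * exp (- (?l * radial \<psi> (of_real (1 / x) * w)))) * indicator {0<..1} x))
      \<in> borel_measurable (lborel \<Otimes>\<^sub>M lborel)" by measurable
    also have "(\<lambda>(w, x). (ray_density q g w * ennreal (cmod w)) * (ennreal (1 / x^3 * exp (- (?l * radial \<psi> (of_real (1 / x) * w)))) * indicator {0<..1} x))
      = (\<lambda>(w, x). (ray_density q g w * ennreal (cmod w)) * (ennreal (1 / x^3 * exp (- (?l * \<psi> (cmod w / x)))) * indicator {0<..1} x))"
      by (auto simp: fun_eq_iff radial_def norm_mult norm_divide indicator_def)
    finally show "(\<lambda>(w, x). (ray_density q g w * ennreal (cmod w)) * (ennreal (1 / x^3 * exp (- (?l * \<psi> (cmod w / x)))) * indicator {0<..1} x))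
      \<in> borel_measurable (lborel \<Otimes>\<^sub>M lborel)" .
  qed
  also have "\<dots> \<le> (\<integral>\<^sup>+w. ennreal A * mean_density q g w \<partial>lborel)"
  proof (rule nn_integral_mono)
    fix w :: complex
    let ?J = "\<integral>\<^sup>+x\<in>{0<..1}. ennreal (1 / x^3 * exp (- (?l * \<psi> (cmod w / x)))) \<partial>lborel"
    have meas: "(\<lambda>x::real. ennreal (1 / x^3 * exp (- (?l * \<psi> (cmod w / x)))) * indicator {0<..1} x) \<in> borel_measurable lborel"
    proof -
      have "(\<lambda>x::real. ennreal (1 / x^3 * exp (- (?l * radial \<psi> (of_real (1 / x) * w)))) * indicator {0<..1} x) \<in> borel_measurable lborel" by measurable
      also have "(\<lambda>x::real. ennreal (1 / x^3 * exp (- (?l * radial \<psi> (of_real (1 / x) * w)))) * indicator {0<..1} x)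
          = (\<lambda>x::real. ennreal (1 / x^3 * exp (- (?l * \<psi> (cmod w / x)))) * indicator {0<..1} x)"
        by (auto simp: fun_eq_iff radial_def norm_mult norm_divide indicator_def)
      finally show ?thesis .
    qed
    have "(\<integral>\<^sup>+x. (ray_density q g w * ennreal (cmod w)) * (ennreal (1 / x^3 * exp (- (?l * \<psi> (cmod w / x)))) * indicator {0<..1} x) \<partial>lborel)
      = ray_density q g w * ennreal (cmod w) * ?J"
      by (rule nn_integral_cmult[OF meas])
    also have "\<dots> \<le> ennreal A * mean_density q g w"
    proof (cases "1 / 2 \<le> cmod w")
      case True
      have sl: "0 \<le> slope w" using slope_pos[of w] by simp
      have "ray_density q g w * ennreal (cmod w) * ?J = mean_density q g w * (ennreal (exp (?l * radial \<psi> w)) * (ennreal (slope w * cmod w) * ?J))"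
        unfolding ray_density_def using True sl by (simp add: ennreal_mult mult.assoc)
      also have "\<dots> \<le> mean_density q g w * (ennreal (exp (?l * radial \<psi> w)) * ennreal (A * exp (- (?l * radial \<psi> w))))"
        using tail[OF True] by (intro mult_left_mono) (auto simp: slope_def radial_def)
      also have "ennreal (exp (?l * radial \<psi> w)) * ennreal (A * exp (- (?l * radial \<psi> w))) = ennreal A"
      proof -
        have "exp (?l * radial \<psi> w) * (A * exp (- (?l * radial \<psi> w))) = A" by (simp add: exp_minus)
        moreover have "0 \<le> A * exp (- (?l * radial \<psi> w))" using A by simp
        ultimately show ?thesis by (metis ennreal_mult'')
      qed
      finally show ?thesis by (simp add: mult.commute)
    qed (simp add: ray_density_def)
    finally show "(\<integral>\<^sup>+x. (ray_density q g w * ennreal (cmod w)) * (ennreal (1 / x^3 * exp (- (?l * \<psi> (cmod w / x)))) * indicator {0<..1} x) \<partial>lborel)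
      \<le> ennreal A * mean_density q g w" .
  qed
  also have "\<dots> = ennreal A * (\<integral>\<^sup>+w. mean_density q g w \<partial>lborel)" by (rule nn_integral_cmult) measurable
  also have "\<dots> \<le> ennreal A * (ennreal (pi * K^4) * (\<integral>\<^sup>+w. ennreal (symbol_density q g w) \<partial>lborel))"
    by (intro mult_left_mono nn_integral_average) simp_all
  also have "\<dots> < \<infinity>" using fin by (simp add: ennreal_mult_less_top)
  finally show ?thesis .
qed

text \<open>The supremum of the integrand along the ray from 0 to \<open>z\<close>, instead of its integral, is controlled by a radial
  integral of local means. This works for exponents below one as well, where Hardy's inequality fails.\<close>

lemma volterra_dominated:
  assumes q: "0 < q" and g: "g holomorphic_on UNIV"
    and fin: "(\<integral>\<^sup>+w. ennreal (symbol_density q g w) \<partial>lborel) < \<infinity>"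
  obtains W where "W \<in> borel_measurable borel" "(\<integral>\<^sup>+z. W z \<partial>lborel) < \<infinity>"
    and "\<And>f z. f \<in> fock_space \<psi> \<infinity> \<Longrightarrow> ennreal (fock_density q (volterra g f) z) \<le> ennreal (fock_norm \<psi> \<infinity> f powr q) * W z"
proof -
  note [measurable] = measurable_ray_density[OF g, of q]
  obtain L where L: "0 < L"
    and ray: "\<And>u z B. \<lbrakk>u holomorphic_on UNIV; u 0 = 0;
      \<And>x. 0 < x \<Longrightarrow> x < 1 \<Longrightarrow> cmod (deriv u (of_real x * z)) \<le> B * ((1 + \<psi>' (x * cmod z)) * exp (1 / 2 * \<psi> (x * cmod z)))\<rbrakk>
      \<Longrightarrow> 0 \<le> B \<Longrightarrow> cmod (u z) \<le> L * B * exp (1 / 2 * \<psi> (cmod z))"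
    using ray_bound[of "1 / 2"] by auto
  obtain A where A: "0 < A"
    and dom: "\<And>z x0. \<lbrakk>0 \<le> x0; x0 \<le> 1; 1 \<le> cmod (of_real x0 * z)\<rbrakk> \<Longrightarrow>
      ennreal (symbol_density q g (of_real x0 * z) * exp (q / 2 * radial \<psi> (of_real x0 * z)))
        \<le> ennreal A * (\<integral>\<^sup>+x\<in>{0<..1}. ray_density q g (of_real x * z) * ennreal (cmod z) \<partial>lborel)"
    by (rule ray_density_dominates[OF q g]) blast
  \<comment> \<open>The factor \<open>exp (radial \<psi>)\<close> that bounds \<open>f\<close> is
    halved: one half goes into \<open>Q\<close>, whose maximum along the ray is taken out, the other
    is integrated by \<open>ray_bound\<close> with exponent \<open>1 / 2\<close>. After
    multiplication by the weight, \<open>exp (- (q / 2 * radial \<psi> z))\<close> remains.\<close>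
  define Q where "Q w = cmod (deriv g w) / slope w * exp (1 / 2 * radial \<psi> w)" for w
  have Qp: "Q w powr q = symbol_density q g w * exp (q / 2 * radial \<psi> w)" for w
  proof -
    have "Q w powr q = (cmod (deriv g w) / slope w) powr q * exp (1 / 2 * radial \<psi> w) powr q"
      unfolding Q_def by (rule powr_mult)
    then show ?thesis by (simp add: symbol_density_def exp_powr_real mult.commute)
  qed
  have Qcont: "continuous_on UNIV Q"
    unfolding Q_def slope_def
    by (intro continuous_intros holomorphic_on_imp_continuous_on holomorphic_deriv[OF g] continuous_weight continuous_on_radial_psi')
      (use slope_pos in \<open>auto simp: slope_def less_imp_neq[symmetric]\<close>)
  have "compact (Q ` cball 0 1)"
    by (intro compact_continuous_image continuous_on_subset[OF Qcont]) auto
  then obtain G where G: "0 < G" "\<And>x. x \<in> Q ` cball 0 1 \<Longrightarrow> norm x \<le> G"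
    using compact_imp_bounded bounded_pos by metis
  let ?J = "\<lambda>z. \<integral>\<^sup>+x\<in>{0<..1}. ray_density q g (of_real x * z) * ennreal (cmod z) \<partial>lborel"
  have Jm [measurable]: "?J \<in> borel_measurable borel"
  proof -
    have "?J \<in> borel_measurable lborel"
      by (rule lborel.borel_measurable_nn_integral) measurable
    then show ?thesis by simp
  qed
  \<comment> \<open>The first summand serves rays on which the maximum of \<open>Q\<close> is
    attained inside the unit disc, the second all others.\<close>
  define W where "W z = ennreal (L powr q * G powr q) * ennreal (exp (- (q / 2 * radial \<psi> z))) + ennreal (L powr q * A) * (?J z * ennreal (exp (- (q / 2 * radial \<psi> z))))" for z
  show ?thesis
  proof (rule that)
    show "W \<in> borel_measurable borel" unfolding W_def [abs_def] by measurable
    obtain A0 where A0: "0 < A0" and dec: "\<And>s. 0 \<le> s \<Longrightarrow> exp (- (q / 2 * \<psi> s)) \<le> A0 / (1 + s)^4"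
      using weight_decay[of "q / 2"] q by auto
    obtain B where B: "0 < B" and bump: "\<And>(a::complex) \<kappa>. 0 < \<kappa> \<Longrightarrow> (\<integral>\<^sup>+z. ennreal (1 / (1 + dist a z / \<kappa>)^4) \<partial>lborel) \<le> ennreal (B * \<kappa>^2)"
      by (rule nn_integral_bump) blast
    have "(\<integral>\<^sup>+z. ennreal (exp (- (q / 2 * radial \<psi> z))) \<partial>lborel) \<le> (\<integral>\<^sup>+z. ennreal A0 * ennreal (1 / (1 + dist (0::complex) z / 1)^4) \<partial>lborel)"
      using dec A0 by (intro nn_integral_mono) (auto simp: radial_def dist_norm intro!: ennreal_leI simp flip: ennreal_mult'')
    also have "\<dots> = ennreal A0 * (\<integral>\<^sup>+z. ennreal (1 / (1 + dist (0::complex) z / 1)^4) \<partial>lborel)"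
      by (rule nn_integral_cmult) measurable
    also have "\<dots> \<le> ennreal A0 * ennreal (B * 1^2)" by (intro mult_left_mono bump) auto
    also have "\<dots> < \<infinity>" by (simp add: ennreal_mult_less_top)
    finally have e: "(\<integral>\<^sup>+z. ennreal (exp (- (q / 2 * radial \<psi> z))) \<partial>lborel) < \<infinity>" .
    have "(\<integral>\<^sup>+z. W z \<partial>lborel) = ennreal (L powr q * G powr q) * (\<integral>\<^sup>+z. ennreal (exp (- (q / 2 * radial \<psi> z))) \<partial>lborel)
        + ennreal (L powr q * A) * (\<integral>\<^sup>+z. ?J z * ennreal (exp (- (q / 2 * radial \<psi> z))) \<partial>lborel)"
      unfolding W_def by (subst nn_integral_add, measurable, subst nn_integral_cmult, measurable, subst nn_integral_cmult, measurable)
    then show "(\<integral>\<^sup>+z. W z \<partial>lborel) < \<infinity>"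
      using e nn_integral_ray_density[OF q g fin] by (simp add: ennreal_mult_less_top)
    fix f z assume f: "f \<in> fock_space \<psi> \<infinity>"
    have hf: "f holomorphic_on UNIV" by (rule fock_space_holomorphic[OF f])
    have N: "0 \<le> fock_norm \<psi> \<infinity> f" by (rule fock_norm_nonneg[OF f])
    have "continuous_on {0..1} (\<lambda>x::real. Q (of_real x * z))"
      by (rule continuous_on_compose2[OF Qcont]) (auto intro!: continuous_intros)
    then obtain x0 where x0: "0 \<le> x0" "x0 \<le> 1" and max: "\<And>x. 0 \<le> x \<Longrightarrow> x \<le> 1 \<Longrightarrow> Q (of_real x * z) \<le> Q (of_real x0 * z)"
      using continuous_attains_sup[of "{0..1::real}" "\<lambda>x. Q (of_real x * z)"] by auto
    define w0 where "w0 = of_real x0 * z"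
    have Q0: "0 \<le> Q w" for w using slope_pos[of w] by (simp add: Q_def)
    have "cmod (volterra g f z) \<le> L * (fock_norm \<psi> \<infinity> f * Q w0) * exp (1 / 2 * \<psi> (cmod z))"
    proof (rule ray[OF holomorphic_on_volterra[OF hf g] volterra_0])
      show "0 \<le> fock_norm \<psi> \<infinity> f * Q w0" using N Q0 by simp
      fix x :: real assume x: "0 < x" "x < 1"
      let ?w = "of_real x * z"
      have nw: "cmod ?w = x * cmod z" using x by (simp add: norm_mult)
      have "cmod (deriv (volterra g f) ?w) \<le> fock_norm \<psi> \<infinity> f * exp (radial \<psi> ?w) * cmod (deriv g ?w)"
        unfolding deriv_volterra[OF hf g] norm_mult[of "f ?w"] using fock_norm_infinity_bound[OF f] by (intro mult_right_mono) auto
      also have "\<dots> = fock_norm \<psi> \<infinity> f * Q ?w * (slope ?w * exp (1 / 2 * radial \<psi> ?w))"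
      proof -
        have "exp (radial \<psi> ?w) = exp (1 / 2 * radial \<psi> ?w) * exp (1 / 2 * radial \<psi> ?w)" by (simp flip: exp_add)
        then show ?thesis using slope_pos[of ?w] by (simp add: Q_def)
      qed
      also have "\<dots> \<le> fock_norm \<psi> \<infinity> f * Q w0 * (slope ?w * exp (1 / 2 * radial \<psi> ?w))"
        unfolding w0_def using max[of x] x N slope_pos[of ?w] by (intro mult_right_mono mult_left_mono) auto
      finally show "cmod (deriv (volterra g f) ?w) \<le> fock_norm \<psi> \<infinity> f * Q w0 * ((1 + \<psi>' (x * cmod z)) * exp (1 / 2 * \<psi> (x * cmod z)))"
        by (simp only: slope_def radial_def nw)
    qed
    then have "cmod (volterra g f z) powr q \<le> (L * (fock_norm \<psi> \<infinity> f * Q w0) * exp (1 / 2 * \<psi> (cmod z))) powr q"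
      using q by (intro powr_mono2) auto
    also have "\<dots> = L powr q * (fock_norm \<psi> \<infinity> f powr q * Q w0 powr q) * exp (q / 2 * radial \<psi> z)"
      using L N Q0[of w0] by (simp add: powr_mult exp_powr_real radial_def)
    finally have "fock_density q (volterra g f) z \<le> (L powr q * (fock_norm \<psi> \<infinity> f powr q * Q w0 powr q) * exp (q / 2 * radial \<psi> z)) * exp (- (q * radial \<psi> z))"
      by (rule mult_right_mono) simp
    also have "\<dots> = fock_norm \<psi> \<infinity> f powr q * (L powr q * Q w0 powr q * exp (- (q / 2 * radial \<psi> z)))"
    proof -
      have "exp (- (q / 2 * radial \<psi> z)) = exp (q / 2 * radial \<psi> z) * exp (- (q * radial \<psi> z))" by (simp flip: exp_add)
      then show ?thesis by (simp add: mult_ac)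
    qed
    finally have "ennreal (fock_density q (volterra g f) z) \<le> ennreal (fock_norm \<psi> \<infinity> f powr q * (L powr q * Q w0 powr q * exp (- (q / 2 * radial \<psi> z))))"
      by (rule ennreal_leI)
    also have "\<dots> = ennreal (fock_norm \<psi> \<infinity> f powr q) * (ennreal (L powr q * Q w0 powr q) * ennreal (exp (- (q / 2 * radial \<psi> z))))"
      by (simp add: ennreal_mult)
    also have "\<dots> \<le> ennreal (fock_norm \<psi> \<infinity> f powr q) * W z"
    proof (rule mult_left_mono)
      show "ennreal (L powr q * Q w0 powr q) * ennreal (exp (- (q / 2 * radial \<psi> z))) \<le> W z"
      proof (cases "1 \<le> cmod w0")
        case False
        then have "Q w0 \<le> G" using G(2)[of "Q w0"] Q0[of w0] by auto
        then have "Q w0 powr q \<le> G powr q" using q Q0 by (intro powr_mono2) auto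
        then have "ennreal (L powr q * Q w0 powr q) * ennreal (exp (- (q / 2 * radial \<psi> z))) \<le> ennreal (L powr q * G powr q) * ennreal (exp (- (q / 2 * radial \<psi> z)))"
          by (intro mult_right_mono ennreal_leI mult_left_mono) auto
        also have "\<dots> \<le> W z" by (simp add: W_def)
        finally show ?thesis .
      next
        case True
        have "ennreal (L powr q * Q w0 powr q) * ennreal (exp (- (q / 2 * radial \<psi> z)))
            = ennreal (L powr q) * ennreal (Q w0 powr q) * ennreal (exp (- (q / 2 * radial \<psi> z)))"
          by (simp add: ennreal_mult)
        also have "\<dots> \<le> ennreal (L powr q) * (ennreal A * ?J z) * ennreal (exp (- (q / 2 * radial \<psi> z)))"
          using dom[OF x0, of z] True unfolding Qp w0_def by (intro mult_right_mono mult_left_mono) auto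
        also have "\<dots> = ennreal (L powr q * A) * (?J z * ennreal (exp (- (q / 2 * radial \<psi> z))))"
          using A by (simp add: ennreal_mult mult.assoc)
        also have "\<dots> \<le> W z" by (simp add: W_def)
        finally show ?thesis .
      qed
    qed simp
    finally show "ennreal (fock_density q (volterra g f) z) \<le> ennreal (fock_norm \<psi> \<infinity> f powr q) * W z" .
  qed
qed

end

section \<open>Functions comparable with the weight\<close>

text \<open>Subtraction on \<open>nat\<close> is truncated, so \<open>(l - l0) + (l0 - l)\<close> is
  the distance of the two indices.\<close>

lemma two_sided_geometric:
  fixes Q :: real and l0 :: nat
  assumes Q: "0 \<le> Q" "Q < 1"
  shows "summable (\<lambda>l. if l = l0 then 0 else Q ^ ((l - l0) + (l0 - l)))"
    and "(\<Sum>l. if l = l0 then 0 else Q ^ ((l - l0) + (l0 - l))) \<le> 2 * Q / (1 - Q)"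
proof -
  let ?f = "\<lambda>l. if l = l0 then 0 else Q ^ ((l - l0) + (l0 - l))"
  have "(\<lambda>l. Q * Q ^ l) sums (Q * (1 / (1 - Q)))"
    using Q by (intro sums_mult geometric_sums) simp
  moreover have "?f (l + Suc l0) = Q * Q ^ l" for l
  proof -
    have "(l + Suc l0 - l0) + (l0 - (l + Suc l0)) = Suc l" by simp
    then show ?thesis by simp
  qed
  ultimately have "(\<lambda>l. ?f (l + Suc l0)) sums (Q / (1 - Q))" by simp
  then have s: "?f sums (Q / (1 - Q) + sum ?f {..<Suc l0})"
    by (rule sums_iff_shift[of ?f "Suc l0" "Q / (1 - Q)", THEN iffD1])
  then show "summable ?f" by (rule sums_summable)
  have "sum ?f {..<Suc l0} = (\<Sum>l<l0. Q * Q ^ (l0 - Suc l))"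
  proof -
    have "?f l = Q * Q ^ (l0 - Suc l)" if "l < l0" for l
    proof -
      have "(l - l0) + (l0 - l) = Suc (l0 - Suc l)" using that by simp
      then show ?thesis using that by simp
    qed
    then show ?thesis by (auto intro: sum.cong)
  qed
  also have "\<dots> = (\<Sum>l<l0. Q * Q ^ l)"
    by (rule sum.nat_diff_reindex)
  also have "\<dots> \<le> (\<Sum>l. Q * Q ^ l)"
    using Q by (intro sum_le_suminf) (auto intro: summable_mult summable_geometric)
  also have "\<dots> = Q / (1 - Q)"
    using Q by (subst suminf_mult) (auto simp: suminf_geometric)
  finally have "Q / (1 - Q) + sum ?f {..<Suc l0} \<le> 2 * Q / (1 - Q)" by simp
  then show "(\<Sum>l. ?f l) \<le> 2 * Q / (1 - Q)" using sums_unique[OF s] by simp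
qed

context scaled_weight
begin

text \<open>The radii \<open>s j\<close> are one \<open>\<tau>\<close>-step apart. The monomial that peaks on the circle of radius \<open>s j\<close>
  then loses a fixed factor against the weight with every step away from this circle.\<close>

lemma peaking_monomials:
  obtains s :: "nat \<Rightarrow> real" and n :: "nat \<Rightarrow> nat"
  where "\<And>j. 0 < s j" "strict_mono s" "filterlim s at_top sequentially"
    and "\<And>j k \<rho>. \<lbrakk>s k \<le> \<rho>; \<rho> \<le> s (Suc k)\<rbrakk> \<Longrightarrow>
      exp (\<psi> (s j)) * (\<rho> / s j) ^ n j \<le> exp 2 * exp (- (c / 4)) ^ ((j - k) + (k - j)) * exp (\<psi> \<rho>)"
    and "\<And>k \<rho>. \<lbrakk>s k \<le> \<rho>; \<rho> \<le> s (Suc k)\<rbrakk> \<Longrightarrow>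
      exp (- (2 * C + 1)) * exp (\<psi> \<rho>) \<le> exp (\<psi> (s k)) * (\<rho> / s k) ^ n k"
proof -
  obtain S0 where S0: "R \<le> S0" and S0t: "\<And>r. S0 \<le> r \<Longrightarrow> \<tau> r \<le> c" using tau_eventually_le[OF c_pos] by blast
  define s where "s = rec_nat S0 (\<lambda>_ r. r + \<tau> r)"
  have s0: "s 0 = S0" and sS: "s (Suc j) = s j + \<tau> (s j)" for j by (simp_all add: s_def)
  have sge: "S0 \<le> s j" for j
  proof (induction j)
    case (Suc j)
    then have "0 < \<tau> (s j)" using S0 by (intro tau_pos') simp
    then show ?case using Suc by (simp add: sS)
  qed (simp add: s0)
  have sR: "R \<le> s j" "2 \<le> s j" "0 < s j" for j using sge[of j] S0 R_ge by auto
  have t: "0 < \<tau> (s j)" "\<tau> (s j) \<le> 1 / 2" "\<tau> (s j) \<le> c" for j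
    using tau_pos'[OF sR(1)] tau_le[OF sR(1)] S0t[OF sge] by auto
  have sm: "strict_mono s" using t(1) by (simp add: strict_mono_Suc_iff sS)
  have smono: "s i \<le> s j" if "i \<le> j" for i j using that sm by (simp add: strict_mono_less_eq)
  \<comment> \<open>A bounded increasing sequence of radii would converge, and its step lengths
    \<open>\<tau> (s j)\<close> would tend both to 0 and to the positive value of
    \<open>\<tau>\<close> at the limit.\<close>
  have unb: "\<exists>j. B \<le> s j" for B
  proof (rule ccontr)
    assume "\<nexists>j. B \<le> s j"
    then have "\<And>j. s j \<le> B" by (simp add: not_le less_imp_le)
    then obtain l where l: "s \<longlonglongrightarrow> l"
      using incseq_convergent[of s B] strict_mono_mono[OF sm] by blast
    have "0 < l" using LIMSEQ_le_const[OF l, of S0] sge S0 R_ge by fastforce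
    then have "isCont \<tau> l" using tau_has_derivative DERIV_isCont by blast
    then have "(\<lambda>j. \<tau> (s j)) \<longlonglongrightarrow> \<tau> l" using l by (rule isCont_tendsto_compose)
    moreover have "(\<lambda>j. s (Suc j) - s j) \<longlonglongrightarrow> l - l" using l by (intro tendsto_diff LIMSEQ_Suc)
    ultimately have "\<tau> l = 0" using LIMSEQ_unique by (fastforce simp: sS)
    then show False using tau_positive[of l] \<open>0 < l\<close> by simp
  qed
  have lim: "filterlim s at_top sequentially"
    unfolding filterlim_at_top eventually_sequentially using unb smono by (meson order_trans)
  define n where "n j = nat \<lfloor>mom (s j)\<rfloor>" for j
  have n: "real (n j) \<le> mom (s j)" "mom (s j) \<le> real (n j) + 1" for j
  proof -
    have "0 \<le> mom (s j)" using mom_nonneg[of "s j"] sR(3)[of j] by simp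
    then have "real (n j) = of_int \<lfloor>mom (s j)\<rfloor>" by (simp add: n_def)
    then show "real (n j) \<le> mom (s j)" "mom (s j) \<le> real (n j) + 1" by linarith+
  qed
  \<comment> \<open>\<open>gap\<close> corrected for rounding the degree down: the monomial divided
    by the weight is exactly \<open>exp (- E)\<close>. Outside the circle the correction helps,
    inside it hurts.\<close>
  define E where "E j \<rho> = gap (s j) \<rho> + (mom (s j) - real (n j)) * ln (\<rho> / s j)" for j \<rho>
  have term_eq: "exp (\<psi> (s j)) * (\<rho> / s j) ^ n j = exp (- E j \<rho>) * exp (\<psi> \<rho>)" if \<rho>: "0 < \<rho>" for j \<rho>
  proof -
    have "(\<rho> / s j) ^ n j = exp (real (n j) * ln (\<rho> / s j))"
      using \<rho> sR(3)[of j] by (simp add: exp_of_nat_mult)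
    moreover have "\<psi> (s j) + real (n j) * ln (\<rho> / s j) = - E j \<rho> + \<psi> \<rho>"
      by (simp add: E_def gap_def algebra_simps)
    ultimately show ?thesis by (simp only: exp_add[symmetric])
  qed
  have step_t: "\<tau> (s i) / 2 \<le> \<tau> (s (Suc i))" "\<tau> (s (Suc i)) \<le> 2 * \<tau> (s i)" for i
    using tau_lower[OF sR(1), of "s (Suc i)" i] tau_upper[OF sR(1), of "s (Suc i)" i] t(1)[of i] by (auto simp: sS)
  have ln_step: "\<tau> (s i) / s (Suc i) \<le> ln (s (Suc i) / s i)" "ln (s (Suc i) / s i) \<le> \<tau> (s i) / s i" "\<tau> (s i) / s i \<le> 1" for i
  proof -
    have "ln (s i / s (Suc i)) \<le> s i / s (Suc i) - 1" using sR(3)[of i] sR(3)[of "Suc i"] by (intro ln_le_minus_one) simp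
    moreover have "s i / s (Suc i) - 1 = - (\<tau> (s i) / s (Suc i))" using sR(3)[of "Suc i"] by (simp add: sS field_simps)
    ultimately show "\<tau> (s i) / s (Suc i) \<le> ln (s (Suc i) / s i)" using sR(3)[of i] sR(3)[of "Suc i"] by (simp add: ln_div)
    have "ln (s (Suc i) / s i) \<le> s (Suc i) / s i - 1" using sR(3)[of i] sR(3)[of "Suc i"] by (intro ln_le_minus_one) simp
    moreover have "s (Suc i) / s i - 1 = \<tau> (s i) / s i" using sR(3)[of i] by (simp add: sS field_simps)
    ultimately show "ln (s (Suc i) / s i) \<le> \<tau> (s i) / s i" by simp
    show "\<tau> (s i) / s i \<le> 1" using t[of i] sR[of i] by simp
  qed
  \<comment> \<open>The growth of \<open>mom\<close> over the step at \<open>s i\<close> is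
    available as slope only from \<open>s (Suc i)\<close> on, hence the shifted indices. One step in
    the logarithm is at least a quarter of \<open>\<tau> (s i) / s i\<close>.\<close>
  have up_step: "c / 4 \<le> (c * s i / \<tau> (s i)) * ln (s (Suc (Suc i)) / s (Suc i))" for i
  proof -
    have "s (Suc (Suc i)) \<le> 2 * s i" using t[of i] t[of "Suc i"] sR[of i] by (simp add: sS)
    then have "1 / 4 * (\<tau> (s i) / s i) \<le> (\<tau> (s i) / 2) / s (Suc (Suc i))"
      using t[of i] sR[of i] sR[of "Suc (Suc i)"] by (simp add: field_simps)
    also have "\<dots> \<le> \<tau> (s (Suc i)) / s (Suc (Suc i))"
      using step_t[of i] sR[of "Suc (Suc i)"] by (intro divide_right_mono) auto
    also have "\<dots> \<le> ln (s (Suc (Suc i)) / s (Suc i))" by (rule ln_step)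
    finally have "(c * s i / \<tau> (s i)) * (1 / 4 * (\<tau> (s i) / s i)) \<le> (c * s i / \<tau> (s i)) * ln (s (Suc (Suc i)) / s (Suc i))"
      using c_pos sR[of i] t[of i] by (intro mult_left_mono) auto
    then show ?thesis using sR[of i] t[of i] by simp
  qed
  have gap_up: "c / 4 * real d \<le> gap (s j) (s (Suc (j + d)))" for j d
  proof (induction d)
    case 0
    show ?case using gap_nonneg[OF sR(3) sR(3)] by simp
  next
    case (Suc d)
    let ?i = "j + d"
    have "gap (s j) (s (Suc ?i)) + (c * s ?i / \<tau> (s ?i)) * ln (s (Suc (Suc ?i)) / s (Suc ?i)) \<le> gap (s j) (s (Suc (Suc ?i)))"
    proof (rule gap_minus_log_mono)
      fix x assume x: "s (Suc ?i) \<le> x"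
      have "mom (s j) \<le> mom (s ?i)" using sR(3)[of j] smono[of j ?i] by (intro mom_mono) auto
      moreover have "mom (s (Suc ?i)) \<le> mom x" using sR(3)[of "Suc ?i"] x by (intro mom_mono) auto
      ultimately show "c * s ?i / \<tau> (s ?i) \<le> mom x - mom (s j)" using mom_step_up[OF sR(1)[of ?i]] by (simp add: sS)
    qed (use sR(3) smono in auto)
    moreover have "c / 4 * real (Suc d) = c / 4 * real d + c / 4" by (simp add: algebra_simps)
    ultimately show ?case unfolding add_Suc_right using Suc up_step[of ?i] by linarith
  qed
  have E_up: "c / 4 * real (k - j) - 2 \<le> E j \<rho>" if jk: "j \<le> k" and \<rho>: "s k \<le> \<rho>" for j k \<rho>
  proof -
    have p: "0 < \<rho>" "s j \<le> \<rho>" using \<rho> sR(3)[of k] smono[OF jk] by auto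
    have "0 \<le> (mom (s j) - real (n j)) * ln (\<rho> / s j)"
      using n(1)[of j] p sR(3)[of j] by (intro mult_nonneg_nonneg) auto
    then have E: "gap (s j) \<rho> \<le> E j \<rho>" by (simp add: E_def)
    show ?thesis
    proof (cases "k = j")
      case True
      then show ?thesis using E gap_nonneg[OF sR(3) p(1), of j] by simp
    next
      case False
      then obtain d where d: "k = Suc (j + d)" using jk by (metis add_Suc_right le_neq_implies_less less_imp_Suc_add)
      have "gap (s j) (s k) + 0 * ln (\<rho> / s k) \<le> gap (s j) \<rho>"
      proof (rule gap_minus_log_mono)
        fix x assume x: "s k \<le> x"
        then have "s j \<le> x" using smono[OF jk] by simp
        then show "0 \<le> mom x - mom (s j)" using sR(3)[of j] mom_mono[of "s j" x] by simp
      qed (use sR(3) \<rho> in auto)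
      then have "c / 4 * real d \<le> E j \<rho>" using gap_up[of d j] d E by simp
      moreover have "c / 4 * real (k - j) = c / 4 * real d + c / 4" by (simp add: d algebra_simps)
      ultimately show ?thesis using c_le by linarith
    qed
  qed
  \<comment> \<open>The subtracted 1 is the rounding of the degree, which works against the decay
    towards the origin. As \<open>\<tau> \<le> c\<close> and the radii are at least 2, the slope is
    at least 2, so half of it survives.\<close>
  have dn_step: "c / 4 \<le> (c * s (Suc i) / \<tau> (s (Suc i)) - 1) * ln (s (Suc i) / s i)" for i
  proof -
    have "2 * \<tau> (s (Suc i)) \<le> c * s (Suc i)"
      using mult_mono[OF sR(2)[of "Suc i"] t(3)[of "Suc i"]] t[of "Suc i"] sR[of "Suc i"] by (simp add: mult.commute)
    then have "2 \<le> c * s (Suc i) / \<tau> (s (Suc i))" using t[of "Suc i"] by (simp add: field_simps)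
    moreover have "x / 2 \<le> x - 1 \<and> 0 \<le> x - 1" if "2 \<le> x" for x :: real using that by simp
    ultimately have a: "c * s (Suc i) / \<tau> (s (Suc i)) / 2 \<le> c * s (Suc i) / \<tau> (s (Suc i)) - 1"
      "0 \<le> c * s (Suc i) / \<tau> (s (Suc i)) - 1" by blast+
    have "c / 4 \<le> c * s (Suc i) / \<tau> (s (Suc i)) / 2 * (\<tau> (s i) / s (Suc i))"
      using step_t(2)[of i] t[of "Suc i"] sR(3)[of "Suc i"] c_pos by (simp add: field_simps)
    also have "\<dots> \<le> (c * s (Suc i) / \<tau> (s (Suc i)) - 1) * ln (s (Suc i) / s i)"
      by (rule mult_mono[OF a(1) ln_step(1) a(2)]) (use t(1)[of i] sR(3)[of "Suc i"] in simp)
    finally show ?thesis .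
  qed
  \<comment> \<open>A lower bound for \<open>E\<close> inside the peak circle, with the rounding at
    its worst case.\<close>
  define G where "G j \<rho> = gap (s j) \<rho> - ln (s j / \<rho>)" for j \<rho>
  have GE: "G j \<rho> \<le> E j \<rho>" if "0 < \<rho>" "\<rho> \<le> s j" for j \<rho>
  proof -
    have "(mom (s j) - real (n j)) * ln (s j / \<rho>) \<le> 1 * ln (s j / \<rho>)"
      using n(2)[of j] that by (intro mult_right_mono) auto
    moreover have "ln (\<rho> / s j) = - ln (s j / \<rho>)" using that sR(3)[of j] by (simp add: ln_div)
    ultimately show ?thesis by (simp add: G_def E_def)
  qed
  have G_mono: "G j y + (k - 1) * ln (y / x) \<le> G j x"
    if "0 < x" "x \<le> y" "mom y - mom (s j) \<le> - k" for j x y k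
  proof -
    have "gap (s j) y + k * ln (y / x) \<le> gap (s j) x"
    proof (rule gap_minus_log_antimono)
      fix v assume "x \<le> v" "v \<le> y"
      then show "mom v - mom (s j) \<le> - k" using that mom_mono[of v y] by simp
    qed (use that sR(3) in auto)
    moreover have "ln (s j / x) = ln (s j / y) + ln (y / x)" using that sR(3)[of j] by (simp add: ln_div)
    ultimately show ?thesis by (simp add: G_def algebra_simps)
  qed
  have mom_dn: "mom (s i) - mom (s j) \<le> - (c * s i / \<tau> (s i))" if "i < j" for i j
  proof -
    have "mom (s (Suc i)) \<le> mom (s j)" using that sR(3)[of "Suc i"] smono[of "Suc i" j] by (intro mom_mono) auto
    then show ?thesis using mom_step_up[OF sR(1)[of i]] by (simp add: sS)
  qed
  have G_dn: "c / 4 * real d - 1 \<le> G (Suc (i + d)) (s i)" for i d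
  proof (induction d arbitrary: i)
    case 0
    show ?case using gap_nonneg[OF sR(3)[of "Suc i"] sR(3)[of i]] ln_step(2,3)[of i] by (simp add: G_def)
  next
    case (Suc d)
    let ?j = "Suc (i + Suc d)"
    have "G ?j (s (Suc i)) + (c * s (Suc i) / \<tau> (s (Suc i)) - 1) * ln (s (Suc i) / s i) \<le> G ?j (s i)"
      using sR(3)[of i] smono[of i "Suc i"] by (intro G_mono mom_dn) auto
    moreover have "c / 4 * real d - 1 \<le> G ?j (s (Suc i))" using Suc[of "Suc i"] by simp
    ultimately show ?case using dn_step[of i] by (simp add: algebra_simps)
  qed
  have E_dn: "c / 4 * real (j - k) - 2 \<le> E j \<rho>" if jk: "k < j" and \<rho>: "s k \<le> \<rho>" "\<rho> \<le> s (Suc k)" for j k \<rho>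
  proof -
    have p: "0 < \<rho>" "\<rho> \<le> s j" using \<rho> sR(3)[of k] smono[of "Suc k" j] jk by auto
    have "c / 4 * real (j - k) - 2 \<le> G j \<rho>"
    proof (cases "j = Suc k")
      case True
      have "ln (s j / \<rho>) \<le> ln (s (Suc k) / s k)"
        using p \<rho> sR(3)[of k] sR(3)[of j] True by (simp add: frac_le)
      also have "\<dots> \<le> 1" using ln_step(2,3)[of k] by simp
      finally show ?thesis using gap_nonneg[OF sR(3) p(1), of j] True c_le by (simp add: G_def)
    next
      case False
      then obtain d where d: "j = Suc (Suc k + d)" using jk by (metis Suc_leI add_Suc_right le_neq_implies_less less_imp_Suc_add)
      have kk: "1 \<le> c * s (Suc k) / \<tau> (s (Suc k))"
      proof -
        have "1 * \<tau> (s (Suc k)) \<le> s (Suc k) * c"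
          using t[of "Suc k"] sR[of "Suc k"] by (intro mult_mono) auto
        then show ?thesis using t[of "Suc k"] by (simp add: field_simps)
      qed
      have "G j (s (Suc k)) + (c * s (Suc k) / \<tau> (s (Suc k)) - 1) * ln (s (Suc k) / \<rho>) \<le> G j \<rho>"
        using d p \<rho> by (intro G_mono mom_dn) auto
      moreover have "0 \<le> (c * s (Suc k) / \<tau> (s (Suc k)) - 1) * ln (s (Suc k) / \<rho>)"
        using kk p \<rho> by (intro mult_nonneg_nonneg) auto
      moreover have "c / 4 * real d - 1 \<le> G j (s (Suc k))" using G_dn[of d "Suc k"] d by simp
      moreover have "c / 4 * real (j - k) = c / 4 * real d + c / 2" by (simp add: d algebra_simps)
      ultimately show ?thesis using c_le by linarith
    qed
    then show ?thesis using GE[OF p] by simp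
  qed
  show ?thesis
  proof (rule that[OF sR(3) sm lim])
    fix j k \<rho> assume \<rho>: "s k \<le> \<rho>" "\<rho> \<le> s (Suc k)"
    then have p: "0 < \<rho>" using sR(3)[of k] by simp
    have "c / 4 * real ((j - k) + (k - j)) - 2 \<le> E j \<rho>"
      using E_up[of j k \<rho>] E_dn[of k j \<rho>] \<rho> by (cases "j \<le> k") auto
    then have "exp (- E j \<rho>) \<le> exp (2 + real ((j - k) + (k - j)) * (- (c / 4)))" by (simp add: mult.commute)
    also have "\<dots> = exp 2 * exp (- (c / 4)) ^ ((j - k) + (k - j))" unfolding exp_add exp_of_nat_mult ..
    finally show "exp (\<psi> (s j)) * (\<rho> / s j) ^ n j \<le> exp 2 * exp (- (c / 4)) ^ ((j - k) + (k - j)) * exp (\<psi> \<rho>)"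
      unfolding term_eq[OF p] by (rule mult_right_mono) simp
  next
    fix k \<rho> assume \<rho>: "s k \<le> \<rho>" "\<rho> \<le> s (Suc k)"
    then have p: "0 < \<rho>" using sR(3)[of k] by simp
    have "gap (s k) \<rho> \<le> 2 * C" using \<rho> t(1)[of k] by (intro gap_upper[OF sR(1)]) (auto simp: sS)
    moreover have "(mom (s k) - real (n k)) * ln (\<rho> / s k) \<le> 1 * 1"
    proof (rule mult_mono)
      have "ln (\<rho> / s k) \<le> ln (s (Suc k) / s k)" using p \<rho> sR(3)[of k] by (simp add: divide_right_mono)
      then show "ln (\<rho> / s k) \<le> 1" using ln_step(2,3)[of k] by simp
    qed (use n[of k] p \<rho> sR(3)[of k] in auto)
    ultimately have "- (2 * C + 1) \<le> - E k \<rho>" by (simp add: E_def)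
    then have "exp (- (2 * C + 1)) \<le> exp (- E k \<rho>)" by (subst exp_le_cancel_iff)
    then show "exp (- (2 * C + 1)) * exp (\<psi> \<rho>) \<le> exp (\<psi> (s k)) * (\<rho> / s k) ^ n k"
      unfolding term_eq[OF p] by (rule mult_right_mono) simp
  qed
qed

text \<open>Summing only every \<open>M\<close>-th monomial makes one term dominate near its circle; the \<open>M\<close> residue classes
  together cover all circles.\<close>

lemma frame_functions:
  obtains M :: nat and fs :: "nat \<Rightarrow> complex \<Rightarrow> complex" and \<epsilon> S :: real
  where "0 < \<epsilon>" "\<And>i. i < M \<Longrightarrow> fs i \<in> fock_space \<psi> \<infinity>"
    and "\<And>z. S \<le> cmod z \<Longrightarrow> \<exists>i<M. \<epsilon> * exp (radial \<psi> z) \<le> cmod (fs i z)"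
proof (rule peaking_monomials)
  fix s :: "nat \<Rightarrow> real" and n :: "nat \<Rightarrow> nat"
  assume sp: "\<And>j. 0 < s j" and sm: "strict_mono s" and lim: "filterlim s at_top sequentially"
    and up: "\<And>j k \<rho>. \<lbrakk>s k \<le> \<rho>; \<rho> \<le> s (Suc k)\<rbrakk> \<Longrightarrow>
      exp (\<psi> (s j)) * (\<rho> / s j) ^ n j \<le> exp 2 * exp (- (c / 4)) ^ ((j - k) + (k - j)) * exp (\<psi> \<rho>)"
    and low: "\<And>k \<rho>. \<lbrakk>s k \<le> \<rho>; \<rho> \<le> s (Suc k)\<rbrakk> \<Longrightarrow>
      exp (- (2 * C + 1)) * exp (\<psi> \<rho>) \<le> exp (\<psi> (s k)) * (\<rho> / s k) ^ n k"
  define b where "b = exp (- (c / 4))"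
  have b: "0 < b" "b < 1" using c_pos by (auto simp: b_def)
  define e0 where "e0 = exp (- (2 * C + 1))"
  have e0: "0 < e0" by (simp add: e0_def)
  have smono: "s i \<le> s j" if "i \<le> j" for i j using that sm by (simp add: strict_mono_less_eq)
  define t where "t j z = of_real (exp (\<psi> (s j))) * (z / of_real (s j)) ^ n j" for j and z :: complex
  have nt: "cmod (t j z) = exp (\<psi> (s j)) * (cmod z / s j) ^ n j" for j z
    using sp[of j] by (simp add: t_def norm_mult norm_power norm_divide)
  have index: "\<exists>k. s k \<le> \<rho> \<and> \<rho> \<le> s (Suc k)" if \<rho>: "s 0 \<le> \<rho>" for \<rho>
  proof -
    have "\<exists>N. \<rho> < s N"
      using filterlim_at_top_dense[THEN iffD1, OF lim] by (metis eventually_sequentially order_refl)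
    then obtain N where N: "\<rho> < s N" by blast
    define k where "k = (LEAST N. \<rho> < s N)"
    have k: "\<rho> < s k" unfolding k_def by (rule LeastI[of _ N]) (rule N)
    then have "k \<noteq> 0" using \<rho> by (cases k) auto
    then obtain k' where k': "k = Suc k'" using not0_implies_Suc by blast
    have "\<not> \<rho> < s k'" using not_less_Least[of k' "\<lambda>N. \<rho> < s N"] k' k_def by simp
    then show ?thesis using k k' by (intro exI[of _ k']) auto
  qed
  \<comment> \<open>With \<open>Q = b ^ M < 1 / 2\<close> the two-sided series is at most
    \<open>4 * Q\<close>; the second bound makes \<open>exp 2 * 4 * Q\<close> at most
    \<open>e0 / 2\<close>, so the other terms consume at most half of the dominant one.\<close>
  have "(\<lambda>M. b ^ M) \<longlonglongrightarrow> 0" using b by (intro LIMSEQ_realpow_zero) auto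
  then have "\<forall>\<^sub>F M in sequentially. b ^ M < min (1 / 2) (e0 / (8 * exp 2))"
    using e0 by (intro order_tendstoD) auto
  moreover have "\<forall>\<^sub>F M in sequentially. 0 < (M::nat)" by (rule eventually_gt_at_top)
  ultimately have "\<forall>\<^sub>F M in sequentially. b ^ M < min (1 / 2) (e0 / (8 * exp 2)) \<and> 0 < M" by (rule eventually_conj)
  then obtain M where M: "b ^ M < 1 / 2" "b ^ M < e0 / (8 * exp 2)" "0 < M"
    using eventually_happens'[OF sequentially_bot] by fastforce
  define Q where "Q = b ^ M"
  have Q: "0 < Q" "Q < 1 / 2" "Q < e0 / (8 * exp 2)" using M b by (auto simp: Q_def)
  have tb: "cmod (t j z) \<le> exp 2 * b ^ ((j - k) + (k - j)) * exp (\<psi> (cmod z))"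
    if "s k \<le> cmod z" "cmod z \<le> s (Suc k)" for j k z
    using up[OF that, of j] by (simp add: nt b_def)
  have tb0: "cmod (t j z) \<le> exp 2 * b ^ ((j - k) + (k - j)) * exp (\<psi> (s k))" if "cmod z \<le> s k" for j k z
  proof -
    have "cmod (t j z) \<le> exp (\<psi> (s j)) * (s k / s j) ^ n j"
      unfolding nt using that sp[of j] by (intro mult_left_mono power_mono divide_right_mono) auto
    also have "\<dots> \<le> exp 2 * b ^ ((j - k) + (k - j)) * exp (\<psi> (s k))"
      using up[of k "s k" j] smono[of k "Suc k"] by (simp add: b_def)
    finally show ?thesis .
  qed
  \<comment> \<open>A crude comparison that loses the factor \<open>M\<close> but holds for every
    residue of \<open>k\<close>; it gives convergence and the upper bound. The exact distance is
    used only for the residue class that contains \<open>k\<close>.\<close>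
  have dist_ge: "(l - k div M) + (k div M - l) \<le> (i + l * M - k) + (k - (i + l * M))" if i: "i < M" for i l k
  proof -
    let ?q = "k div M" and ?r = "k mod M"
    have k: "k = ?q * M + ?r" and r: "?r < M" using M(3) by simp_all
    show ?thesis
    proof (cases l ?q rule: linorder_cases)
      case less
      then obtain d where d: "?q = Suc (l + d)" using less_imp_Suc_add by blast
      have "Suc d + (i + l * M) \<le> k"
      proof -
        have "d * 1 \<le> d * M" using M(3) by (intro mult_le_mono) auto
        moreover have "(l + d) * M = l * M + d * M" by (simp add: distrib_right)
        ultimately have "Suc d + (i + l * M) \<le> (l + d) * M + M" using i by linarith
        also have "\<dots> \<le> k" using k d by (simp add: distrib_right)
        finally show ?thesis .
      qed
      then show ?thesis using d by simp
    next
      case greater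
      then obtain d where d: "l = Suc (?q + d)" using less_imp_Suc_add by blast
      have "Suc d + k \<le> i + l * M"
      proof -
        have "d * 1 \<le> d * M" using M(3) by (intro mult_le_mono) auto
        then have "Suc d + k \<le> Suc (d * M) + (?q * M + ?r)" using k by linarith
        also have "\<dots> \<le> d * M + ?q * M + M" using r by linarith
        also have "\<dots> = l * M" using d by (simp add: distrib_right)
        finally show ?thesis by simp
      qed
      then show ?thesis using d by simp
    qed simp
  qed
  define D where "D l l0 = (l - l0) + (l0 - l)" for l l0 :: nat
  have Dsum: "summable (\<lambda>l. q ^ D l l0)" "(\<Sum>l. q ^ D l l0) \<le> 1 + 2 * q / (1 - q)" if "0 \<le> q" "q < 1" for q :: real and l0
  proof -
    have "(\<lambda>l. if l = l0 then (1::real) else 0) sums 1" using sums_single[of l0 "\<lambda>_. 1::real"] by simp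
    from sums_add[OF this summable_sums[OF two_sided_geometric(1)[OF that, of l0]]]
    have "(\<lambda>l. q ^ D l l0) sums (1 + (\<Sum>l. if l = l0 then 0 else q ^ ((l - l0) + (l0 - l))))"
      by (rule back_subst[of "\<lambda>f. f sums _"]) (auto simp: D_def)
    then show "summable (\<lambda>l. q ^ D l l0)" "(\<Sum>l. q ^ D l l0) \<le> 1 + 2 * q / (1 - q)"
      using two_sided_geometric(2)[OF that, of l0] by (auto simp: sums_iff)
  qed
  define f where "f i z = (\<Sum>l. t (i + l * M) z)" for i z
  have bD: "b ^ ((i + l * M - k) + (k - (i + l * M))) \<le> b ^ D l (k div M)" if "i < M" for i l k
    unfolding D_def using dist_ge[OF that, of l k] b by (intro power_decreasing) auto
  have conv0: "cmod (t (i + l * M) z) \<le> exp 2 * exp (\<psi> (s k)) * b ^ D l (k div M)" if "i < M" "cmod z \<le> s k" for i l k z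
  proof -
    have "cmod (t (i + l * M) z) \<le> exp 2 * b ^ ((i + l * M - k) + (k - (i + l * M))) * exp (\<psi> (s k))" by (rule tb0[OF that(2)])
    also have "\<dots> \<le> exp 2 * b ^ D l (k div M) * exp (\<psi> (s k))"
      using bD[OF that(1)] by (intro mult_right_mono mult_left_mono) auto
    finally show ?thesis by (simp add: mult_ac)
  qed
  have big: "\<exists>k. r \<le> s k" for r
    using filterlim_at_top[THEN iffD1, OF lim] by (metis eventually_sequentially order_refl)
  have summ: "summable (\<lambda>l. t (i + l * M) z)" if i: "i < M" for i z
  proof -
    obtain k where k: "cmod z \<le> s k" using big by blast
    show ?thesis
      by (rule summable_comparison_test'[OF summable_mult[OF Dsum(1)[of b "k div M"], of "exp 2 * exp (\<psi> (s k))"], of 0])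
        (use b conv0[OF i k] in auto)
  qed
  have hol: "f i holomorphic_on UNIV" if i: "i < M" for i
  proof (rule holomorphic_uniform_sequence[of UNIV "\<lambda>N z. \<Sum>l<N. t (i + l * M) z"])
    show "(\<lambda>z. \<Sum>l<N. t (i + l * M) z) holomorphic_on UNIV" for N
      unfolding t_def using sp by (intro holomorphic_intros) (auto simp: less_imp_neq[symmetric])
    fix x :: complex
    obtain k where k: "cmod x + 1 \<le> s k" using big by blast
    have "uniform_limit (cball x 1) (\<lambda>N z. \<Sum>l<N. t (i + l * M) z) (f i) sequentially"
      unfolding f_def
    proof (rule Weierstrass_m_test)
      show "summable (\<lambda>l. exp 2 * exp (\<psi> (s k)) * b ^ D l (k div M))"
        using b by (intro summable_mult Dsum) auto
      fix l z assume "z \<in> cball x 1"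
      then have "cmod z \<le> s k" using k norm_triangle_ineq2[of z x] by (simp add: dist_norm norm_minus_commute)
      then show "cmod (t (i + l * M) z) \<le> exp 2 * exp (\<psi> (s k)) * b ^ D l (k div M)" by (rule conv0[OF i])
    qed
    then show "\<exists>d>0. cball x d \<subseteq> UNIV \<and> uniform_limit (cball x d) (\<lambda>N z. \<Sum>l<N. t (i + l * M) z) (f i) sequentially"
      by (intro exI[of _ 1]) auto
  qed simp
  have f_le: "cmod (f i z) \<le> X * (1 + 2 * b / (1 - b))" if i: "i < M" and X: "0 \<le> X"
    and bd: "\<And>l. cmod (t (i + l * M) z) \<le> X * b ^ D l l0" for i z X l0
  proof -
    have sN: "summable (\<lambda>l. X * b ^ D l l0)" using b by (intro summable_mult Dsum) auto
    have "cmod (f i z) \<le> (\<Sum>l. X * b ^ D l l0)"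
      unfolding f_def by (rule norm_suminf_le[OF bd sN])
    also have "\<dots> = X * (\<Sum>l. b ^ D l l0)" using b by (intro suminf_mult Dsum) auto
    also have "\<dots> \<le> X * (1 + 2 * b / (1 - b))" using b X by (intro mult_left_mono Dsum) auto
    finally show ?thesis .
  qed
  define P where "P = 1 + 2 * b / (1 - b)"
  have P: "0 < P" using b by (simp add: P_def add_pos_nonneg)
  have mem: "f i \<in> fock_space \<psi> \<infinity>" if i: "i < M" for i
  proof (rule fock_space_infinityI(1)[OF hol[OF i]])
    fix z
    show "cmod (f i z) \<le> (exp 2 * exp (\<psi> (s 0)) * P) * exp (radial \<psi> z)"
    proof (cases "s 0 \<le> cmod z")
      case True
      then obtain k where k: "s k \<le> cmod z" "cmod z \<le> s (Suc k)" using index by blast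
      have "cmod (f i z) \<le> exp 2 * exp (\<psi> (cmod z)) * P" unfolding P_def
      proof (rule f_le[OF i])
        fix l
        have "cmod (t (i + l * M) z) \<le> exp 2 * b ^ ((i + l * M - k) + (k - (i + l * M))) * exp (\<psi> (cmod z))" by (rule tb[OF k])
        also have "\<dots> \<le> exp 2 * b ^ D l (k div M) * exp (\<psi> (cmod z))"
          using bD[OF i] by (intro mult_right_mono mult_left_mono) auto
        finally show "cmod (t (i + l * M) z) \<le> exp 2 * exp (\<psi> (cmod z)) * b ^ D l (k div M)" by (simp add: mult_ac)
      qed simp
      also have "\<dots> \<le> exp 2 * exp (\<psi> (cmod z)) * P * exp (\<psi> (s 0))"
        using P psi_nonneg[of "s 0"] sp[of 0] by simp
      finally show ?thesis by (simp add: radial_def mult_ac)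
    next
      case False
      then have "cmod z \<le> s 0" by simp
      then have "cmod (f i z) \<le> exp 2 * exp (\<psi> (s 0)) * P" unfolding P_def
        using conv0[OF i, of z 0] by (intro f_le[OF i]) auto
      also have "\<dots> \<le> exp 2 * exp (\<psi> (s 0)) * P * exp (radial \<psi> z)"
        using P psi_nonneg[of "cmod z"] by (simp add: radial_def)
      finally show ?thesis .
    qed
  qed
  show ?thesis
  proof (rule that[of "e0 / 2" M f "s 0"])
    show "0 < e0 / 2" using e0 by simp
    show "f i \<in> fock_space \<psi> \<infinity>" if "i < M" for i by (rule mem[OF that])
    fix z :: complex assume "s 0 \<le> cmod z"
    then obtain k where k: "s k \<le> cmod z" "cmod z \<le> s (Suc k)" using index by blast
    define i l0 where "i = k mod M" and "l0 = k div M"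
    have i: "i < M" using M(3) by (simp add: i_def)
    have kl: "k = i + l0 * M" by (simp add: i_def l0_def)
    let ?X = "exp 2 * exp (\<psi> (cmod z))"
    have tk: "e0 * exp (\<psi> (cmod z)) \<le> cmod (t (i + l0 * M) z)"
      using low[OF k] unfolding nt e0_def kl[symmetric] .
    have "(\<lambda>l. if l = l0 then t (i + l * M) z else 0) sums t (i + l0 * M) z"
      using sums_single[of l0 "\<lambda>l. t (i + l * M) z"] by simp
    from sums_diff[OF summable_sums[OF summ[OF i, of z]] this]
    have "(\<lambda>l. if l = l0 then 0 else t (i + l * M) z) sums (f i z - t (i + l0 * M) z)"
      unfolding f_def by (rule back_subst[of "\<lambda>f. f sums _"]) auto
    then have eq: "f i z - t (i + l0 * M) z = (\<Sum>l. if l = l0 then 0 else t (i + l * M) z)" by (simp add: sums_iff)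
    have g: "summable (\<lambda>l. if l = l0 then 0 else Q ^ ((l - l0) + (l0 - l)))"
      "(\<Sum>l. if l = l0 then 0 else Q ^ ((l - l0) + (l0 - l))) \<le> 2 * Q / (1 - Q)"
      using two_sided_geometric[of Q l0] Q by auto
    have "cmod (f i z - t (i + l0 * M) z) \<le> (\<Sum>l. ?X * (if l = l0 then 0 else Q ^ ((l - l0) + (l0 - l))))"
      unfolding eq
    proof (rule norm_suminf_le[OF _ summable_mult[OF g(1)]])
      fix l
      show "cmod (if l = l0 then 0 else t (i + l * M) z) \<le> ?X * (if l = l0 then 0 else Q ^ ((l - l0) + (l0 - l)))"
      proof (cases "l = l0")
        case False
        \<comment> \<open>In the residue class of \<open>k\<close> the index distance is exactly
          \<open>M\<close> times that of \<open>l\<close> and \<open>l0\<close>, so the terms decay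
          with ratio \<open>Q\<close> instead of \<open>b\<close>.\<close>
        have "(i + l * M - k) + (k - (i + l * M)) = M * ((l - l0) + (l0 - l))"
          by (simp add: kl distrib_left diff_mult_distrib2 mult.commute)
        then have "b ^ ((i + l * M - k) + (k - (i + l * M))) = Q ^ ((l - l0) + (l0 - l))"
          by (simp only: power_mult Q_def)
        then show ?thesis using tb[OF k, of "i + l * M"] False by (simp add: mult_ac)
      qed simp
    qed
    also have "\<dots> = ?X * (\<Sum>l. if l = l0 then 0 else Q ^ ((l - l0) + (l0 - l)))" by (rule suminf_mult[OF g(1)])
    also have "\<dots> \<le> ?X * (2 * Q / (1 - Q))" by (intro mult_left_mono g) auto
    also have "\<dots> \<le> ?X * (4 * Q)"
      using Q by (intro mult_left_mono) (auto simp: field_simps)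
    also have "\<dots> \<le> ?X * (e0 / (2 * exp 2))" using Q(3) by (intro mult_left_mono) (auto simp: field_simps)
    also have "\<dots> = e0 / 2 * exp (\<psi> (cmod z))" by simp
    finally have "cmod (f i z - t (i + l0 * M) z) \<le> e0 / 2 * exp (\<psi> (cmod z))" .
    then have "e0 / 2 * exp (radial \<psi> z) \<le> cmod (f i z)"
      using tk norm_triangle_ineq2[of "t (i + l0 * M) z" "t (i + l0 * M) z - f i z"] by (simp add: norm_minus_commute radial_def)
    then show "\<exists>i<M. e0 / 2 * exp (radial \<psi> z) \<le> cmod (f i z)" using i by blast
  qed
qed

end

section \<open>Operators out of the space with the supremum norm\<close>

context stepped_weight
begin

lemma quotient_in_Lp_iff:
  assumes g: "g holomorphic_on UNIV"
  shows "(\<lambda>z. deriv g z / of_real (1 + radial \<psi>' z)) \<in> Lp_space q \<longleftrightarrow>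
    (\<integral>\<^sup>+w. ennreal (symbol_density q g w) \<partial>lborel) < \<infinity>"
proof -
  note [measurable] = measurable_symbol_density[OF g, of q]
  have [measurable]: "deriv g \<in> borel_measurable borel"
    using holomorphic_deriv[OF g open_UNIV]
    by (intro borel_measurable_continuous_onI holomorphic_on_imp_continuous_on)
  have m: "(\<lambda>z. deriv g z / of_real (slope z)) \<in> borel_measurable lborel" by measurable
  have "cmod (deriv g z / of_real (slope z)) powr q = symbol_density q g z" for z
    using slope_pos[of z] by (simp add: symbol_density_def norm_divide)
  then show ?thesis
    using m unfolding slope_def[symmetric]
    by (simp add: Lp_space_def integrable_iff_bounded)
qed

text \<open>Far out, one of finitely many functions \<open>fs i\<close> is comparable with
  \<open>exp (radial \<psi>)\<close>, so the symbol density is dominated by the sum of the densities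
  in \<open>nn_integral_deriv_le\<close> for their images. Finiteness of each of these norms
  suffices, so the mapping property alone carries the argument.\<close>

lemma symbol_density_finite_if_maps:
  assumes q: "0 < q" and g: "g holomorphic_on UNIV"
    and maps: "\<And>f. f \<in> fock_space \<psi> \<infinity> \<Longrightarrow> volterra g f \<in> fock_space \<psi> (ennreal q)"
  shows "(\<integral>\<^sup>+w. ennreal (symbol_density q g w) \<partial>lborel) < \<infinity>"
proof -
  obtain M :: nat and fs \<epsilon> S where e: "0 < \<epsilon>" and fs: "\<And>i. i < M \<Longrightarrow> fs i \<in> fock_space \<psi> \<infinity>"
    and frame: "\<And>z. S \<le> cmod z \<Longrightarrow> \<exists>i<M. \<epsilon> * exp (radial \<psi> z) \<le> cmod (fs i z)"
    by (rule frame_functions) blast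
  obtain G where G: "0 < G" "\<And>z. cmod z \<le> S \<Longrightarrow> cmod (deriv g z) \<le> G"
    using holomorphic_bounded_on_cball[OF holomorphic_deriv[OF g open_UNIV], of S] by blast
  let ?h = "\<lambda>i z. ennreal ((cmod (deriv (volterra g (fs i)) z) / slope z) powr q * exp (- (q * radial \<psi> z)))"
  have hm: "?h i \<in> borel_measurable lborel" if "i < M" for i
  proof -
    have [measurable]: "deriv (volterra g (fs i)) \<in> borel_measurable borel"
      by (intro borel_measurable_continuous_onI holomorphic_on_imp_continuous_on holomorphic_deriv
          holomorphic_on_volterra fock_space_holomorphic[OF fs[OF that]] g open_UNIV)
    show ?thesis by measurable
  qed
  have "(\<integral>\<^sup>+w. ennreal (symbol_density q g w) \<partial>lborel)
      \<le> (\<integral>\<^sup>+w. ennreal (G powr q) * indicator (cball 0 S) w + ennreal (\<epsilon> powr (- q)) * (\<Sum>i<M. ?h i w) \<partial>lborel)"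
  proof (rule nn_integral_mono)
    fix w
    show "ennreal (symbol_density q g w) \<le> ennreal (G powr q) * indicator (cball 0 S) w + ennreal (\<epsilon> powr (- q)) * (\<Sum>i<M. ?h i w)"
    proof (cases "S \<le> cmod w")
      case False
      then have w: "cmod w \<le> S" by simp
      have "cmod (deriv g w) / slope w \<le> cmod (deriv g w) / 1"
        using slope_ge_1[of w] by (intro divide_left_mono) auto
      then have "cmod (deriv g w) / slope w \<le> G" using G(2)[OF w] by simp
      then have "symbol_density q g w \<le> G powr q"
        unfolding symbol_density_def using q slope_pos[of w] by (intro powr_mono2) auto
      then have "ennreal (symbol_density q g w) \<le> ennreal (G powr q) * indicator (cball 0 S) w"
        using w by (simp add: ennreal_leI)
      then show ?thesis by (rule order_trans) simp
    next
      case True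
      obtain i where i: "i < M" "\<epsilon> * exp (radial \<psi> w) \<le> cmod (fs i w)" using frame[OF True] by blast
      have d: "cmod (deriv (volterra g (fs i)) w) = cmod (fs i w) * cmod (deriv g w)"
        by (simp add: deriv_volterra[OF fock_space_holomorphic[OF fs[OF i(1)]] g] norm_mult)
      have "symbol_density q g w = \<epsilon> powr (- q) * ((\<epsilon> * exp (radial \<psi> w) * cmod (deriv g w) / slope w) powr q * exp (- (q * radial \<psi> w)))"
      proof -
        have "(\<epsilon> * exp (radial \<psi> w) * cmod (deriv g w) / slope w) powr q = \<epsilon> powr q * exp (q * radial \<psi> w) * symbol_density q g w"
          by (simp add: symbol_density_def powr_mult powr_divide exp_powr_real mult.commute)
        then show ?thesis using e by (simp add: powr_minus exp_minus field_simps)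
      qed
      also have "\<dots> \<le> \<epsilon> powr (- q) * ((cmod (deriv (volterra g (fs i)) w) / slope w) powr q * exp (- (q * radial \<psi> w)))"
        unfolding d using i(2) e q slope_pos[of w]
        by (intro mult_left_mono mult_right_mono powr_mono2 divide_right_mono) auto
      finally have "ennreal (symbol_density q g w) \<le> ennreal (\<epsilon> powr (- q)) * ?h i w"
        by (subst ennreal_mult''[symmetric]) (auto intro: ennreal_leI)
      also have "\<dots> \<le> ennreal (\<epsilon> powr (- q)) * (\<Sum>i<M. ?h i w)"
        using i(1) by (intro mult_left_mono member_le_sum) auto
      finally show ?thesis by (rule order_trans) simp
    qed
  qed
  also have "\<dots> = (\<integral>\<^sup>+w. ennreal (G powr q) * indicator (cball 0 S) w \<partial>(lborel :: complex measure)) + (\<integral>\<^sup>+w. ennreal (\<epsilon> powr (- q)) * (\<Sum>i<M. ?h i w) \<partial>lborel)"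
    using hm by (intro nn_integral_add borel_measurable_times_ennreal borel_measurable_sum borel_measurable_indicator) auto
  also have "(\<integral>\<^sup>+w. ennreal (\<epsilon> powr (- q)) * (\<Sum>i<M. ?h i w) \<partial>lborel) = ennreal (\<epsilon> powr (- q)) * (\<Sum>i<M. \<integral>\<^sup>+w. ?h i w \<partial>lborel)"
    using hm by (subst nn_integral_cmult, intro borel_measurable_sum, simp, subst nn_integral_sum) auto
  also have "(\<integral>\<^sup>+w. ennreal (G powr q) * indicator (cball 0 S) w \<partial>(lborel :: complex measure)) = ennreal (G powr q) * emeasure lborel (cball (0::complex) S)"
    by (rule nn_integral_cmult_indicator) simp
  also have "ennreal (G powr q) * emeasure lborel (cball (0::complex) S) + ennreal (\<epsilon> powr (- q)) * (\<Sum>i<M. \<integral>\<^sup>+w. ?h i w \<partial>lborel) < \<infinity>"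
    using nn_integral_deriv_le[OF q maps[OF fs]] emeasure_lborel_cball_finite[of "0::complex" S]
    by (simp add: ennreal_mult_less_top)
  finally show ?thesis .
qed

lemma volterra_bounded_if_density_finite:
  assumes q: "0 < q" and g: "g holomorphic_on UNIV"
    and fin: "(\<integral>\<^sup>+w. ennreal (symbol_density q g w) \<partial>lborel) < \<infinity>"
  shows "bounded_operator \<psi> \<infinity> (ennreal q) (volterra g)"
proof -
  obtain W where W: "W \<in> borel_measurable borel" "(\<integral>\<^sup>+z. W z \<partial>lborel) < \<infinity>"
    and dom: "\<And>f z. f \<in> fock_space \<psi> \<infinity> \<Longrightarrow> ennreal (fock_density q (volterra g f) z) \<le> ennreal (fock_norm \<psi> \<infinity> f powr q) * W z"
    by (rule volterra_dominated[OF q g fin]) blast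
  obtain w where w: "0 \<le> w" "(\<integral>\<^sup>+z. W z \<partial>lborel) = ennreal w"
    using W(2) by (cases "\<integral>\<^sup>+z. W z \<partial>lborel" rule: ennreal_cases) auto
  have "volterra g f \<in> fock_space \<psi> (ennreal q) \<and> fock_norm \<psi> (ennreal q) (volterra g f) \<le> w powr (1 / q) * fock_norm \<psi> \<infinity> f"
    if f: "f \<in> fock_space \<psi> \<infinity>" for f
  proof -
    have N: "0 \<le> fock_norm \<psi> \<infinity> f" by (rule fock_norm_nonneg[OF f])
    have "(\<integral>\<^sup>+z. ennreal (fock_density q (volterra g f) z) \<partial>lborel) \<le> (\<integral>\<^sup>+z. ennreal (fock_norm \<psi> \<infinity> f powr q) * W z \<partial>lborel)"
      by (intro nn_integral_mono dom[OF f])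
    also have "\<dots> = ennreal (fock_norm \<psi> \<infinity> f powr q) * ennreal w"
      using W(1) by (subst nn_integral_cmult) (auto simp: w)
    also have "\<dots> = ennreal (fock_norm \<psi> \<infinity> f powr q * w)" using w by (simp add: ennreal_mult)
    also have "fock_norm \<psi> \<infinity> f powr q * w = (w powr (1 / q) * fock_norm \<psi> \<infinity> f) powr q"
      using q w by (simp add: powr_mult powr_powr mult.commute)
    finally have le: "(\<integral>\<^sup>+z. ennreal (fock_density q (volterra g f) z) \<partial>lborel) \<le> ennreal ((w powr (1 / q) * fock_norm \<psi> \<infinity> f) powr q)" .
    have "0 \<le> w powr (1 / q) * fock_norm \<psi> \<infinity> f" using N by simp
    from fock_space_finiteI[OF q holomorphic_on_volterra[OF fock_space_holomorphic[OF f] g] this le] show ?thesis by blast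
  qed
  then show ?thesis unfolding bounded_operator_def by blast
qed

lemma volterra_compact_if_density_finite:
  assumes q: "0 < q" and g: "g holomorphic_on UNIV"
    and fin: "(\<integral>\<^sup>+w. ennreal (symbol_density q g w) \<partial>lborel) < \<infinity>"
  shows "compact_operator \<psi> \<infinity> (ennreal q) (volterra g)"
proof (rule compact_operatorI)
  show "0 < ennreal q" using q by simp
  show maps: "volterra g f \<in> fock_space \<psi> (ennreal q)" if "f \<in> fock_space \<psi> \<infinity>" for f
    using that volterra_bounded_if_density_finite[OF q g fin] by (simp add: bounded_operator_def)
  fix F M
  assume F: "\<And>n::nat. F n \<in> fock_space \<psi> \<infinity>" "\<And>n. fock_norm \<psi> \<infinity> (F n) \<le> M"
  obtain W where W: "W \<in> borel_measurable borel" "(\<integral>\<^sup>+z. W z \<partial>lborel) < \<infinity>"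
    and dom: "\<And>f z. f \<in> fock_space \<psi> \<infinity> \<Longrightarrow> ennreal (fock_density q (volterra g f) z) \<le> ennreal (fock_norm \<psi> \<infinity> f powr q) * W z"
    by (rule volterra_dominated[OF q g fin]) blast
  obtain L where L: "0 < L"
    and vol: "\<And>f g z B. \<lbrakk>f holomorphic_on UNIV; g holomorphic_on UNIV; 0 \<le> B;
      \<And>w. cmod w \<le> cmod z \<Longrightarrow> cmod (f w * deriv g w) \<le> B * majorant w\<rbrakk> \<Longrightarrow>
      cmod (volterra g f z) \<le> L * B * exp (radial \<psi> z)"
    by (rule volterra_majorized) blast
  have inf0: "0 < (\<infinity>::ennreal)" by simp
  obtain f r where f: "f holomorphic_on UNIV" and r: "strict_mono (r :: nat \<Rightarrow> nat)"
    and pt: "\<And>z. (\<lambda>n. F (r n) z) \<longlonglongrightarrow> f z"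
    and ul: "\<And>S. uniform_limit (cball 0 S) (\<lambda>n. F (r n)) f sequentially"
    using fock_Montel[where F = F, OF inf0 F] by blast
  have hF: "F n holomorphic_on UNIV" for n by (rule fock_space_holomorphic[OF F(1)])
  have M: "0 \<le> M" by (rule order_trans[OF fock_norm_nonneg[OF F(1)[of 0]] F(2)])
  have Fb: "cmod (F n z) \<le> M * exp (radial \<psi> z)" for n z
    by (rule order_trans[OF fock_norm_infinity_bound[OF F(1)] mult_right_mono[OF F(2)]]) simp
  have fb: "cmod (f z) \<le> M * exp (radial \<psi> z)" for z
    by (rule LIMSEQ_le_const2[OF tendsto_norm[OF pt]]) (use Fb in auto)
  \<comment> \<open>For the supremum norm the pointwise bound passes to the limit, so
    \<open>f\<close> is in the domain and \<open>volterra g f\<close> is a legitimate limit in the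
    target.\<close>
  have fin': "f \<in> fock_space \<psi> \<infinity>" by (rule fock_space_infinityI(1)[OF f fb])
  define h where "h n z = F (r n) z - f z" for n z
  have hh: "h n holomorphic_on UNIV" for n unfolding h_def by (intro holomorphic_intros hF f)
  have "cmod (h n z) \<le> (2 * M) * exp (radial \<psi> z)" for n z
    using norm_triangle_ineq4[of "F (r n) z" "f z"] Fb[of "r n" z] fb[of z] by (simp add: h_def)
  then have hmem: "h n \<in> fock_space \<psi> \<infinity>" and hnorm: "fock_norm \<psi> \<infinity> (h n) \<le> 2 * M" for n
    using fock_space_infinityI[OF hh] by blast+
  have Vh: "volterra g (h n) z = volterra g (F (r n)) z - volterra g f z" for n z
    unfolding h_def by (rule volterra_diff[OF hF f g])
  have null: "(\<lambda>n. volterra g (h n) z) \<longlonglongrightarrow> 0" for z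
  proof (rule LIMSEQ_I)
    fix e :: real assume e: "0 < e"
    obtain G where G: "0 < G" "\<And>w. cmod w \<le> cmod z \<Longrightarrow> cmod (deriv g w) \<le> G"
      using holomorphic_bounded_on_cball[OF holomorphic_deriv[OF g open_UNIV], of "cmod z"] by blast
    define e' where "e' = e / (2 * L * exp (radial \<psi> z))"
    have e': "0 < e'" using e L by (simp add: e'_def)
    have "\<forall>\<^sub>F n in sequentially. \<forall>w\<in>cball 0 (cmod z). dist (F (r n) w) (f w) < e' / G"
      using ul[of "cmod z"] e' G(1) by (auto simp: uniform_limit_iff)
    then obtain N where "\<forall>n\<ge>N. \<forall>w\<in>cball 0 (cmod z). dist (F (r n) w) (f w) < e' / G"
      by (auto simp: eventually_sequentially)
    then have N: "cmod (h n w) < e' / G" if "N \<le> n" "cmod w \<le> cmod z" for n w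
      using that by (auto simp: h_def dist_norm)
    show "\<exists>N. \<forall>n\<ge>N. norm (volterra g (h n) z - 0) < e"
    proof (intro exI allI impI)
      fix n assume n: "N \<le> n"
      have "cmod (volterra g (h n) z) \<le> L * e' * exp (radial \<psi> z)"
      proof (rule vol[OF hh g])
        fix w assume w: "cmod w \<le> cmod z"
        have "cmod (h n w * deriv g w) \<le> e' / G * G"
          unfolding norm_mult using N[OF n w] G(2)[OF w] G(1) e' by (intro mult_mono) auto
        also have "\<dots> = e' * 1" using G(1) by simp
        also have "\<dots> \<le> e' * majorant w" using e' one_le_majorant by (intro mult_left_mono) auto
        finally show "cmod (h n w * deriv g w) \<le> e' * majorant w" .
      qed (use e' in simp)
      also have "\<dots> = e / 2" using L by (simp add: e'_def)
      finally show "norm (volterra g (h n) z - 0) < e" using e by simp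
    qed
  qed
  have hol: "volterra g (h n) holomorphic_on UNIV" for n by (rule holomorphic_on_volterra[OF hh g])
  have "(\<lambda>n. \<integral>\<^sup>+z. ennreal (fock_density q (volterra g (h n)) z) \<partial>lborel) \<longlonglongrightarrow> (\<integral>\<^sup>+z. 0 \<partial>(lborel :: complex measure))"
  proof (rule nn_integral_dominated_convergence)
    show "(\<lambda>z. ennreal (fock_density q (volterra g (h n)) z)) \<in> borel_measurable lborel" for n
      using measurable_fock_density[OF hol] by simp
    show "(\<lambda>z. ennreal ((2 * M) powr q) * W z) \<in> borel_measurable lborel" using W(1) by simp
    show "(\<integral>\<^sup>+z. ennreal ((2 * M) powr q) * W z \<partial>lborel) < \<infinity>"
      using W by (subst nn_integral_cmult) (auto simp: ennreal_mult_less_top)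
    have "ennreal (fock_density q (volterra g (h n)) z) \<le> ennreal ((2 * M) powr q) * W z" for n z
    proof (rule order_trans[OF dom[OF hmem] mult_right_mono])
      show "ennreal (fock_norm \<psi> \<infinity> (h n) powr q) \<le> ennreal ((2 * M) powr q)"
        using q hnorm fock_norm_nonneg[OF hmem] by (intro ennreal_leI powr_mono2) auto
    qed simp
    then show "AE z in lborel. ennreal (fock_density q (volterra g (h n)) z) \<le> ennreal ((2 * M) powr q) * W z" for n
      by (intro AE_I2)
    have "(\<lambda>n. ennreal (fock_density q (volterra g (h n)) z)) \<longlonglongrightarrow> 0" for z
    proof -
      have "(\<lambda>n. cmod (volterra g (h n) z) powr q) \<longlonglongrightarrow> 0 powr q"
        using tendsto_norm[OF null[of z]] q by (intro tendsto_powr') auto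
      then have "(\<lambda>n. fock_density q (volterra g (h n)) z) \<longlonglongrightarrow> 0"
        using q by (auto intro!: tendsto_eq_intros)
      then show ?thesis by (metis ennreal_0 tendsto_ennrealI)
    qed
    then show "AE z in lborel. (\<lambda>n. ennreal (fock_density q (volterra g (h n)) z)) \<longlonglongrightarrow> 0" by (intro AE_I2)
  qed simp
  then have "(\<lambda>n. ennreal (fock_norm \<psi> (ennreal q) (volterra g (h n)) powr q)) \<longlonglongrightarrow> 0"
    by (simp add: nn_integral_fock_density[OF q maps[OF hmem]])
  then have "(\<lambda>n. fock_norm \<psi> (ennreal q) (volterra g (h n)) powr q) \<longlonglongrightarrow> 0"
    by (subst (asm) tendsto_ennreal_iff[of _ _ 0, simplified]) auto
  then have "(\<lambda>n. (fock_norm \<psi> (ennreal q) (volterra g (h n)) powr q) powr (1 / q)) \<longlonglongrightarrow> 0 powr (1 / q)"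
    using q by (intro tendsto_powr') auto
  then have "(\<lambda>n. fock_norm \<psi> (ennreal q) (volterra g (h n))) \<longlonglongrightarrow> 0"
    using q fock_norm_nonneg[OF maps[OF hmem]] by (simp add: powr_powr)
  moreover have "volterra g (h n) = (\<lambda>z. volterra g (F (r n)) z - volterra g f z)" for n
    by (rule ext) (rule Vh)
  ultimately show "\<exists>r u. strict_mono r \<and> u \<in> fock_space \<psi> (ennreal q) \<and> (\<lambda>n. fock_norm \<psi> (ennreal q) (\<lambda>z. volterra g (F (r n)) z - u z)) \<longlonglongrightarrow> 0"
    using r maps[OF fin'] by auto
qed

end

section \<open>Translation between growth conditions in \<open>\<tau>\<close> and in the
  Laplacian\<close>

context scaled_weight
begin

text \<open>Near the origin \<open>\<psi>' r / r\<close> is bounded because \<open>\<psi>'\<close>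
  vanishes at 0 and has a locally bounded derivative. The value at the origin, where the polar
  formula says nothing, enters through the maximum.\<close>

lemma laplacian_locally_bounded:
  obtains B where "\<And>z. cmod z \<le> S \<Longrightarrow> laplacian (radial \<psi>) z \<le> B"
proof -
  have "compact (\<psi>'' ` {0..S})"
    by (intro compact_continuous_image continuous_on_subset[OF psi_deriv2_cont]) auto
  then obtain B0 where "\<And>x. x \<in> {0..S} \<Longrightarrow> norm (\<psi>'' x) \<le> B0"
    by (meson bounded_iff compact_imp_bounded imageI)
  then have B0: "\<bar>\<psi>'' x\<bar> \<le> B0" if "0 \<le> x" "x \<le> S" for x using that by fastforce
  have "lap r \<le> 2 * B0" if r: "0 < r" "r \<le> S" for r
  proof -
    have "norm (\<psi>' r - \<psi>' 0) \<le> B0 * norm (r - 0)"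
    proof (rule field_differentiable_bound[of "{0..r}" \<psi>' \<psi>''])
      fix x assume "x \<in> {0..r}"
      then show "norm (\<psi>'' x) \<le> B0" "(\<psi>' has_field_derivative \<psi>'' x) (at x within {0..r})"
        using B0[of x] r by (auto intro: DERIV_subset[OF psi_deriv2])
    qed (use r in auto)
    then have "\<psi>' r / r \<le> B0" using r psi'_0 by (simp add: pos_divide_le_eq)
    then show ?thesis using B0[of r] r by (simp add: lap_def)
  qed
  then have "laplacian (radial \<psi>) z \<le> max (2 * B0) (laplacian (radial \<psi>) 0)" if "cmod z \<le> S" for z
    using that laplacian_radial[of z] by (cases "z = 0") (auto simp: le_max_iff_disj)
  then show ?thesis by (rule that)
qed

text \<open>The operator criteria use \<open>\<tau>\<close> far from the origin, the theorem the
  Laplacian on the whole plane. Here \<open>lam\<close> stands for the constant 1 when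
  \<open>p\<close> is infinite and for the power \<open>1 / p\<close> of the Laplacian otherwise; on
  bounded discs everything is bounded.\<close>

lemma growth_condition_iff:
  assumes g: "g holomorphic_on UNIV" and c1: "0 < c1" and lam: "\<And>z. 0 \<le> lam z"
    and lo: "\<And>z. 1 \<le> cmod z \<Longrightarrow> c1 * \<tau> (cmod z) powr (- d) \<le> lam z"
    and hi: "\<And>z. 1 \<le> cmod z \<Longrightarrow> lam z \<le> c2 * \<tau> (cmod z) powr (- d)"
    and loc: "\<And>S. \<exists>B. \<forall>z. cmod z \<le> S \<longrightarrow> lam z \<le> B"
  shows "bdd_above (range (\<lambda>z. cmod (deriv g z) * lam z / (1 + radial \<psi>' z))) \<longleftrightarrow>
      (\<exists>B S. \<forall>z. S \<le> cmod z \<longrightarrow> cmod (deriv g z) * \<tau> (cmod z) powr (- d) \<le> B * (1 + radial \<psi>' z))" (is "?A \<longleftrightarrow> ?B")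
    and "((\<lambda>z. cmod (deriv g z) * lam z / (1 + radial \<psi>' z)) \<longlongrightarrow> 0) at_infinity \<longleftrightarrow>
      (\<forall>e>0. \<exists>S. \<forall>z. S \<le> cmod z \<longrightarrow> cmod (deriv g z) * \<tau> (cmod z) powr (- d) \<le> e * (1 + radial \<psi>' z))" (is "?C \<longleftrightarrow> ?D")
proof -
  let ?s = "\<lambda>z. 1 + radial \<psi>' z"
  have s: "0 < ?s z" "1 \<le> ?s z" for z using psi'_nonneg[of "cmod z"] by (auto simp: radial_def)
  have from_lam: "cmod (deriv g z) * \<tau> (cmod z) powr (- d) \<le> e / c1 * ?s z"
    if "1 \<le> cmod z" "cmod (deriv g z) * lam z / ?s z \<le> e" for z e
  proof -
    have "c1 * (cmod (deriv g z) * \<tau> (cmod z) powr (- d)) = cmod (deriv g z) * (c1 * \<tau> (cmod z) powr (- d))" by (simp add: mult_ac)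
    also have "\<dots> \<le> cmod (deriv g z) * lam z" using lo[OF that(1)] by (rule mult_left_mono) simp
    also have "\<dots> \<le> e * ?s z" using that(2) s(1)[of z] by (simp add: pos_divide_le_eq)
    finally show ?thesis using c1 by (simp add: field_simps)
  qed
  have to_lam: "cmod (deriv g z) * lam z / ?s z \<le> \<bar>c2\<bar> * e"
    if "1 \<le> cmod z" "cmod (deriv g z) * \<tau> (cmod z) powr (- d) \<le> e * ?s z" for z e
  proof -
    have "lam z \<le> \<bar>c2\<bar> * \<tau> (cmod z) powr (- d)"
      using hi[OF that(1)] mult_right_mono[OF abs_ge_self[of c2], of "\<tau> (cmod z) powr (- d)"] by simp
    then have "cmod (deriv g z) * lam z \<le> cmod (deriv g z) * (\<bar>c2\<bar> * \<tau> (cmod z) powr (- d))" by (rule mult_left_mono) simp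
    also have "\<dots> = \<bar>c2\<bar> * (cmod (deriv g z) * \<tau> (cmod z) powr (- d))" by (simp add: mult_ac)
    also have "\<dots> \<le> \<bar>c2\<bar> * (e * ?s z)" using that(2) by (rule mult_left_mono) simp
    finally show ?thesis using s(1)[of z] by (simp add: pos_divide_le_eq mult.assoc)
  qed
  show "?A \<longleftrightarrow> ?B"
  proof
    assume ?A
    then obtain B where "\<And>z. cmod (deriv g z) * lam z / ?s z \<le> B" by (auto simp: bdd_above_def)
    then show ?B using from_lam by blast
  next
    assume ?B
    then obtain B S where B: "\<And>z. S \<le> cmod z \<Longrightarrow> cmod (deriv g z) * \<tau> (cmod z) powr (- d) \<le> B * ?s z" by blast
    let ?S = "max 1 S"
    obtain G where G: "0 < G" "\<And>z. cmod z \<le> ?S \<Longrightarrow> cmod (deriv g z) \<le> G"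
      using holomorphic_bounded_on_cball[OF holomorphic_deriv[OF g open_UNIV], of ?S] by blast
    obtain D where D: "\<And>z. cmod z \<le> ?S \<Longrightarrow> lam z \<le> D" using loc[of ?S] by blast
    have "cmod (deriv g z) * lam z / ?s z \<le> max (\<bar>c2\<bar> * B) (G * D)" for z
    proof (cases "?S \<le> cmod z")
      case True
      then show ?thesis using to_lam[of z B] B[of z] by simp
    next
      case False
      then have z: "cmod z \<le> ?S" by linarith
      have "cmod (deriv g z) * lam z / ?s z \<le> cmod (deriv g z) * lam z / 1"
        using s[of z] lam[of z] by (intro divide_left_mono) auto
      also have "\<dots> \<le> G * D" using G D[OF z] lam[of z] z by (simp add: mult_mono)
      finally show ?thesis by simp
    qed
    then show ?A by (rule bdd_aboveI2)
  qed
  have nn: "0 \<le> cmod (deriv g z) * lam z / ?s z" for z using lam s(1)[of z] by simp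
  show "?C \<longleftrightarrow> ?D"
  proof
    assume C: ?C
    show ?D
    proof (intro allI impI)
      fix e :: real assume e: "0 < e"
      have "\<forall>\<^sub>F z in at_infinity. cmod (deriv g z) * lam z / ?s z < e * c1"
        using C by (rule order_tendstoD) (use e c1 in simp)
      then obtain S where S: "\<And>z. S \<le> cmod z \<Longrightarrow> cmod (deriv g z) * lam z / ?s z < e * c1"
        by (auto simp: eventually_at_infinity)
      show "\<exists>S. \<forall>z. S \<le> cmod z \<longrightarrow> cmod (deriv g z) * \<tau> (cmod z) powr (- d) \<le> e * ?s z"
      proof (intro exI allI impI)
        fix z assume "max 1 S \<le> cmod z"
        then show "cmod (deriv g z) * \<tau> (cmod z) powr (- d) \<le> e * ?s z"
          using from_lam[of z "e * c1"] S[of z] c1 by (simp add: less_imp_le)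
      qed
    qed
  next
    assume D: ?D
    show ?C
    proof (rule tendstoI)
      fix e :: real assume e: "0 < e"
      have e': "0 < e / (\<bar>c2\<bar> + 1)" using e by simp
      then obtain S where S: "\<And>z. S \<le> cmod z \<Longrightarrow> cmod (deriv g z) * \<tau> (cmod z) powr (- d) \<le> e / (\<bar>c2\<bar> + 1) * ?s z" using D by blast
      have "dist (cmod (deriv g z) * lam z / ?s z) 0 < e" if z: "max 1 S \<le> cmod z" for z
      proof -
        have "cmod (deriv g z) * lam z / ?s z \<le> \<bar>c2\<bar> * (e / (\<bar>c2\<bar> + 1))" by (rule to_lam[OF _ S]) (use z in auto)
        also have "\<dots> < (\<bar>c2\<bar> + 1) * (e / (\<bar>c2\<bar> + 1))" using e' by (intro mult_strict_right_mono) auto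
        also have "\<dots> = e" by simp
        finally show ?thesis unfolding dist_real_def diff_0_right abs_of_nonneg[OF nn] .
      qed
      then show "\<forall>\<^sub>F z in at_infinity. dist (cmod (deriv g z) * lam z / ?s z) 0 < e"
        unfolding eventually_at_infinity by blast
    qed
  qed
qed

lemma laplacian_powr_comparable:
  assumes q: "0 < q"
  obtains c1 c2 where "0 < c1"
    and "\<And>z. 1 \<le> cmod z \<Longrightarrow> c1 * \<tau> (cmod z) powr (- (2 / q)) \<le> laplacian (radial \<psi>) z powr (1 / q)"
    and "\<And>z. 1 \<le> cmod z \<Longrightarrow> laplacian (radial \<psi>) z powr (1 / q) \<le> c2 * \<tau> (cmod z) powr (- (2 / q))"
proof -
  obtain K where K: "1 \<le> K" and lo: "\<And>r. 1 \<le> r \<Longrightarrow> 1 / K \<le> (\<tau> r)^2 * lap r"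
    and hi: "\<And>r. 1 \<le> r \<Longrightarrow> (\<tau> r)^2 * lap r \<le> K"
    by (rule tau_lap_comparable) blast
  have pw: "(k * \<tau> r powr (- 2)) powr (1 / q) = k powr (1 / q) * \<tau> r powr (- (2 / q))" for k r
    by (simp add: powr_mult powr_powr)
  show ?thesis
  proof (rule that[of "(1 / K) powr (1 / q)" "K powr (1 / q)"])
    show "0 < (1 / K) powr (1 / q)" using K by simp
    fix z :: complex assume z: "1 \<le> cmod z"
    have L: "laplacian (radial \<psi>) z = lap (cmod z)" using z by (intro laplacian_radial) auto
    have t: "0 < \<tau> (cmod z)" using tau_positive[of "cmod z"] by simp
    have lp: "0 < lap (cmod z)" by (rule lap_pos) (use z in linarith)
    have m2: "\<tau> (cmod z) powr (- 2) = 1 / (\<tau> (cmod z))^2" using t by (simp add: powr_minus_divide powr_numeral)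
    have "1 / K * \<tau> (cmod z) powr (- 2) \<le> lap (cmod z)"
    proof -
      have "1 / K / (\<tau> (cmod z))^2 \<le> lap (cmod z)"
        by (subst pos_divide_le_eq) (use lo[OF z] t in \<open>simp_all add: mult.commute\<close>)
      then show ?thesis unfolding m2 by simp
    qed
    then show "(1 / K) powr (1 / q) * \<tau> (cmod z) powr (- (2 / q)) \<le> laplacian (radial \<psi>) z powr (1 / q)"
      unfolding L pw[symmetric] using q K by (intro powr_mono2) auto
    have "lap (cmod z) \<le> K * \<tau> (cmod z) powr (- 2)"
    proof -
      have "lap (cmod z) \<le> K / (\<tau> (cmod z))^2"
        by (subst pos_le_divide_eq) (use hi[OF z] t in \<open>simp_all add: mult.commute\<close>)
      then show ?thesis unfolding m2 by simp
    qed
    then show "laplacian (radial \<psi>) z powr (1 / q) \<le> K powr (1 / q) * \<tau> (cmod z) powr (- (2 / q))"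
      unfolding L pw[symmetric] using q less_imp_le[OF lp] by (intro powr_mono2) auto
  qed
qed

lemma volterra_bounded_iff:
  assumes p: "0 < p" and g: "g holomorphic_on UNIV"
  shows "bounded_operator \<psi> p \<infinity> (volterra g) \<longleftrightarrow>
    (\<exists>B S. \<forall>z. S \<le> cmod z \<longrightarrow> cmod (deriv g z) * \<tau> (cmod z) powr (- decay p) \<le> B * (1 + radial \<psi>' z))"
  using volterra_bounded_if[OF p g] volterra_bounded_only_if[OF p g] by blast

lemma volterra_compact_iff:
  assumes p: "0 < p" and g: "g holomorphic_on UNIV"
  shows "compact_operator \<psi> p \<infinity> (volterra g) \<longleftrightarrow>
    (\<forall>e>0. \<exists>S. \<forall>z. S \<le> cmod z \<longrightarrow> cmod (deriv g z) * \<tau> (cmod z) powr (- decay p) \<le> e * (1 + radial \<psi>' z))"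
  using volterra_compact_if[OF p g] volterra_compact_only_if[OF p g] by blast

end

theorem theorem1p1:
  fixes \<psi> \<psi>' \<psi>'' \<tau> :: "real \<Rightarrow> real" and g :: "complex \<Rightarrow> complex" and p :: ennreal
  assumes "admissible_weight \<psi> \<psi>' \<psi>'' \<tau>"
    and "g holomorphic_on UNIV"
    and "0 < p"
  shows
    "(bounded_operator \<psi> p \<infinity> (volterra g) \<longleftrightarrow>
        (if p = \<infinity>
         then bdd_above (range (\<lambda>z. cmod (deriv g z) / (1 + radial \<psi>' z)))
         else bdd_above (range (\<lambda>z. cmod (deriv g z) *
                laplacian (radial \<psi>) z powr (1 / enn2real p) / (1 + radial \<psi>' z))))) \<and>
     (compact_operator \<psi> p \<infinity> (volterra g) \<longleftrightarrow>
        (if p = \<infinity>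
         then ((\<lambda>z. cmod (deriv g z) / (1 + radial \<psi>' z)) \<longlongrightarrow> 0) at_infinity
         else ((\<lambda>z. cmod (deriv g z) *
                laplacian (radial \<psi>) z powr (1 / enn2real p) / (1 + radial \<psi>' z))
                \<longlongrightarrow> 0) at_infinity)) \<and>
     (p < \<infinity> \<longrightarrow>
        (bounded_operator \<psi> \<infinity> p (volterra g) \<longleftrightarrow> compact_operator \<psi> \<infinity> p (volterra g)) \<and>
        (compact_operator \<psi> \<infinity> p (volterra g) \<longleftrightarrow>
          (\<lambda>z. deriv g z / of_real (1 + radial \<psi>' z)) \<in> Lp_space (enn2real p)))"
proof -
  note g = assms(2) and p = assms(3)
  interpret admissible_weight \<psi> \<psi>' \<psi>'' \<tau> by (rule assms(1))
  obtain R c C where "scaled_weight \<psi> \<psi>' \<psi>'' \<tau> R c C" by (rule scaled_weight_exists)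
  then interpret scaled_weight \<psi> \<psi>' \<psi>'' \<tau> R c C .
  obtain \<delta> K where "stepped_weight \<psi> \<psi>' \<psi>'' \<tau> R c C \<delta> K" by (rule stepped_weight_exists)
  then interpret stepped_weight \<psi> \<psi>' \<psi>'' \<tau> R c C \<delta> K .
  show ?thesis
    using p
  proof (cases p rule: ennreal_exponent_cases)
    case 1
    have t: "0 < \<tau> (cmod z)" for z using tau_positive[of "cmod z"] by simp
    have d: "\<tau> (cmod z) powr (- decay p) = 1" for z using t[of z] 1 by (simp add: decay_def)
    have "bdd_above (range (\<lambda>z. cmod (deriv g z) * 1 / (1 + radial \<psi>' z))) \<longleftrightarrow> bounded_operator \<psi> p \<infinity> (volterra g)"
      unfolding volterra_bounded_iff[OF p g]
      by (rule growth_condition_iff(1)[OF g, where ?c1.0 = 1 and ?c2.0 = 1]) (auto simp: d)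
    moreover have "((\<lambda>z. cmod (deriv g z) * 1 / (1 + radial \<psi>' z)) \<longlongrightarrow> 0) at_infinity \<longleftrightarrow> compact_operator \<psi> p \<infinity> (volterra g)"
      unfolding volterra_compact_iff[OF p g]
      by (rule growth_condition_iff(2)[OF g, where ?c1.0 = 1 and ?c2.0 = 1]) (auto simp: d)
    ultimately show ?thesis using 1 by simp
  next
    case (2 q)
    have pq: "enn2real p = q" "p < \<infinity>" "p \<noteq> \<infinity>" using 2 by auto
    have dq: "decay p = 2 / q" using 2 by (simp add: decay_def)
    obtain c1 c2 where c1: "0 < c1"
      and lo: "\<And>z. 1 \<le> cmod z \<Longrightarrow> c1 * \<tau> (cmod z) powr (- (2 / q)) \<le> laplacian (radial \<psi>) z powr (1 / q)"
      and hi: "\<And>z. 1 \<le> cmod z \<Longrightarrow> laplacian (radial \<psi>) z powr (1 / q) \<le> c2 * \<tau> (cmod z) powr (- (2 / q))"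
      by (rule laplacian_powr_comparable[OF 2(1)]) blast
    have loc: "\<exists>B. \<forall>z. cmod z \<le> S \<longrightarrow> laplacian (radial \<psi>) z powr (1 / q) \<le> B" for S
    proof -
      obtain B where B: "\<And>z. cmod z \<le> S \<Longrightarrow> laplacian (radial \<psi>) z \<le> B"
        by (rule laplacian_locally_bounded[of S]) blast
      have "laplacian (radial \<psi>) z powr (1 / q) \<le> B powr (1 / q)" if "cmod z \<le> S" for z
        using B[OF that] laplacian_pos[of z] 2(1) by (intro powr_mono2) auto
      then show ?thesis by blast
    qed
    note growth = growth_condition_iff[OF g c1 powr_ge_zero lo hi loc]
    \<comment> \<open>Bounded and compact operators both map the space into the target. Mapping
      alone gives the integrability of the symbol density, and this in turn gives boundedness as
      well as compactness.\<close>
    have "bounded_operator \<psi> \<infinity> (ennreal q) (volterra g) \<longleftrightarrow> (\<integral>\<^sup>+w. ennreal (symbol_density q g w) \<partial>lborel) < \<infinity>"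
      "compact_operator \<psi> \<infinity> (ennreal q) (volterra g) \<longleftrightarrow> (\<integral>\<^sup>+w. ennreal (symbol_density q g w) \<partial>lborel) < \<infinity>"
      using symbol_density_finite_if_maps[OF 2(1) g] volterra_bounded_if_density_finite[OF 2(1) g]
        volterra_compact_if_density_finite[OF 2(1) g]
      unfolding bounded_operator_def compact_operator_def by blast+
    then show ?thesis
      using growth volterra_bounded_iff[OF p g] volterra_compact_iff[OF p g] quotient_in_Lp_iff[OF g, of q] pq dq
      unfolding 2(2)[symmetric] by simp
  qed
qed

end
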